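(* Let $\Sigma$ be a finite CW complex of dimension $d$ with $n$ facets, and let $\mathcal{C}=\operatorname{im}_{\mathbb{Z}}\partial_d^*\subseteq\mathbb{Z}^n$ and $\mathcal{F}=\ker_{\mathbb{Z}}\partial_d\subseteq\mathbb{Z}^n$ be its cut and flow lattices. Then there is a commutative diagram with exact rows $$\begin{array}{ccccccccc} 0\to & \mathbb{Z}^n/(\mathcal{C}\oplus\mathcal{F}) & \xrightarrow{\ \psi\ } & \mathcal{C}^\sharp/\mathcal{C} & \to & \operatorname{tor}(\tilde H^d(\Sigma;\mathbb{Z})) & \to 0\\ & \downarrow\alpha & & \downarrow\beta & & \downarrow\gamma & \\ 0\to & \operatorname{im}\partial_d/\operatorname{im}\partial_d\partial_d^* & \to & K(\Sigma) & \to & \operatorname{tor}(\tilde H_{d-1}(\Sigma;\mathbb{Z})) & \to 0 \end{array}$$ in which the vertical maps $\alpha,\beta,\gamma$ are all isomorphisms, and $\psi$ is induced by orthogonal projection of $\mathbb{R}^n$ onto $\mathcal{C}\otimes\mathbb{R}$. In particular $K(\Sigma)\cong\mathcal{C}^\sharp/\mathcal{C}$.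
   Context: $\Sigma$ is a finite CW complex with the convention that it has a unique cell of dimension $-1$ (so cellular homology is reduced homology $\tilde H_*$); $d$-cells are called facets. Cells are oriented, so $C_i(\Sigma;\mathbb{Z})\cong\mathbb{Z}^{\Sigma_i}$, with $\partial_i:C_i\to C_{i-1}$ the cellular boundary map and $\partial_i^*:C_{i-1}\to C_i$ its transpose (the coboundary map), identifying $C_d(\Sigma;\mathbb{Z})$ and $C^d(\Sigma;\mathbb{Z})$ with $\mathbb{Z}^n$ using the standard inner product in which the facets are orthonormal. All kernels and images are over $\mathbb{Z}$ unless indicated. For a lattice $\mathcal{L}\subseteq\mathbb{R}^n$, its dual is $\mathcal{L}^\sharp=\{v\in\mathcal{L}\otimes\mathbb{R}:\langle v,w\rangle\in\mathbb{Z}\ \forall w\in\mathcal{L}\}$. The critical group is $K(\Sigma)=\operatorname{tor}(\ker\partial_{d-1}/\operatorname{im}\partial_d\partial_d^* )$, where $\operatorname{tor}$ denotes the torsion subgroup. *)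

theory Defs
  imports "HOL-Homology.Homology" "HOL-Algebra.Exact_Sequence"
begin

section \<open>Finite CW complexes with oriented cells\<close>

text \<open>
  For \<open>k = 0\<close> the closed and the open disk are both the one-point space and the bounding
  sphere is empty.
\<close>

definition disk :: "nat \<Rightarrow> (nat \<Rightarrow> real) topology" where
  "disk k = subtopology (Euclidean_space k) {x. (\<Sum>i<k. (x i)\<^sup>2) \<le> 1}"

definition open_disk :: "nat \<Rightarrow> (nat \<Rightarrow> real) set" where
  "open_disk k = {x \<in> topspace (disk k). (\<Sum>i<k. (x i)\<^sup>2) < 1}"

definition disk_boundary :: "nat \<Rightarrow> (nat \<Rightarrow> real) set" where
  "disk_boundary k = {x \<in> topspace (disk k). (\<Sum>i<k. (x i)\<^sup>2) = 1}"

text \<open>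
  \<open>cells \<Sigma> i\<close> indexes the \<open>i\<close>-cells. The unique cell of dimension \<open>-1\<close> carries no topology:
  the characteristic map and the orientation matter only for \<open>i \<ge> 0\<close>.
  The orientation of an \<open>i\<close>-cell is a homology class of the disk relative to its boundary.
\<close>

record ('a, 'c) oriented_CW =
  total_space :: "'a topology"
  cells :: "int \<Rightarrow> 'c set"
  char_map :: "int \<Rightarrow> 'c \<Rightarrow> (nat \<Rightarrow> real) \<Rightarrow> 'a"
  orientation :: "int \<Rightarrow> 'c \<Rightarrow> (nat \<Rightarrow> real) chain set"

definition open_cell :: "('a, 'c) oriented_CW \<Rightarrow> int \<Rightarrow> 'c \<Rightarrow> 'a set" where
  "open_cell \<Sigma> i \<sigma> = char_map \<Sigma> i \<sigma> ` open_disk (nat i)"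

definition skeleton :: "('a, 'c) oriented_CW \<Rightarrow> int \<Rightarrow> 'a set" where
  "skeleton \<Sigma> i = (\<Union>j\<in>{0..i}. \<Union>\<sigma>\<in>cells \<Sigma> j. open_cell \<Sigma> j \<sigma>)"

abbreviation skeleton_space :: "('a, 'c) oriented_CW \<Rightarrow> int \<Rightarrow> 'a topology" where
  "skeleton_space \<Sigma> i \<equiv> subtopology (total_space \<Sigma>) (skeleton \<Sigma> i)"

abbreviation disk_homology :: "int \<Rightarrow> (nat \<Rightarrow> real) chain set monoid" where
  "disk_homology i \<equiv> relative_homology_group i (disk (nat i)) (disk_boundary (nat i))"

text \<open>
  The topological part is the usual characterization of a CW structure on a Hausdorff space by
  characteristic maps; closure finiteness and the weak topology are automatic when there are
  only finitely many cells. All vertices are oriented by the same generator of the homology of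
  the point, in accordance with the convention that every vertex has boundary \<open>+1\<close> times the
  \<open>-1\<close>-cell.
\<close>

definition finite_CW :: "('a, 'c) oriented_CW \<Rightarrow> bool" where
  "finite_CW \<Sigma> \<longleftrightarrow>
     Hausdorff_space (total_space \<Sigma>) \<and>
     finite (SIGMA i:UNIV. cells \<Sigma> i) \<and>
     (\<exists>e. cells \<Sigma> (-1) = {e}) \<and>
     (\<forall>i < -1. cells \<Sigma> i = {}) \<and>
     (\<forall>i\<ge>0. \<forall>\<sigma>\<in>cells \<Sigma> i.
        continuous_map (disk (nat i)) (total_space \<Sigma>) (char_map \<Sigma> i \<sigma>) \<and>
        embedding_map (subtopology (disk (nat i)) (open_disk (nat i))) (total_space \<Sigma>)
          (char_map \<Sigma> i \<sigma>) \<and>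
        char_map \<Sigma> i \<sigma> ` disk_boundary (nat i) \<subseteq> skeleton \<Sigma> (i - 1)) \<and>
     disjoint_family_on (\<lambda>(i, \<sigma>). open_cell \<Sigma> i \<sigma>) (SIGMA i:{0..}. cells \<Sigma> i) \<and>
     (\<Union>i\<in>{0..}. skeleton \<Sigma> i) = topspace (total_space \<Sigma>) \<and>
     (\<forall>i\<ge>0. \<forall>\<sigma>\<in>cells \<Sigma> i.
        orientation \<Sigma> i \<sigma> \<in> carrier (disk_homology i) \<and>
        generate (disk_homology i) {orientation \<Sigma> i \<sigma>} = carrier (disk_homology i)) \<and>
     (\<forall>\<sigma>\<in>cells \<Sigma> 0. \<forall>\<tau>\<in>cells \<Sigma> 0. orientation \<Sigma> 0 \<sigma> = orientation \<Sigma> 0 \<tau>)"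

definition CW_dimension :: "('a, 'c) oriented_CW \<Rightarrow> int \<Rightarrow> bool" where
  "CW_dimension \<Sigma> d \<longleftrightarrow> cells \<Sigma> d \<noteq> {} \<and> (\<forall>i>d. cells \<Sigma> i = {})"


section \<open>The cellular chain complex\<close>

abbreviation skeletal_homology :: "('a, 'c) oriented_CW \<Rightarrow> int \<Rightarrow> 'a chain set monoid" where
  "skeletal_homology \<Sigma> i \<equiv> relative_homology_group i (skeleton_space \<Sigma> i) (skeleton \<Sigma> (i - 1))"

definition cell_class :: "('a, 'c) oriented_CW \<Rightarrow> int \<Rightarrow> 'c \<Rightarrow> 'a chain set" where
  "cell_class \<Sigma> i \<sigma> =
     hom_induced i (disk (nat i)) (disk_boundary (nat i)) (skeleton_space \<Sigma> i) (skeleton \<Sigma> (i - 1))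
       (char_map \<Sigma> i \<sigma>) (orientation \<Sigma> i \<sigma>)"

text \<open>
  For \<open>i \<ge> 1\<close>, \<open>incidence \<Sigma> i \<sigma> \<tau>\<close> is the coefficient of \<open>\<tau>\<close> in the cellular boundary of \<open>\<sigma>\<close>: the
  homology of the \<open>(i - 1)\<close>-skeleton relative to the \<open>(i - 2)\<close>-skeleton (in multiplicative notation)
  is free abelian on the classes of the \<open>(i - 1)\<close>-cells, and the cellular boundary is the connecting
  map of the triple of skeleta. For \<open>i = 0\<close> it is the augmentation.
\<close>

definition incidence :: "('a, 'c) oriented_CW \<Rightarrow> int \<Rightarrow> 'c \<Rightarrow> 'c \<Rightarrow> int" where
  "incidence \<Sigma> i \<sigma> =
     (if i = 0 then (\<lambda>\<tau>. 1)
      else (THE a. (\<forall>\<tau>. \<tau> \<notin> cells \<Sigma> (i - 1) \<longrightarrow> a \<tau> = 0) \<and>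
              hom_relboundary i (skeleton_space \<Sigma> i) (skeleton \<Sigma> (i - 1)) (skeleton \<Sigma> (i - 2))
                (cell_class \<Sigma> i \<sigma>) =
              finprod (skeletal_homology \<Sigma> (i - 1))
                (\<lambda>\<tau>. cell_class \<Sigma> (i - 1) \<tau> [^]\<^bsub>skeletal_homology \<Sigma> (i - 1)\<^esub> a \<tau>)
                (cells \<Sigma> (i - 1))))"

text \<open>
  Chains are real-valued functions on cells supported on the cells of the given dimension;
  integral chains are the lattice of integer-valued ones. Cochains are identified with chains.
\<close>

definition int_chains :: "('a, 'c) oriented_CW \<Rightarrow> int \<Rightarrow> ('c \<Rightarrow> real) set" where
  "int_chains \<Sigma> i = {c. (\<forall>\<sigma>. c \<sigma> \<in> \<int>) \<and> (\<forall>\<sigma>. \<sigma> \<notin> cells \<Sigma> i \<longrightarrow> c \<sigma> = 0)}"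

definition bd :: "('a, 'c) oriented_CW \<Rightarrow> int \<Rightarrow> ('c \<Rightarrow> real) \<Rightarrow> 'c \<Rightarrow> real" where
  "bd \<Sigma> i c =
     (\<lambda>\<tau>. if \<tau> \<in> cells \<Sigma> (i - 1) then \<Sum>\<sigma>\<in>cells \<Sigma> i. of_int (incidence \<Sigma> i \<sigma> \<tau>) * c \<sigma> else 0)"

text \<open>\<open>cobd \<Sigma> i\<close> is the transpose of \<open>bd \<Sigma> i\<close>, so it maps \<open>(i - 1)\<close>-chains to \<open>i\<close>-chains.\<close>

definition cobd :: "('a, 'c) oriented_CW \<Rightarrow> int \<Rightarrow> ('c \<Rightarrow> real) \<Rightarrow> 'c \<Rightarrow> real" where
  "cobd \<Sigma> i c =
     (\<lambda>\<sigma>. if \<sigma> \<in> cells \<Sigma> i then \<Sum>\<tau>\<in>cells \<Sigma> (i - 1). of_int (incidence \<Sigma> i \<sigma> \<tau>) * c \<tau> else 0)"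

definition im_bd :: "('a, 'c) oriented_CW \<Rightarrow> int \<Rightarrow> ('c \<Rightarrow> real) set" where
  "im_bd \<Sigma> i = bd \<Sigma> i ` int_chains \<Sigma> i"

definition ker_bd :: "('a, 'c) oriented_CW \<Rightarrow> int \<Rightarrow> ('c \<Rightarrow> real) set" where
  "ker_bd \<Sigma> i = {c \<in> int_chains \<Sigma> i. bd \<Sigma> i c = (\<lambda>_. 0)}"

definition im_cobd :: "('a, 'c) oriented_CW \<Rightarrow> int \<Rightarrow> ('c \<Rightarrow> real) set" where
  "im_cobd \<Sigma> i = cobd \<Sigma> i ` int_chains \<Sigma> (i - 1)"

definition ker_cobd :: "('a, 'c) oriented_CW \<Rightarrow> int \<Rightarrow> ('c \<Rightarrow> real) set" where
  "ker_cobd \<Sigma> i = {c \<in> int_chains \<Sigma> (i - 1). cobd \<Sigma> i c = (\<lambda>_. 0)}"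

definition im_bd_cobd :: "('a, 'c) oriented_CW \<Rightarrow> int \<Rightarrow> ('c \<Rightarrow> real) set" where
  "im_bd_cobd \<Sigma> i = (bd \<Sigma> i \<circ> cobd \<Sigma> i) ` int_chains \<Sigma> (i - 1)"


section \<open>Homology, cohomology and the critical group\<close>

definition vec_group :: "('c \<Rightarrow> real) set \<Rightarrow> ('c \<Rightarrow> real) monoid" where
  "vec_group L = \<lparr>carrier = L, mult = (\<lambda>u v \<sigma>. u \<sigma> + v \<sigma>), one = (\<lambda>_. 0)\<rparr>"

definition torsion_subgroup :: "('g, 'm) monoid_scheme \<Rightarrow> ('g, 'm) monoid_scheme" where
  "torsion_subgroup G = G\<lparr>carrier := {x \<in> carrier G. \<exists>n::nat. n > 0 \<and> x [^]\<^bsub>G\<^esub> n = \<one>\<^bsub>G\<^esub>}\<rparr>"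

text \<open>By the convention on the \<open>-1\<close>-cell these are the reduced groups.\<close>

definition cell_homology :: "('a, 'c) oriented_CW \<Rightarrow> int \<Rightarrow> ('c \<Rightarrow> real) set monoid" where
  "cell_homology \<Sigma> i = vec_group (ker_bd \<Sigma> i) Mod im_bd \<Sigma> (i + 1)"

definition cell_cohomology :: "('a, 'c) oriented_CW \<Rightarrow> int \<Rightarrow> ('c \<Rightarrow> real) set monoid" where
  "cell_cohomology \<Sigma> i = vec_group (ker_cobd \<Sigma> (i + 1)) Mod im_cobd \<Sigma> i"

definition critical_group :: "('a, 'c) oriented_CW \<Rightarrow> int \<Rightarrow> ('c \<Rightarrow> real) set monoid" where
  "critical_group \<Sigma> d = torsion_subgroup (vec_group (ker_bd \<Sigma> (d - 1)) Mod im_bd_cobd \<Sigma> d)"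


section \<open>Lattices\<close>

text \<open>The real span of \<open>L\<close>, playing the role of the tensor product of \<open>L\<close> with the reals.\<close>

definition real_span :: "('c \<Rightarrow> real) set \<Rightarrow> ('c \<Rightarrow> real) set" where
  "real_span L = {(\<lambda>\<sigma>. \<Sum>w\<in>W. a w * w \<sigma>) | W a. finite W \<and> W \<subseteq> L}"

definition std_inner :: "'c set \<Rightarrow> ('c \<Rightarrow> real) \<Rightarrow> ('c \<Rightarrow> real) \<Rightarrow> real" where
  "std_inner A u v = (\<Sum>\<sigma>\<in>A. u \<sigma> * v \<sigma>)"

definition dual_lattice :: "'c set \<Rightarrow> ('c \<Rightarrow> real) set \<Rightarrow> ('c \<Rightarrow> real) set" where
  "dual_lattice A L = {v \<in> real_span L. \<forall>w\<in>L. std_inner A v w \<in> \<int>}"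

definition orth_proj :: "'c set \<Rightarrow> ('c \<Rightarrow> real) set \<Rightarrow> ('c \<Rightarrow> real) \<Rightarrow> 'c \<Rightarrow> real" where
  "orth_proj A U v = (THE u. u \<in> U \<and> (\<forall>w\<in>U. std_inner A (\<lambda>\<sigma>. v \<sigma> - u \<sigma>) w = 0))"

definition cut_lattice :: "('a, 'c) oriented_CW \<Rightarrow> int \<Rightarrow> ('c \<Rightarrow> real) set" where
  "cut_lattice \<Sigma> d = im_cobd \<Sigma> d"

definition flow_lattice :: "('a, 'c) oriented_CW \<Rightarrow> int \<Rightarrow> ('c \<Rightarrow> real) set" where
  "flow_lattice \<Sigma> d = ker_bd \<Sigma> d"

end

(* The only topological input is that the cellular boundary squares to zero. For this the relative
   homology of consecutive skeleta has to be free on the cell classes, since the incidence numbers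
   are coordinates in this basis: the characteristic map of a single attached cell induces an
   isomorphism onto relative homology (deform the cell outwards, then excise), and the skeleton is
   built up one cell at a time.

   The rest is lattice theory. Each of the isomorphisms alpha and beta is induced by the boundary
   map D, with transpose T. The boundary map is injective on the real span of the cuts, and a vector
   u of this span lies in the dual lattice iff D u is integral, in which case some multiple of u is
   an integral cut; this identifies the dual lattice modulo cuts with the critical group. For gamma,
   D is diagonalized over the integers, so that D and T have cokernels with isomorphic torsion. Since
   gamma is not canonical, the upper right map is obtained by transporting the lower row along
   alpha, beta and gamma. *)

theory Submission
  imports Defs
begin

section \<open>Diagonalization of integer matrices\<close>

text \<open>Two obstacles shape the proof. The incidence numbers are a definite description, so
  nothing is known about the boundary map until coordinates with respect to the cell classes exist
  and are unique. The topological half proves this only to obtain one matrix identity; the rest, in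
  the locale \<open>cut_flow\<close>, sees a finite integer matrix and a subgroup K of integral
  chains that is closed under division by positive integers. The other obstacle is the passage
  between reals and integers. The dual lattice lies in a real span, while torsion asks for an
  integral multiple. A real w for which D (T w) is integral may be irrational, yet the cut T w is
  rational; this is shown with an additive map from the reals to the rationals instead of
  determinants. In the same spirit the orthogonal projection comes from solving the normal equations
  by induction, because the Gram matrix of the cuts of unit vectors may be singular. Every torsion
  subgroup is rewritten as the quotient of \<open>saturation X N\<close> by \<open>N\<close>, so
  that the diagram compares sets of vectors.\<close>

definition diagonalizable :: "'a set \<Rightarrow> 'b set \<Rightarrow> ('a \<Rightarrow> 'b \<Rightarrow> int) \<Rightarrow> bool" where
  "diagonalizable A B M \<longleftrightarrow> (\<exists>(r::nat) p \<xi> \<eta> x y. (\<forall>i<r. p i \<noteq> 0) \<and>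
     (\<forall>i<r. \<forall>j<r. (\<Sum>a\<in>A. \<xi> i a * x j a) = of_bool (i = j)) \<and>
     (\<forall>i<r. \<forall>j<r. (\<Sum>b\<in>B. \<eta> i b * y j b) = of_bool (i = j)) \<and>
     (\<forall>a\<in>A. \<forall>b\<in>B. M a b = (\<Sum>i<r. p i * \<xi> i a * \<eta> i b)))"

text \<open>The dual systems of \<open>diagonalizable\<close> take the place of unimodular changes
  of basis: a dual family x shows that the functionals \<xi> span a direct summand. To add a pair,
  the old dual vectors are corrected by multiples of \<open>x\<^sub>0\<close> so that the new
  functional kills them; the old functionals do not notice, as they vanish on
  \<open>x\<^sub>0\<close>.\<close>

lemma biorthogonal_extend:
  fixes \<xi> :: "nat \<Rightarrow> 'a \<Rightarrow> int"
  assumes bi: "\<And>i j. i < r \<Longrightarrow> j < r \<Longrightarrow> (\<Sum>a\<in>A. \<xi> i a * x j a) = of_bool (i = j)"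
    and new: "(\<Sum>a\<in>A. \<xi>\<^sub>0 a * x\<^sub>0 a) = 1" and orth: "\<And>i. i < r \<Longrightarrow> (\<Sum>a\<in>A. \<xi> i a * x\<^sub>0 a) = 0"
    and i: "i < Suc r" and j: "j < Suc r"
  shows "(\<Sum>a\<in>A. (\<xi>(r := \<xi>\<^sub>0)) i a * ((\<lambda>j a. x j a - (\<Sum>c\<in>A. \<xi>\<^sub>0 c * x j c) * x\<^sub>0 a)(r := x\<^sub>0)) j a) = of_bool (i = j)"
proof -
  have s: "(\<Sum>a\<in>A. \<zeta> a * (x j a - q * x\<^sub>0 a)) = (\<Sum>a\<in>A. \<zeta> a * x j a) - q * (\<Sum>a\<in>A. \<zeta> a * x\<^sub>0 a)" for \<zeta> q
    by (simp add: algebra_simps sum_subtractf sum_distrib_left)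
  consider "i = r" "j = r" | "i = r" "j < r" | "i < r" "j = r" | "i < r" "j < r" using i j by linarith
  then show ?thesis
    using new orth bi by cases (simp_all add: s)
qed

lemma sum_rotate: "(\<Sum>b\<in>B. \<Sum>a\<in>A. \<Sum>j\<in>J. f b a j) = (\<Sum>j\<in>J. \<Sum>b\<in>B. \<Sum>a\<in>A. f b a j)"
proof -
  have "(\<Sum>b\<in>B. \<Sum>a\<in>A. \<Sum>j\<in>J. f b a j) = (\<Sum>b\<in>B. \<Sum>j\<in>J. \<Sum>a\<in>A. f b a j)"
    by (intro sum.cong refl sum.swap)
  also have "\<dots> = (\<Sum>j\<in>J. \<Sum>b\<in>B. \<Sum>a\<in>A. f b a j)" by (rule sum.swap)
  finally show ?thesis .
qed

text \<open>A nonzero value \<open>p\<close> of least absolute value of the bilinear form of \<open>M\<close>, attained at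
  \<open>(x\<^sub>0, y\<^sub>0)\<close>, divides all values in which \<open>x\<^sub>0\<close> or \<open>y\<^sub>0\<close> is an argument. Hence a rank one matrix
  can be split off. This enlarges the set \<open>K M\<close> of supports modulo 2 of kernel vectors, which
  bounds the number of steps.\<close>

theorem diagonalizable:
  fixes M :: "'a \<Rightarrow> 'b \<Rightarrow> int"
  assumes A: "finite A" and B: "finite B"
  shows "diagonalizable A B M"
proof -
  define K :: "('a \<Rightarrow> 'b \<Rightarrow> int) \<Rightarrow> 'a set set" where
    "K M = (\<lambda>x. {a \<in> A. odd (x a)}) ` {x. \<forall>b\<in>B. (\<Sum>a\<in>A. x a * M a b) = 0}" for M
  have KA: "K M \<subseteq> Pow A" for M by (auto simp: K_def)
  then have fK: "finite (K M)" and cK: "card (K M) \<le> card (Pow A)" for M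
    using A by (meson finite_Pow_iff finite_subset, meson card_mono finite_Pow_iff)
  show ?thesis
  proof (induction "card (Pow A) - card (K M)" arbitrary: M rule: less_induct)
    case less
    define L where "L x b = (\<Sum>a\<in>A. x a * M a b)" for x b
    define R where "R y a = (\<Sum>b\<in>B. M a b * y b)" for y a
    define \<beta> where "\<beta> x y = (\<Sum>b\<in>B. L x b * y b)" for x y
    have \<beta>R: "\<beta> x y = (\<Sum>a\<in>A. R y a * x a)" for x y
      unfolding \<beta>_def L_def R_def sum_distrib_right by (subst sum.swap) (simp add: ac_simps)
    have \<beta>y: "\<beta> x (\<lambda>b. y b - q * z b) = \<beta> x y - q * \<beta> x z" for x y z q
      unfolding \<beta>_def by (simp add: algebra_simps sum_subtractf sum_distrib_left)
    have \<beta>x: "\<beta> (\<lambda>a. x a - q * z a) y = \<beta> x y - q * \<beta> z y" for x y z q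
      unfolding \<beta>R by (simp add: algebra_simps sum_subtractf sum_distrib_left)
    have \<beta>1: "\<beta> x (\<lambda>b. of_bool (b = b')) = L x b'" if "b' \<in> B" for x b'
      unfolding \<beta>_def using that B by (simp add: of_bool_def if_distrib cong: if_cong)
    have \<beta>2: "\<beta> (\<lambda>a. of_bool (a = a')) y = R y a'" if "a' \<in> A" for y a'
      unfolding \<beta>R using that A by (simp add: of_bool_def if_distrib cong: if_cong)
    show ?case
    proof (cases "\<exists>a\<in>A. \<exists>b\<in>B. M a b \<noteq> 0")
      case False
      then show ?thesis unfolding diagonalizable_def by (intro exI[of _ 0]) auto
    next
      case True
      then obtain a b where ab: "a \<in> A" "b \<in> B" "M a b \<noteq> 0" by blast
      have "L (\<lambda>c. of_bool (c = a)) b = M a b" unfolding L_def using ab A by (simp add: of_bool_def if_distribR if_distrib cong: if_cong)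
      with ab have "\<beta> (\<lambda>c. of_bool (c = a)) (\<lambda>c. of_bool (c = b)) \<noteq> 0" by (simp add: \<beta>1)
      then have "case (\<lambda>c. of_bool (c = a), \<lambda>c. of_bool (c = b)) of (x, y) \<Rightarrow> \<beta> x y \<noteq> 0" by simp
      from ex_has_least_nat[of "\<lambda>(x, y). \<beta> x y \<noteq> 0", OF this, of "\<lambda>(x, y). nat \<bar>\<beta> x y\<bar>"]
      obtain x\<^sub>0 y\<^sub>0 where nz: "\<beta> x\<^sub>0 y\<^sub>0 \<noteq> 0"
        and least: "\<And>x y. \<beta> x y \<noteq> 0 \<Longrightarrow> nat \<bar>\<beta> x\<^sub>0 y\<^sub>0\<bar> \<le> nat \<bar>\<beta> x y\<bar>" by auto
      define p where "p = \<beta> x\<^sub>0 y\<^sub>0"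
      have zero: "\<beta> x y = 0" if "\<bar>\<beta> x y\<bar> < \<bar>p\<bar>" for x y
        using least[of x y] that unfolding p_def by linarith
      \<comment> \<open>The remainder modulo p is again a value of \<beta>, at a unit vector reduced
        by a multiple of \<open>y\<^sub>0\<close>. Being smaller than p in absolute value, it
        vanishes by minimality.\<close>
      have dvdL: "p dvd L x\<^sub>0 b" if b: "b \<in> B" for b
      proof -
        have "\<beta> x\<^sub>0 (\<lambda>c. of_bool (c = b) - (L x\<^sub>0 b div p) * y\<^sub>0 c) = L x\<^sub>0 b mod p"
          by (simp add: \<beta>y \<beta>1 b minus_div_mult_eq_mod flip: p_def)
        with zero[of x\<^sub>0 "\<lambda>c. of_bool (c = b) - (L x\<^sub>0 b div p) * y\<^sub>0 c"] nz abs_mod_less[of p "L x\<^sub>0 b"]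
        show ?thesis by (simp add: p_def mod_0_imp_dvd)
      qed
      have dvdR: "p dvd R y\<^sub>0 a" if a: "a \<in> A" for a
      proof -
        have "\<beta> (\<lambda>c. of_bool (c = a) - (R y\<^sub>0 a div p) * x\<^sub>0 c) y\<^sub>0 = R y\<^sub>0 a mod p"
          by (simp add: \<beta>x \<beta>2 a minus_div_mult_eq_mod flip: p_def)
        with zero[of "\<lambda>c. of_bool (c = a) - (R y\<^sub>0 a div p) * x\<^sub>0 c" y\<^sub>0] nz abs_mod_less[of p "R y\<^sub>0 a"]
        show ?thesis by (simp add: p_def mod_0_imp_dvd)
      qed
      have p0: "p \<noteq> 0" using nz by (simp add: p_def)
      define \<eta>\<^sub>0 where "\<eta>\<^sub>0 b = L x\<^sub>0 b div p" for b
      define \<xi>\<^sub>0 where "\<xi>\<^sub>0 a = R y\<^sub>0 a div p" for a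
      have \<eta>: "p * \<eta>\<^sub>0 b = L x\<^sub>0 b" if "b \<in> B" for b using dvdL[OF that] by (simp add: \<eta>\<^sub>0_def)
      have \<xi>: "p * \<xi>\<^sub>0 a = R y\<^sub>0 a" if "a \<in> A" for a using dvdR[OF that] by (simp add: \<xi>\<^sub>0_def)
      have p\<xi>: "p * (\<Sum>a\<in>A. \<xi>\<^sub>0 a * x a) = \<beta> x y\<^sub>0" for x
        unfolding \<beta>R sum_distrib_left by (intro sum.cong refl) (simp add: \<xi> flip: mult.assoc)
      have p\<eta>: "p * (\<Sum>b\<in>B. \<eta>\<^sub>0 b * y b) = \<beta> x\<^sub>0 y" for y
        unfolding \<beta>_def sum_distrib_left by (intro sum.cong refl) (simp add: \<eta> flip: mult.assoc)
      have \<xi>1: "(\<Sum>a\<in>A. \<xi>\<^sub>0 a * x\<^sub>0 a) = 1" using p\<xi>[of x\<^sub>0] p0 by (simp flip: p_def)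
      have \<eta>1: "(\<Sum>b\<in>B. \<eta>\<^sub>0 b * y\<^sub>0 b) = 1" using p\<eta>[of y\<^sub>0] p0 by (simp flip: p_def)
      \<comment> \<open>Subtracting this rank one matrix puts \<open>x\<^sub>0\<close> into the left
        kernel and \<open>y\<^sub>0\<close> into the right kernel (\<open>L'0\<close>,
        \<open>R'0\<close>), which later gives orthogonality to the system obtained for
        \<open>M'\<close>.\<close>
      define M' where "M' a b = M a b - p * \<xi>\<^sub>0 a * \<eta>\<^sub>0 b" for a b
      have L': "(\<Sum>a\<in>A. x a * M' a b) = L x b - p * (\<Sum>a\<in>A. \<xi>\<^sub>0 a * x a) * \<eta>\<^sub>0 b" for x b
        unfolding M'_def L_def by (simp add: algebra_simps sum_subtractf sum_distrib_left sum_distrib_right)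
      have R': "(\<Sum>b\<in>B. M' a b * y b) = R y a - p * (\<Sum>b\<in>B. \<eta>\<^sub>0 b * y b) * \<xi>\<^sub>0 a" for y a
        unfolding M'_def R_def by (simp add: algebra_simps sum_subtractf sum_distrib_left sum_distrib_right)
      have L'0: "(\<Sum>a\<in>A. x\<^sub>0 a * M' a b) = 0" if "b \<in> B" for b using that by (simp add: L' \<xi>1 \<eta>)
      have R'0: "(\<Sum>b\<in>B. M' a b * y\<^sub>0 b) = 0" if "a \<in> A" for a using that by (simp add: R' \<eta>1 \<xi>)
      have ker: "(\<Sum>a\<in>A. \<xi>\<^sub>0 a * x a) = 0" if "\<forall>b\<in>B. L x b = 0" for x
        using p\<xi>[of x] p0 that by (simp add: \<beta>_def)
      have "K M \<subseteq> K M'"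
        unfolding K_def L' using ker by (auto simp flip: L_def)
      moreover have "{a \<in> A. odd (x\<^sub>0 a)} \<in> K M'" unfolding K_def using L'0 by blast
      \<comment> \<open>If a kernel vector x of M agreed with \<open>x\<^sub>0\<close> modulo 2,
        then \<open>\<xi>\<^sub>0\<close> would be even on the difference. But it kills x and is 1
        at \<open>x\<^sub>0\<close>. Reducing modulo 2 keeps the growing sets inside a finite power
        set.\<close>
      moreover have "{a \<in> A. odd (x\<^sub>0 a)} \<notin> K M"
      proof
        assume "{a \<in> A. odd (x\<^sub>0 a)} \<in> K M"
        then obtain x where x: "\<forall>b\<in>B. L x b = 0" "{a \<in> A. odd (x\<^sub>0 a)} = {a \<in> A. odd (x a)}"
          by (auto simp: K_def L_def)
        then have "even (x\<^sub>0 a - x a)" if "a \<in> A" for a using that by auto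
        then have "even (\<Sum>a\<in>A. \<xi>\<^sub>0 a * (x\<^sub>0 a - x a))" by (intro dvd_sum) simp
        also have "(\<Sum>a\<in>A. \<xi>\<^sub>0 a * (x\<^sub>0 a - x a)) = 1"
          using ker[OF x(1)] \<xi>1 by (simp add: right_diff_distrib sum_subtractf)
        finally show False by simp
      qed
      ultimately have "card (K M) < card (K M')" by (intro psubset_card_mono fK) auto
      then have "diagonalizable A B M'" using less[of M'] cK[of M'] by linarith
      then obtain r :: nat and q \<xi> \<eta> x y where d: "(\<forall>i<r. q i \<noteq> 0) \<and>
          (\<forall>i<r. \<forall>j<r. (\<Sum>a\<in>A. \<xi> i a * x j a) = of_bool (i = j)) \<and>
          (\<forall>i<r. \<forall>j<r. (\<Sum>b\<in>B. \<eta> i b * y j b) = of_bool (i = j)) \<and>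
          (\<forall>a\<in>A. \<forall>b\<in>B. M' a b = (\<Sum>i<r. q i * \<xi> i a * \<eta> i b))"
        unfolding diagonalizable_def by (elim exE)
      then have q: "\<And>i. i < r \<Longrightarrow> q i \<noteq> 0"
        and bi1: "\<And>i j. i < r \<Longrightarrow> j < r \<Longrightarrow> (\<Sum>a\<in>A. \<xi> i a * x j a) = of_bool (i = j)"
        and bi2: "\<And>i j. i < r \<Longrightarrow> j < r \<Longrightarrow> (\<Sum>b\<in>B. \<eta> i b * y j b) = of_bool (i = j)"
        and M': "\<And>a b. a \<in> A \<Longrightarrow> b \<in> B \<Longrightarrow> M' a b = (\<Sum>i<r. q i * \<xi> i a * \<eta> i b)"
        by blast+
      \<comment> \<open>\<open>x\<^sub>0\<close> is in the left kernel of \<open>M'\<close>. Pairing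
        the resulting zero row with \<open>y i\<close> isolates the term of index i in the
        decomposition, and \<open>q i\<close> is nonzero.\<close>
      have \<xi>x0: "(\<Sum>a\<in>A. \<xi> i a * x\<^sub>0 a) = 0" if i: "i < r" for i
      proof -
        have "0 = (\<Sum>b\<in>B. (\<Sum>a\<in>A. x\<^sub>0 a * M' a b) * y i b)" by (simp add: L'0)
        also have "\<dots> = (\<Sum>b\<in>B. \<Sum>a\<in>A. \<Sum>j<r. q j * (\<xi> j a * x\<^sub>0 a) * (\<eta> j b * y i b))"
          by (intro sum.cong refl) (simp add: M' sum_distrib_left sum_distrib_right ac_simps)
        also have "\<dots> = (\<Sum>j<r. \<Sum>b\<in>B. \<Sum>a\<in>A. q j * (\<xi> j a * x\<^sub>0 a) * (\<eta> j b * y i b))"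
          by (rule sum_rotate)
        also have "\<dots> = (\<Sum>j<r. q j * (\<Sum>a\<in>A. \<xi> j a * x\<^sub>0 a) * (\<Sum>b\<in>B. \<eta> j b * y i b))"
          by (simp add: sum_distrib_left sum_distrib_right)
        also have "\<dots> = q i * (\<Sum>a\<in>A. \<xi> i a * x\<^sub>0 a)"
          using i by (simp add: bi2 of_bool_def if_distrib cong: if_cong)
        finally show ?thesis using q[OF i] by simp
      qed
      have \<eta>y0: "(\<Sum>b\<in>B. \<eta> i b * y\<^sub>0 b) = 0" if i: "i < r" for i
      proof -
        have "0 = (\<Sum>a\<in>A. x i a * (\<Sum>b\<in>B. M' a b * y\<^sub>0 b))" by (simp add: R'0)
        also have "\<dots> = (\<Sum>a\<in>A. \<Sum>b\<in>B. \<Sum>j<r. q j * (\<xi> j a * x i a) * (\<eta> j b * y\<^sub>0 b))"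
          by (intro sum.cong refl) (simp add: M' sum_distrib_left sum_distrib_right ac_simps)
        also have "\<dots> = (\<Sum>j<r. \<Sum>a\<in>A. \<Sum>b\<in>B. q j * (\<xi> j a * x i a) * (\<eta> j b * y\<^sub>0 b))"
          by (rule sum_rotate)
        also have "\<dots> = (\<Sum>j<r. q j * (\<Sum>a\<in>A. \<xi> j a * x i a) * (\<Sum>b\<in>B. \<eta> j b * y\<^sub>0 b))"
          by (simp add: sum_distrib_left sum_distrib_right) (subst sum.swap, rule refl)
        also have "\<dots> = q i * (\<Sum>b\<in>B. \<eta> i b * y\<^sub>0 b)"
          using i by (simp add: bi1 of_bool_def if_distrib if_distribR cong: if_cong)
        finally show ?thesis using q[OF i] by simp
      qed
      let ?x = "(\<lambda>j a. x j a - (\<Sum>c\<in>A. \<xi>\<^sub>0 c * x j c) * x\<^sub>0 a)(r := x\<^sub>0)"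
      let ?y = "(\<lambda>j b. y j b - (\<Sum>c\<in>B. \<eta>\<^sub>0 c * y j c) * y\<^sub>0 b)(r := y\<^sub>0)"
      have 1: "\<forall>i<Suc r. (q(r := p)) i \<noteq> 0" using q p0 by (auto simp: less_Suc_eq)
      have 2: "\<forall>i<Suc r. \<forall>j<Suc r. (\<Sum>a\<in>A. (\<xi>(r := \<xi>\<^sub>0)) i a * ?x j a) = of_bool (i = j)"
        by (intro allI impI biorthogonal_extend bi1 \<xi>1 \<xi>x0)
      have 3: "\<forall>i<Suc r. \<forall>j<Suc r. (\<Sum>b\<in>B. (\<eta>(r := \<eta>\<^sub>0)) i b * ?y j b) = of_bool (i = j)"
        by (intro allI impI biorthogonal_extend bi2 \<eta>1 \<eta>y0)
      have 4: "\<forall>a\<in>A. \<forall>b\<in>B. M a b = (\<Sum>i<Suc r. (q(r := p)) i * (\<xi>(r := \<xi>\<^sub>0)) i a * (\<eta>(r := \<eta>\<^sub>0)) i b)"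
        using M' by (auto simp: M'_def algebra_simps)
      from 1 2 3 4 show ?thesis unfolding diagonalizable_def by (intro exI conjI)
    qed
  qed
qed

section \<open>Quotients of groups of real vectors\<close>

definition real_subgroup :: "('c \<Rightarrow> real) set \<Rightarrow> bool" where
  "real_subgroup L \<longleftrightarrow> (\<lambda>_. 0) \<in> L \<and> (\<forall>u\<in>L. \<forall>v\<in>L. (\<lambda>\<sigma>. u \<sigma> - v \<sigma>) \<in> L)"

lemma real_subgroup_0: "real_subgroup L \<Longrightarrow> (\<lambda>_. 0) \<in> L"
  and real_subgroup_diff: "real_subgroup L \<Longrightarrow> u \<in> L \<Longrightarrow> v \<in> L \<Longrightarrow> (\<lambda>\<sigma>. u \<sigma> - v \<sigma>) \<in> L"
  by (auto simp: real_subgroup_def)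

lemma real_subgroup_uminus: "real_subgroup L \<Longrightarrow> u \<in> L \<Longrightarrow> (\<lambda>\<sigma>. - u \<sigma>) \<in> L"
  using real_subgroup_diff[OF _ real_subgroup_0] by fastforce

lemma real_subgroup_add: "real_subgroup L \<Longrightarrow> u \<in> L \<Longrightarrow> v \<in> L \<Longrightarrow> (\<lambda>\<sigma>. u \<sigma> + v \<sigma>) \<in> L"
  using real_subgroup_diff[of L u "\<lambda>\<sigma>. - v \<sigma>"] real_subgroup_uminus by fastforce

lemma real_subgroup_nat_mult: "real_subgroup L \<Longrightarrow> u \<in> L \<Longrightarrow> (\<lambda>\<sigma>. real n * u \<sigma>) \<in> L"
proof (induction n)
  case (Suc n)
  then show ?case using real_subgroup_add[of L u "\<lambda>\<sigma>. real n * u \<sigma>"] by (simp add: algebra_simps)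
qed (simp add: real_subgroup_0)

section \<open>Subgroups of real vectors as groups, and their cosets\<close>

lemma vec_group_simps [simp]:
  "carrier (vec_group L) = L" "\<one>\<^bsub>vec_group L\<^esub> = (\<lambda>_. 0)" "u \<otimes>\<^bsub>vec_group L\<^esub> v = (\<lambda>\<sigma>. u \<sigma> + v \<sigma>)"
  by (simp_all add: vec_group_def)

lemma comm_group_vec_group: "real_subgroup L \<Longrightarrow> comm_group (vec_group L)"
proof (rule comm_groupI)
  fix u assume "real_subgroup L" "u \<in> carrier (vec_group L)"
  then show "\<exists>v\<in>carrier (vec_group L). v \<otimes>\<^bsub>vec_group L\<^esub> u = \<one>\<^bsub>vec_group L\<^esub>"
    using real_subgroup_uminus by (intro bexI[of _ "\<lambda>\<sigma>. - u \<sigma>"]) auto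
qed (auto simp: real_subgroup_add real_subgroup_0 algebra_simps)

lemma normal_vec_group:
  assumes "real_subgroup X" "real_subgroup N" "N \<subseteq> X" shows "N \<lhd> vec_group X"
proof -
  interpret comm_group "vec_group X" by (rule comm_group_vec_group) fact
  have "inv\<^bsub>vec_group X\<^esub> u = (\<lambda>\<sigma>. - u \<sigma>)" if "u \<in> X" for u
    using that real_subgroup_uminus assms by (intro inv_equality) auto
  then have "subgroup N (vec_group X)"
    using assms by unfold_locales (auto simp: real_subgroup_add real_subgroup_0 real_subgroup_uminus subset_iff)
  then show ?thesis by (rule subgroup_imp_normal)
qed

text \<open>Right cosets in \<open>vec_group X\<close> do not depend on X. Dropping X from the
  notation lets one coset be read in several quotients, as the maps of the lower row
  require.\<close>

definition coset :: "('c \<Rightarrow> real) set \<Rightarrow> ('c \<Rightarrow> real) \<Rightarrow> ('c \<Rightarrow> real) set" where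
  "coset N u = (\<lambda>n \<sigma>. n \<sigma> + u \<sigma>) ` N"

lemma r_coset_vec_group: "N #>\<^bsub>vec_group X\<^esub> u = coset N u"
  by (auto simp: r_coset_def coset_def)

lemma coset_self: "real_subgroup N \<Longrightarrow> u \<in> coset N u"
  unfolding coset_def by (rule rev_image_eqI[OF real_subgroup_0]) auto

lemma coset_eq_iff:
  assumes "real_subgroup N" shows "coset N u = coset N v \<longleftrightarrow> (\<lambda>\<sigma>. u \<sigma> - v \<sigma>) \<in> N"
proof
  assume eq: "coset N u = coset N v"
  have "u \<in> coset N u" by (rule coset_self[OF assms])
  then obtain n where "n \<in> N" "u = (\<lambda>\<sigma>. n \<sigma> + v \<sigma>)" unfolding eq by (auto simp: coset_def)
  then show "(\<lambda>\<sigma>. u \<sigma> - v \<sigma>) \<in> N" by simp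
next
  assume d: "(\<lambda>\<sigma>. u \<sigma> - v \<sigma>) \<in> N"
  show "coset N u = coset N v"
  proof (intro equalityI subsetI)
    fix w assume "w \<in> coset N u"
    then obtain n where "n \<in> N" "w = (\<lambda>\<sigma>. n \<sigma> + u \<sigma>)" by (auto simp: coset_def)
    with real_subgroup_add[OF assms _ d, of n] show "w \<in> coset N v"
      unfolding coset_def by (intro rev_image_eqI[of "\<lambda>\<sigma>. n \<sigma> + (u \<sigma> - v \<sigma>)"]) auto
  next
    fix w assume "w \<in> coset N v"
    then obtain n where "n \<in> N" "w = (\<lambda>\<sigma>. n \<sigma> + v \<sigma>)" by (auto simp: coset_def)
    with real_subgroup_diff[OF assms _ d, of n] show "w \<in> coset N u"
      unfolding coset_def by (intro rev_image_eqI[of "\<lambda>\<sigma>. n \<sigma> - (u \<sigma> - v \<sigma>)"]) auto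
  qed
qed

lemma coset_0: "coset N (\<lambda>_. 0) = N"
  by (simp add: coset_def)

lemma coset_eq_self_iff: "real_subgroup N \<Longrightarrow> coset N u = N \<longleftrightarrow> u \<in> N"
  using coset_eq_iff[of N u "\<lambda>_. 0"] by (simp add: coset_0)

lemma carrier_quotient: "carrier (vec_group X Mod N) = coset N ` X"
  by (auto simp: FactGroup_def RCOSETS_def r_coset_vec_group)

lemma set_mult_coset:
  assumes "real_subgroup N"
  shows "coset N u <#>\<^bsub>vec_group X\<^esub> coset N v = coset N (\<lambda>\<sigma>. u \<sigma> + v \<sigma>)"
proof (intro equalityI subsetI)
    fix w assume "w \<in> coset N u <#>\<^bsub>vec_group X\<^esub> coset N v"
    then obtain m n where "m \<in> N" "n \<in> N" "w = (\<lambda>\<sigma>. (m \<sigma> + u \<sigma>) + (n \<sigma> + v \<sigma>))"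
      by (auto simp: set_mult_def coset_def)
    with real_subgroup_add[OF assms, of m n] show "w \<in> coset N (\<lambda>\<sigma>. u \<sigma> + v \<sigma>)"
      unfolding coset_def by (intro rev_image_eqI[of "\<lambda>\<sigma>. m \<sigma> + n \<sigma>"]) auto
  next
    fix w assume "w \<in> coset N (\<lambda>\<sigma>. u \<sigma> + v \<sigma>)"
    then obtain n where n: "n \<in> N" "w = (\<lambda>\<sigma>. n \<sigma> + (u \<sigma> + v \<sigma>))" by (auto simp: coset_def)
    have "(\<lambda>\<sigma>. n \<sigma> + u \<sigma>) \<in> coset N u" "v \<in> coset N v"
      using n coset_self[OF assms] by (auto simp: coset_def)
    then show "w \<in> coset N u <#>\<^bsub>vec_group X\<^esub> coset N v"
      unfolding set_mult_def n(2) by (intro UN_I[of "\<lambda>\<sigma>. n \<sigma> + u \<sigma>"] UN_I[of v]) (auto simp: add.assoc)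
  qed

lemma group_quotient: "real_subgroup X \<Longrightarrow> real_subgroup N \<Longrightarrow> N \<subseteq> X \<Longrightarrow> group (vec_group X Mod N)"
  using normal_vec_group normal.factorgroup_is_group by blast

lemma pow_quotient:
  assumes "real_subgroup N"
  shows "coset N u [^]\<^bsub>vec_group X Mod N\<^esub> (n::nat) = coset N (\<lambda>\<sigma>. real n * u \<sigma>)"
proof (induction n)
  case 0
  then show ?case by (simp add: coset_0)
next
  case (Suc n)
  then show ?case by (simp add: set_mult_coset[OF assms] algebra_simps)
qed

text \<open>The preimage in X of the torsion subgroup of the quotient of X by N, also called the
  isolator of N in X.\<close>

definition saturation :: "('c \<Rightarrow> real) set \<Rightarrow> ('c \<Rightarrow> real) set \<Rightarrow> ('c \<Rightarrow> real) set" where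
  "saturation X N = {u \<in> X. \<exists>n::nat. n > 0 \<and> (\<lambda>\<sigma>. real n * u \<sigma>) \<in> N}"

text \<open>An equality of records and not just an isomorphism: products of cosets are products of
  sets, which do not see the ambient group. So torsion subgroups can be replaced by
  rewriting.\<close>

lemma torsion_quotient:
  assumes "real_subgroup N"
  shows "torsion_subgroup (vec_group X Mod N) = vec_group (saturation X N) Mod N"
proof -
  have "{x \<in> carrier (vec_group X Mod N). \<exists>n::nat. n > 0 \<and> x [^]\<^bsub>vec_group X Mod N\<^esub> n = \<one>\<^bsub>vec_group X Mod N\<^esub>}
      = coset N ` saturation X N"
    unfolding carrier_quotient saturation_def
    by (auto simp: pow_quotient[OF assms] coset_eq_self_iff[OF assms] intro!: imageI)
  moreover have "set_mult (vec_group X) = set_mult (vec_group (saturation X N))"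
    by (auto simp: fun_eq_iff set_mult_def)
  ultimately show ?thesis
    unfolding torsion_subgroup_def carrier_quotient[symmetric] by (simp add: FactGroup_def)
qed

lemma real_subgroup_saturation:
  assumes "real_subgroup X" "real_subgroup N"
  shows "real_subgroup (saturation X N)"
  unfolding real_subgroup_def
proof (intro conjI ballI)
  show "(\<lambda>_. 0) \<in> saturation X N"
    using assms real_subgroup_0 by (auto simp: saturation_def intro!: exI[of _ 1])
  fix u v assume "u \<in> saturation X N" "v \<in> saturation X N"
  then obtain m n :: nat where mn: "u \<in> X" "v \<in> X" "m > 0" "n > 0"
    "(\<lambda>\<sigma>. real m * u \<sigma>) \<in> N" "(\<lambda>\<sigma>. real n * v \<sigma>) \<in> N"
    by (auto simp: saturation_def)
  have "(\<lambda>\<sigma>. real n * (real m * u \<sigma>) - real m * (real n * v \<sigma>)) \<in> N"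
    by (intro real_subgroup_diff real_subgroup_nat_mult assms mn)
  also have "(\<lambda>\<sigma>. real n * (real m * u \<sigma>) - real m * (real n * v \<sigma>)) = (\<lambda>\<sigma>. real (m * n) * (u \<sigma> - v \<sigma>))"
    by (simp add: algebra_simps)
  finally have "(\<lambda>\<sigma>. real (m * n) * (u \<sigma> - v \<sigma>)) \<in> N" .
  moreover have "(\<lambda>\<sigma>. u \<sigma> - v \<sigma>) \<in> X" by (intro real_subgroup_diff assms mn)
  moreover have "m * n > 0" using mn by simp
  ultimately show "(\<lambda>\<sigma>. u \<sigma> - v \<sigma>) \<in> saturation X N"
    unfolding saturation_def by blast
qed

lemma subset_saturation: "N \<subseteq> X \<Longrightarrow> N \<subseteq> saturation X N"
  unfolding saturation_def by (auto intro!: exI[of _ "Suc 0"])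

text \<open>A function on all sets of vectors, by choice of a representative. When f is additive and
  maps N into L, the choice does not matter on cosets of N (\<open>induced_coset\<close>).\<close>

definition induced :: "('b \<Rightarrow> real) set \<Rightarrow> (('a \<Rightarrow> real) \<Rightarrow> 'b \<Rightarrow> real) \<Rightarrow> ('a \<Rightarrow> real) set \<Rightarrow> ('b \<Rightarrow> real) set" where
  "induced L f S = coset L (f (SOME u. u \<in> S))"

text \<open>Five maps of the diagram and the coordinates of a diagonal form are instances.
  Injectivity and surjectivity on quotients reduce to statements about representatives.\<close>

locale lattice_map =
  fixes X N :: "('a \<Rightarrow> real) set" and Y L :: "('b \<Rightarrow> real) set" and f :: "('a \<Rightarrow> real) \<Rightarrow> 'b \<Rightarrow> real"
  assumes X: "real_subgroup X" and N: "real_subgroup N" "N \<subseteq> X" and Y: "real_subgroup Y" and L: "real_subgroup L" "L \<subseteq> Y"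
    and add: "\<And>u v. u \<in> X \<Longrightarrow> v \<in> X \<Longrightarrow> f (\<lambda>\<sigma>. u \<sigma> + v \<sigma>) = (\<lambda>\<sigma>. f u \<sigma> + f v \<sigma>)"
    and into: "\<And>u. u \<in> X \<Longrightarrow> f u \<in> Y" and sub: "\<And>u. u \<in> N \<Longrightarrow> f u \<in> L"
begin

lemma diff: assumes "u \<in> X" "v \<in> X" shows "f (\<lambda>\<sigma>. u \<sigma> - v \<sigma>) = (\<lambda>\<sigma>. f u \<sigma> - f v \<sigma>)"
  using add[OF real_subgroup_diff[OF X assms] assms(2)] by (auto simp: fun_eq_iff algebra_simps)

lemma induced_coset:
  assumes "u \<in> X" shows "induced L f (coset N u) = coset L (f u)"
proof -
  have "u \<in> coset N u" by (rule coset_self[OF N(1)])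
  then have "(SOME w. w \<in> coset N u) \<in> coset N u" by (rule someI[where P = "\<lambda>w. w \<in> coset N u"])
  then obtain n where n: "n \<in> N" "(SOME w. w \<in> coset N u) = (\<lambda>\<sigma>. n \<sigma> + u \<sigma>)"
    by (auto simp: coset_def)
  have "f (\<lambda>\<sigma>. n \<sigma> + u \<sigma>) = (\<lambda>\<sigma>. f n \<sigma> + f u \<sigma>)" using n N assms by (intro add) auto
  with n sub show ?thesis unfolding induced_def by (simp add: coset_eq_iff L)
qed

lemma induced_hom: "induced L f \<in> hom (vec_group X Mod N) (vec_group Y Mod L)"
proof (rule homI)
  fix S assume "S \<in> carrier (vec_group X Mod N)"
  then show "induced L f S \<in> carrier (vec_group Y Mod L)"
    by (auto simp: carrier_quotient induced_coset into)
next
  fix S T assume "S \<in> carrier (vec_group X Mod N)" "T \<in> carrier (vec_group X Mod N)"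
  then show "induced L f (S \<otimes>\<^bsub>vec_group X Mod N\<^esub> T) = induced L f S \<otimes>\<^bsub>vec_group Y Mod L\<^esub> induced L f T"
    by (auto simp: carrier_quotient set_mult_coset N L induced_coset real_subgroup_add X add)
qed

lemma inj_induced:
  assumes "\<And>u. u \<in> X \<Longrightarrow> f u \<in> L \<Longrightarrow> u \<in> N"
  shows "inj_on (induced L f) (carrier (vec_group X Mod N))"
proof (rule inj_onI)
  fix S T assume "S \<in> carrier (vec_group X Mod N)" "T \<in> carrier (vec_group X Mod N)" and eq: "induced L f S = induced L f T"
  then obtain u v where uv: "u \<in> X" "v \<in> X" "S = coset N u" "T = coset N v" by (auto simp: carrier_quotient)
  with eq have "(\<lambda>\<sigma>. f u \<sigma> - f v \<sigma>) \<in> L" by (simp add: induced_coset coset_eq_iff L)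
  with uv assms[OF real_subgroup_diff[OF X uv(1,2)]] show "S = T" by (simp add: diff coset_eq_iff N)
qed

lemma surj_induced:
  assumes "\<And>y. y \<in> Y \<Longrightarrow> \<exists>u\<in>X. f u = y"
  shows "induced L f ` carrier (vec_group X Mod N) = carrier (vec_group Y Mod L)"
proof -
  have "f ` X = Y" using assms into by blast
  then have "coset L ` Y = (\<lambda>u. induced L f (coset N u)) ` X"
    using induced_coset by (auto simp: image_iff)
  then show ?thesis by (auto simp: carrier_quotient)
qed

lemma iso_induced:
  assumes "\<And>u. u \<in> X \<Longrightarrow> f u \<in> L \<Longrightarrow> u \<in> N" "\<And>y. y \<in> Y \<Longrightarrow> \<exists>u\<in>X. f u = y"
  shows "induced L f \<in> iso (vec_group X Mod N) (vec_group Y Mod L)"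
  using induced_hom inj_induced[OF assms(1)] surj_induced[OF assms(2)] by (simp add: iso_def bij_betw_def)

end

section \<open>Torsion of the cokernel of an integer matrix\<close>

definition ints :: "'a set \<Rightarrow> ('a \<Rightarrow> real) set" where
  "ints A = {c. (\<forall>\<sigma>. c \<sigma> \<in> \<int>) \<and> (\<forall>\<sigma>. \<sigma> \<notin> A \<longrightarrow> c \<sigma> = 0)}"

lemma real_subgroup_ints: "real_subgroup (ints A)"
  by (auto simp: real_subgroup_def ints_def)

definition int_map :: "'a set \<Rightarrow> 'b set \<Rightarrow> ('a \<Rightarrow> 'b \<Rightarrow> int) \<Rightarrow> ('a \<Rightarrow> real) \<Rightarrow> 'b \<Rightarrow> real" where
  "int_map A B M c = (\<lambda>\<tau>. if \<tau> \<in> B then \<Sum>\<sigma>\<in>A. of_int (M \<sigma> \<tau>) * c \<sigma> else 0)"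

lemma int_map_ints: "c \<in> ints A \<Longrightarrow> int_map A B M c \<in> ints B"
  by (auto simp: ints_def int_map_def intro!: Ints_sum Ints_mult)

lemma int_map_0 [simp]: "int_map A B M (\<lambda>_. 0) = (\<lambda>_. 0)"
  by (auto simp: int_map_def)

lemma int_map_add: "int_map A B M (\<lambda>\<sigma>. u \<sigma> + v \<sigma>) = (\<lambda>\<sigma>. int_map A B M u \<sigma> + int_map A B M v \<sigma>)"
  by (auto simp: int_map_def algebra_simps sum.distrib)

lemma int_map_diff: "int_map A B M (\<lambda>\<sigma>. u \<sigma> - v \<sigma>) = (\<lambda>\<sigma>. int_map A B M u \<sigma> - int_map A B M v \<sigma>)"
  by (auto simp: int_map_def algebra_simps sum_subtractf)

lemma int_map_scale: "int_map A B M (\<lambda>\<sigma>. k * u \<sigma>) = (\<lambda>\<sigma>. k * int_map A B M u \<sigma>)"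
  by (auto simp: int_map_def algebra_simps sum_distrib_left)

lemma real_subgroup_image_int_map: "real_subgroup S \<Longrightarrow> real_subgroup (int_map A B M ` S)"
  unfolding real_subgroup_def[of "_ ` _"]
proof (intro conjI ballI)
  assume S: "real_subgroup S"
  then show "(\<lambda>_. 0) \<in> int_map A B M ` S"
    by (intro image_eqI[of _ _ "\<lambda>_. 0"]) (simp_all add: real_subgroup_0)
  fix u v assume "u \<in> int_map A B M ` S" "v \<in> int_map A B M ` S"
  then obtain u' v' where "u' \<in> S" "v' \<in> S" "u = int_map A B M u'" "v = int_map A B M v'" by blast
  then show "(\<lambda>\<sigma>. u \<sigma> - v \<sigma>) \<in> int_map A B M ` S"
    using real_subgroup_diff[OF S] by (intro image_eqI[of _ _ "\<lambda>\<sigma>. u' \<sigma> - v' \<sigma>"]) (simp_all add: int_map_diff)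
qed

section \<open>Coordinates of a diagonal form\<close>

locale diagonalized =
  fixes A :: "'a set" and B :: "'b set" and M :: "'a \<Rightarrow> 'b \<Rightarrow> int"
    and r :: nat and p :: "nat \<Rightarrow> int" and \<xi> x :: "nat \<Rightarrow> 'a \<Rightarrow> int" and \<eta> y :: "nat \<Rightarrow> 'b \<Rightarrow> int"
  assumes p: "\<And>i. i < r \<Longrightarrow> p i \<noteq> 0"
    and \<xi>x: "\<And>i j. i < r \<Longrightarrow> j < r \<Longrightarrow> (\<Sum>a\<in>A. \<xi> i a * x j a) = of_bool (i = j)"
    and \<eta>y: "\<And>i j. i < r \<Longrightarrow> j < r \<Longrightarrow> (\<Sum>b\<in>B. \<eta> i b * y j b) = of_bool (i = j)"
    and M: "\<And>a b. a \<in> A \<Longrightarrow> b \<in> B \<Longrightarrow> M a b = (\<Sum>i<r. p i * \<xi> i a * \<eta> i b)"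
begin

text \<open>Analysis by the dual vectors y, against synthesis by \<open>of_coord\<close>. One
  composite is the identity below r; the other is shown to be so on vectors with a positive multiple
  in the image (\<open>of_coord_coord_saturation\<close>). The value 0 from r on makes
  \<open>coord u\<close> a member of \<open>ints {..<r}\<close> for integral u.\<close>

definition coord :: "('b \<Rightarrow> real) \<Rightarrow> nat \<Rightarrow> real" where
  "coord u = (\<lambda>i. if i < r then \<Sum>b\<in>B. real_of_int (y i b) * u b else 0)"

definition of_coord :: "(nat \<Rightarrow> real) \<Rightarrow> 'b \<Rightarrow> real" where
  "of_coord t = (\<lambda>b. if b \<in> B then \<Sum>i<r. t i * real_of_int (\<eta> i b) else 0)"

lemma of_coord_cong: "(\<And>i. i < r \<Longrightarrow> s i = t i) \<Longrightarrow> of_coord s = of_coord t"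
  by (simp add: of_coord_def fun_eq_iff)

definition lift :: "(nat \<Rightarrow> real) \<Rightarrow> 'a \<Rightarrow> real" where
  "lift t = (\<lambda>a. if a \<in> A then \<Sum>i<r. t i * real_of_int (x i a) else 0)"

lemma \<xi>x_real: "i < r \<Longrightarrow> j < r \<Longrightarrow> (\<Sum>a\<in>A. real_of_int (\<xi> i a) * x j a) = of_bool (i = j)"
  using \<xi>x[of i j] by (metis (no_types, lifting) of_int_mult of_int_of_bool of_int_sum sum.cong)

lemma \<eta>y_real: "i < r \<Longrightarrow> j < r \<Longrightarrow> (\<Sum>b\<in>B. real_of_int (\<eta> i b) * y j b) = of_bool (i = j)"
  using \<eta>y[of i j] by (metis (no_types, lifting) of_int_mult of_int_of_bool of_int_sum sum.cong)

lemma int_map_eq: "int_map A B M c = of_coord (\<lambda>i. real_of_int (p i) * (\<Sum>a\<in>A. real_of_int (\<xi> i a) * c a))"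
proof
  fix b
  show "int_map A B M c b = of_coord (\<lambda>i. real_of_int (p i) * (\<Sum>a\<in>A. real_of_int (\<xi> i a) * c a)) b"
  proof (cases "b \<in> B")
    case True
    then have "int_map A B M c b = (\<Sum>a\<in>A. \<Sum>i<r. real_of_int (p i) * \<xi> i a * \<eta> i b * c a)"
      by (simp add: int_map_def M sum_distrib_right)
    also have "\<dots> = (\<Sum>i<r. \<Sum>a\<in>A. real_of_int (p i) * \<xi> i a * \<eta> i b * c a)" by (rule sum.swap)
    also have "\<dots> = of_coord (\<lambda>i. real_of_int (p i) * (\<Sum>a\<in>A. real_of_int (\<xi> i a) * c a)) b"
      using True by (simp add: of_coord_def sum_distrib_left sum_distrib_right ac_simps)
    finally show ?thesis .
  qed (simp add: int_map_def of_coord_def)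
qed

lemma coord_of_coord: "i < r \<Longrightarrow> coord (of_coord t) i = t i"
proof -
  assume i: "i < r"
  have "coord (of_coord t) i = (\<Sum>b\<in>B. \<Sum>j<r. t j * (real_of_int (\<eta> j b) * y i b))"
    using i by (auto simp: coord_def of_coord_def sum_distrib_left sum_distrib_right ac_simps intro!: sum.cong)
  also have "\<dots> = (\<Sum>j<r. t j * (\<Sum>b\<in>B. real_of_int (\<eta> j b) * y i b))"
    by (subst sum.swap) (simp add: sum_distrib_left)
  also have "\<dots> = (\<Sum>j<r. if j = i then t j else 0)"
    by (rule sum.cong) (simp_all add: \<eta>y_real i)
  finally show ?thesis using i by simp
qed

lemma int_map_lift: "int_map A B M (lift t) = of_coord (\<lambda>i. real_of_int (p i) * t i)"
proof -
  have "(\<Sum>a\<in>A. real_of_int (\<xi> i a) * lift t a) = t i" if i: "i < r" for i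
  proof -
    have "(\<Sum>a\<in>A. real_of_int (\<xi> i a) * lift t a) = (\<Sum>a\<in>A. \<Sum>j<r. t j * (real_of_int (\<xi> i a) * x j a))"
      by (auto simp: lift_def sum_distrib_left ac_simps intro!: sum.cong)
    also have "\<dots> = (\<Sum>j<r. t j * (\<Sum>a\<in>A. real_of_int (\<xi> i a) * x j a))"
      by (subst sum.swap) (simp add: sum_distrib_left)
    also have "\<dots> = (\<Sum>j<r. if j = i then t j else 0)"
      by (rule sum.cong) (auto simp: \<xi>x_real i)
    finally show ?thesis using i by simp
  qed
  then show ?thesis unfolding int_map_eq of_coord_def by (auto simp: fun_eq_iff)
qed

text \<open>A multiple of u lies in the image, hence in the span of the \<eta>, where
  \<open>of_coord\<close> inverts \<open>coord\<close>. Both maps are linear, so the factor n can be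
  cancelled.\<close>

lemma of_coord_coord_saturation:
  assumes "u \<in> saturation (ints B) (int_map A B M ` ints A)"
  shows "of_coord (coord u) = u"
proof -
  obtain n :: nat and c where n: "n > 0" "(\<lambda>\<sigma>. real n * u \<sigma>) = int_map A B M c"
    using assms by (auto simp: saturation_def)
  define s where "s i = real_of_int (p i) * (\<Sum>a\<in>A. real_of_int (\<xi> i a) * c a)" for i
  have u: "real n * u b = of_coord s b" for b
    using n(2) unfolding int_map_eq s_def by (rule fun_cong)
  have "real n * coord u i = s i" if "i < r" for i
  proof -
    have "real n * coord u i = coord (of_coord s) i"
      unfolding coord_def u[symmetric] by (simp add: sum_distrib_left ac_simps)
    then show ?thesis using that by (simp add: coord_of_coord)
  qed
  then have "real n * of_coord (coord u) b = real n * u b" for b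
    unfolding u by (simp add: of_coord_def sum_distrib_left flip: mult.assoc)
  with n(1) show ?thesis by (simp add: fun_eq_iff)
qed

text \<open>The lattice of all integral t with \<open>p i\<close> dividing \<open>t i\<close>, so
  that its quotient is the sum of the cyclic groups of orders |p i|. It depends on r and p alone,
  and these are the same for the transposed matrix.\<close>

definition L :: "(nat \<Rightarrow> real) set" where "L = {t \<in> ints {..<r}. \<forall>i<r. t i / real_of_int (p i) \<in> \<int>}"

text \<open>\<open>coord\<close> maps the image into L because in coordinates M multiplies by the
  \<open>p i\<close>; conversely, dividing by the \<open>p i\<close> and applying
  \<open>lift\<close> recovers a preimage. That every integral t is the coordinate vector of a
  torsion class rests on the \<open>p i\<close> being nonzero.\<close>

lemma torsion_coker:
  "vec_group (saturation (ints B) (int_map A B M ` ints A)) Mod (int_map A B M ` ints A) \<cong> vec_group (ints {..<r}) Mod L"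
proof -
  let ?I = "int_map A B M ` ints A"
  have coord_ints: "coord u \<in> ints {..<r}" if "u \<in> ints B" for u
    using that by (auto simp: coord_def ints_def intro!: Ints_sum Ints_mult)
  have of_coord_ints: "of_coord t \<in> ints B" if "t \<in> ints {..<r}" for t
    using that by (auto simp: of_coord_def ints_def intro!: Ints_sum Ints_mult)
  have lift_ints: "lift t \<in> ints A" if "\<And>i. i < r \<Longrightarrow> t i \<in> \<int>" for t
    using that by (auto simp: lift_def ints_def intro!: Ints_sum Ints_mult)
  interpret lattice_map "saturation (ints B) ?I" ?I "ints {..<r}" L coord
  proof
    show "real_subgroup L" unfolding real_subgroup_def L_def
      using real_subgroup_ints[of "{..<r}"] by (auto simp: real_subgroup_def diff_divide_distrib)
    show "real_subgroup ?I" by (intro real_subgroup_image_int_map real_subgroup_ints)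
    then show "real_subgroup (saturation (ints B) ?I)" by (intro real_subgroup_saturation real_subgroup_ints)
    show "?I \<subseteq> saturation (ints B) ?I" by (intro subset_saturation) (auto simp: int_map_ints)
    show "coord (\<lambda>\<sigma>. u \<sigma> + v \<sigma>) = (\<lambda>\<sigma>. coord u \<sigma> + coord v \<sigma>)" for u v
      by (auto simp: coord_def algebra_simps sum.distrib)
    show "coord u \<in> ints {..<r}" if "u \<in> saturation (ints B) ?I" for u
      using that coord_ints by (auto simp: saturation_def)
    show "coord u \<in> L" if u: "u \<in> ?I" for u
    proof -
      obtain c where c: "c \<in> ints A" "u = int_map A B M c" using u by blast
      then have "coord u i / real_of_int (p i) = (\<Sum>a\<in>A. real_of_int (\<xi> i a) * c a)" if "i < r" for i
        using that p[OF that] by (simp add: int_map_eq coord_of_coord)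
      moreover have "(\<Sum>a\<in>A. real_of_int (\<xi> i a) * c a) \<in> \<int>" for i
        using c by (auto simp: ints_def intro!: Ints_sum Ints_mult)
      ultimately show ?thesis unfolding L_def using coord_ints c int_map_ints[of c A B M] by auto
    qed
  qed (auto simp: L_def real_subgroup_ints)
  have "induced L coord \<in> iso (vec_group (saturation (ints B) ?I) Mod ?I) (vec_group (ints {..<r}) Mod L)"
  proof (rule iso_induced)
    fix u assume u: "u \<in> saturation (ints B) ?I" "coord u \<in> L"
    have "int_map A B M (lift (\<lambda>i. coord u i / real_of_int (p i))) = of_coord (coord u)"
      unfolding int_map_lift of_coord_def using p by (auto simp: fun_eq_iff intro!: sum.cong)
    then have eq: "int_map A B M (lift (\<lambda>i. coord u i / real_of_int (p i))) = u" using of_coord_coord_saturation u by simp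
    have "lift (\<lambda>i. coord u i / real_of_int (p i)) \<in> ints A" using u by (intro lift_ints) (simp add: L_def)
    from imageI[OF this, of "int_map A B M"] show "u \<in> ?I" unfolding eq .
  next
    fix t assume t: "t \<in> ints {..<r}"
    \<comment> \<open>A common multiple of the \<open>p i\<close>: q times any integral t lies in L,
      hence q times \<open>of_coord t\<close> lies in the image.\<close>
    define q where "q = (\<Prod>i<r. nat \<bar>p i\<bar>)"
    have q: "q > 0" unfolding q_def using p by (intro prod_pos) auto
    have qp: "p i dvd int q" if "i < r" for i
    proof -
      have "nat \<bar>p i\<bar> dvd q" unfolding q_def using that by (intro dvd_prodI) auto
      then show ?thesis by (simp add: nat_abs_dvd_iff)
    qed
    have "lift (\<lambda>i. real_of_int (int q div p i) * t i) \<in> ints A"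
      using t by (intro lift_ints Ints_mult) (auto simp: ints_def)
    moreover have "int_map A B M (lift (\<lambda>i. real_of_int (int q div p i) * t i)) = (\<lambda>b. real q * of_coord t b)"
    proof -
      have "real_of_int (p i) * (real_of_int (int q div p i) * t i) = real q * t i" if "i < r" for i
      proof -
        have "real_of_int (p i * (int q div p i)) = real q" using qp[OF that] by simp
        then show ?thesis by (simp only: of_int_mult flip: mult.assoc)
      qed
      then have "int_map A B M (lift (\<lambda>i. real_of_int (int q div p i) * t i)) = of_coord (\<lambda>i. real q * t i)"
        unfolding int_map_lift by (intro of_coord_cong)
      then show ?thesis by (simp add: of_coord_def fun_eq_iff sum_distrib_left mult.assoc)
    qed
    ultimately have "(\<lambda>b. real q * of_coord t b) \<in> ?I" by (intro image_eqI) auto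
    then have "of_coord t \<in> saturation (ints B) ?I"
      using q of_coord_ints[OF t] unfolding saturation_def by blast
    moreover have "coord (of_coord t) = t"
    proof
      fix i show "coord (of_coord t) i = t i"
        using t by (cases "i < r") (simp add: coord_of_coord, simp add: coord_def ints_def)
    qed
    ultimately show "\<exists>u\<in>saturation (ints B) ?I. coord u = t" by blast
  qed
  then show ?thesis by (rule is_isoI)
qed

end

text \<open>Over the integers a matrix and its transpose have the same diagonal form.\<close>

theorem torsion_coker_transpose:
  assumes "finite A" "finite B"
  shows "vec_group (saturation (ints B) (int_map A B M ` ints A)) Mod (int_map A B M ` ints A) \<cong>
    vec_group (saturation (ints A) (int_map B A (\<lambda>b a. M a b) ` ints B)) Mod (int_map B A (\<lambda>b a. M a b) ` ints B)"
proof -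
  obtain r :: nat and p \<xi> \<eta> x y where d: "(\<forall>i<r. p i \<noteq> 0) \<and>
     (\<forall>i<r. \<forall>j<r. (\<Sum>a\<in>A. \<xi> i a * x j a) = of_bool (i = j)) \<and>
     (\<forall>i<r. \<forall>j<r. (\<Sum>b\<in>B. \<eta> i b * y j b) = of_bool (i = j)) \<and>
     (\<forall>a\<in>A. \<forall>b\<in>B. M a b = (\<Sum>i<r. p i * \<xi> i a * \<eta> i b))"
    using diagonalizable[OF assms, of M] unfolding diagonalizable_def by (elim exE)
  interpret D1: diagonalized A B M r p \<xi> x \<eta> y using d by unfold_locales blast+
  interpret D2: diagonalized B A "\<lambda>b a. M a b" r p \<eta> y \<xi> x
    using d by unfold_locales (auto simp: ac_simps)
  have "D1.L = D2.L" by (simp add: D1.L_def D2.L_def)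
  moreover have "group (vec_group (saturation (ints A) (int_map B A (\<lambda>b a. M a b) ` ints B)) Mod (int_map B A (\<lambda>b a. M a b) ` ints B))"
    by (intro group_quotient real_subgroup_saturation real_subgroup_ints real_subgroup_image_int_map subset_saturation) (auto simp: int_map_ints)
  ultimately show ?thesis
    using iso_trans[OF D1.torsion_coker] group.iso_sym[OF _ D2.torsion_coker] by simp
qed

section \<open>Cuts and flows\<close>

text \<open>Linear extension from a basis of the reals over the rationals. Additivity suffices for
  commuting with integer matrices and, together with \<open>g 1 = 1\<close>, for fixing the
  integers.\<close>

lemma rational_retraction:
  obtains g :: "real \<Rightarrow> rat" where "\<And>a b. g (a + b) = g a + g b" "g 1 = 1"
proof -
  let ?s = "\<lambda>(q::rat) (x::real). of_rat q * x"
  interpret vector_space_pair ?s "\<lambda>q r :: rat. q * r"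
    by unfold_locales (simp_all add: algebra_simps of_rat_add of_rat_mult)
  have "vs1.independent {1}" by (simp add: vs1.independent_insert)
  from linear_independent_extend[OF this, of "\<lambda>_. 1"]
  obtain g where "Vector_Spaces.linear ?s (\<lambda>q r :: rat. q * r) g" "g 1 = 1" by blast
  then show ?thesis using that linear_add by blast
qed

lemma common_denominator:
  assumes "finite B"
  shows "\<exists>n::nat. n > 0 \<and> (\<forall>b\<in>B. real n * real_of_rat (q b) \<in> \<int>)"
  using assms
proof (induction B rule: finite_induct)
  case (insert b B)
  then obtain n :: nat where n: "n > 0" "\<And>b. b \<in> B \<Longrightarrow> real n * real_of_rat (q b) \<in> \<int>" by auto
  obtain k d where kd: "quotient_of (q b) = (k, d)" by fastforce
  then have d: "d > 0" "q b = of_int k / of_int d"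
    using quotient_of_denom_pos quotient_of_div by auto
  have "real (n * nat d) * real_of_rat (q b) = real_of_int (int n * k)"
    using d by (simp add: of_rat_divide)
  moreover have "real (n * nat d) * real_of_rat (q c) \<in> \<int>" if "c \<in> B" for c
  proof -
    have "real (nat d) * (real n * real_of_rat (q c)) \<in> \<int>" by (rule Ints_mult[OF Ints_of_nat n(2)[OF that]])
    then show ?thesis by (simp only: of_nat_mult mult.assoc mult.left_commute)
  qed
  moreover have "n * nat d > 0" using n d by simp
  ultimately show ?case by (intro exI[of _ "n * nat d"]) (auto simp del: of_nat_mult)
qed auto

section \<open>Real chains and real spans\<close>

definition supported :: "'a set \<Rightarrow> ('a \<Rightarrow> real) set" where
  "supported A = {c. \<forall>\<sigma>. \<sigma> \<notin> A \<longrightarrow> c \<sigma> = 0}"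

lemma ints_supported: "ints A \<subseteq> supported A"
  by (auto simp: ints_def supported_def)

lemma real_span_0: "(\<lambda>_. 0) \<in> real_span L"
  unfolding real_span_def by (intro CollectI exI[of _ "{}"]) auto

lemma real_span_base: "w \<in> L \<Longrightarrow> w \<in> real_span L"
  unfolding real_span_def by (intro CollectI exI[of _ "{w}"] exI[of _ "\<lambda>_. 1"]) auto

lemma real_span_scale:
  assumes "u \<in> real_span L" shows "(\<lambda>\<sigma>. k * u \<sigma>) \<in> real_span L"
proof -
  obtain W a where "u = (\<lambda>\<sigma>. \<Sum>w\<in>W. a w * w \<sigma>)" "finite W" "W \<subseteq> L"
    using assms unfolding real_span_def by blast
  then show ?thesis unfolding real_span_def
    by (intro CollectI exI[of _ W] exI[of _ "\<lambda>w. k * a w"]) (simp add: sum_distrib_left mult.assoc)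
qed

lemma real_span_add:
  assumes "u \<in> real_span L" "v \<in> real_span L" shows "(\<lambda>\<sigma>. u \<sigma> + v \<sigma>) \<in> real_span L"
proof -
  obtain V a where V: "u = (\<lambda>\<sigma>. \<Sum>w\<in>V. a w * w \<sigma>)" "finite V" "V \<subseteq> L"
    using assms(1) unfolding real_span_def by blast
  obtain W b where W: "v = (\<lambda>\<sigma>. \<Sum>w\<in>W. b w * w \<sigma>)" "finite W" "W \<subseteq> L"
    using assms(2) unfolding real_span_def by blast
  have "(\<Sum>w\<in>V. a w * w \<sigma>) = (\<Sum>w\<in>V \<union> W. (if w \<in> V then a w else 0) * w \<sigma>)" for \<sigma>
    using V W by (intro sum.mono_neutral_cong_left) auto
  moreover have "(\<Sum>w\<in>W. b w * w \<sigma>) = (\<Sum>w\<in>V \<union> W. (if w \<in> W then b w else 0) * w \<sigma>)" for \<sigma>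
    using V W by (intro sum.mono_neutral_cong_left) auto
  ultimately have "(\<lambda>\<sigma>. u \<sigma> + v \<sigma>) = (\<lambda>\<sigma>. \<Sum>w\<in>V \<union> W. ((if w \<in> V then a w else 0) + (if w \<in> W then b w else 0)) * w \<sigma>)"
    unfolding V(1) W(1) by (simp add: distrib_right sum.distrib)
  then show ?thesis
    unfolding real_span_def using V(2,3) W(2,3)
    by (intro CollectI exI[of _ "V \<union> W"] exI[of _ "\<lambda>w. (if w \<in> V then a w else 0) + (if w \<in> W then b w else 0)"]) simp
qed

lemma real_span_sum:
  "(\<And>i. i \<in> I \<Longrightarrow> f i \<in> real_span L) \<Longrightarrow> (\<lambda>\<sigma>. \<Sum>i\<in>I. a i * f i \<sigma>) \<in> real_span L"
  by (induction I rule: infinite_finite_induct) (auto simp: real_span_0 intro!: real_span_add real_span_scale)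

section \<open>An integer matrix, its transpose and the projection onto the cuts\<close>

locale integer_matrix =
  fixes A :: "'a set" and B :: "'b set" and M :: "'a \<Rightarrow> 'b \<Rightarrow> int"
  assumes fin_A: "finite A" and fin_B: "finite B"
begin

abbreviation D :: "('a \<Rightarrow> real) \<Rightarrow> 'b \<Rightarrow> real" where "D \<equiv> int_map A B M"
abbreviation T :: "('b \<Rightarrow> real) \<Rightarrow> 'a \<Rightarrow> real" where "T \<equiv> int_map B A (\<lambda>b a. M a b)"

abbreviation cuts :: "('a \<Rightarrow> real) set" where "cuts \<equiv> T ` ints B"
abbreviation flows :: "('a \<Rightarrow> real) set" where "flows \<equiv> {c \<in> ints A. D c = (\<lambda>_. 0)}"

lemma adjoint: "std_inner A c (T w) = std_inner B (D c) w"
proof -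
  have "std_inner A c (T w) = (\<Sum>a\<in>A. \<Sum>b\<in>B. M a b * c a * w b)"
    by (simp add: std_inner_def int_map_def sum_distrib_left ac_simps)
  also have "\<dots> = std_inner B (D c) w"
    by (subst sum.swap) (simp add: std_inner_def int_map_def sum_distrib_right)
  finally show ?thesis .
qed

lemma std_inner_self_eq_0: "finite S \<Longrightarrow> std_inner S u u = 0 \<Longrightarrow> \<sigma> \<in> S \<Longrightarrow> u \<sigma> = 0"
  by (auto simp: std_inner_def sum_nonneg_eq_0_iff)

text \<open>The squared length of T w is the pairing of D (T w) with w. Over the reals this makes D
  injective on the span of the cuts, the fact behind \<beta> and behind the trivial intersection of
  cuts and flows.\<close>

lemma T_eq_0_iff: "T w = (\<lambda>_. 0) \<longleftrightarrow> D (T w) = (\<lambda>_. 0)"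
proof
  assume "D (T w) = (\<lambda>_. 0)"
  then have 0: "std_inner A (T w) (T w) = 0" by (simp add: adjoint) (simp add: std_inner_def)
  have "T w a = 0" if "a \<in> A" for a by (rule std_inner_self_eq_0[OF fin_A 0 that])
  then show "T w = (\<lambda>_. 0)" by (auto simp: int_map_def)
qed simp

lemma D_T_inject: "D (T v) = D (T w) \<Longrightarrow> T v = T w"
  using T_eq_0_iff[of "\<lambda>\<sigma>. v \<sigma> - w \<sigma>"] by (auto simp: int_map_diff fun_eq_iff)

lemma unit_ints: "b \<in> B \<Longrightarrow> (\<lambda>c. of_bool (c = b)) \<in> ints B"
  by (auto simp: ints_def)

lemma std_inner_unit: "b \<in> B \<Longrightarrow> std_inner B u (\<lambda>c. of_bool (c = b)) = u b"
  using fin_B by (simp add: std_inner_def of_bool_def if_distrib cong: if_cong)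

lemma T_sum_units:
  assumes "w \<in> supported B"
  shows "T w = (\<lambda>a. \<Sum>b\<in>B. w b * T (\<lambda>c. of_bool (c = b)) a)"
proof
  fix a
  have "T (\<lambda>c. of_bool (c = b)) a = (if a \<in> A then of_int (M a b) else 0)" if "b \<in> B" for b
    using that fin_B by (simp add: int_map_def of_bool_def if_distrib cong: if_cong)
  then show "T w a = (\<Sum>b\<in>B. w b * T (\<lambda>c. of_bool (c = b)) a)"
    by (simp add: int_map_def ac_simps)
qed

text \<open>A real combination of integral cuts is T of the same combination of cochains; conversely
  T w is a combination of the cuts of unit vectors, which are integral. In this form the adjoint
  relation applies to the span.\<close>

lemma real_span_cuts: "real_span cuts = T ` supported B"
proof (intro equalityI subsetI)
  fix u assume "u \<in> real_span cuts"
  then obtain W a where W: "u = (\<lambda>\<sigma>. \<Sum>w\<in>W. a w * w \<sigma>)" "finite W" "W \<subseteq> cuts"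
    unfolding real_span_def by blast
  have "(\<lambda>\<sigma>. \<Sum>w\<in>W. a w * w \<sigma>) \<in> T ` supported B"
    using W(2,3)
  proof (induction W rule: finite_induct)
    case empty
    have "(\<lambda>_. 0) \<in> supported B" by (simp add: supported_def)
    then show ?case by (intro image_eqI[of _ _ "\<lambda>_. 0"]) auto
  next
    case (insert w W)
    then obtain v where v: "v \<in> supported B" "(\<lambda>\<sigma>. \<Sum>w\<in>W. a w * w \<sigma>) = T v" by blast
    obtain z where z: "z \<in> ints B" "w = T z" using insert by blast
    have "T (\<lambda>b. a w * z b + v b) = (\<lambda>\<sigma>. a w * T z \<sigma> + T v \<sigma>)"
      by (simp add: int_map_add int_map_scale)
    also have "\<dots> = (\<lambda>\<sigma>. \<Sum>w\<in>insert w W. a w * w \<sigma>)"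
      unfolding z(2)[symmetric] v(2)[symmetric] using insert.hyps by simp
    finally have "T (\<lambda>b. a w * z b + v b) = (\<lambda>\<sigma>. \<Sum>w\<in>insert w W. a w * w \<sigma>)" .
    moreover have "(\<lambda>b. a w * z b + v b) \<in> supported B"
      using v(1) z(1) by (auto simp: supported_def ints_def)
    ultimately show ?case by (metis imageI)
  qed
  then show "u \<in> T ` supported B" by (simp add: W)
next
  fix u assume "u \<in> T ` supported B"
  then obtain w where "w \<in> supported B" "u = T w" by blast
  moreover have "(\<lambda>a. \<Sum>b\<in>B. w b * T (\<lambda>c. of_bool (c = b)) a) \<in> real_span cuts"
    by (intro real_span_sum real_span_base imageI unit_ints)
  ultimately show "u \<in> real_span cuts" by (simp add: T_sum_units)
qed

text \<open>Gram-Schmidt on the cuts of the unit vectors, one unit vector at a time.\<close>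

lemma partial_normal_equation:
  assumes "finite S" "S \<subseteq> B"
  shows "\<exists>w\<in>supported S. \<forall>b\<in>S. D (T w) b = D v b"
  using assms
proof (induction S arbitrary: v rule: finite_induct)
  case empty
  then show ?case by (auto simp: supported_def intro!: bexI[of _ "\<lambda>_. 0"])
next
  case (insert s S)
  define e where "e = (\<lambda>c. of_bool (c = s) :: real)"
  obtain w where w: "w \<in> supported S" "\<forall>b\<in>S. D (T w) b = D v b" using insert by blast
  obtain z where z: "z \<in> supported S" "\<forall>b\<in>S. D (T z) b = D (T e) b" using insert by blast
  \<comment> \<open>The component of the cut of the unit vector at s that is orthogonal to the cuts
    of the units in S: its boundary vanishes on S.\<close>
  define g where "g = T (\<lambda>b. e b - z b)"
  have gS: "D g b = 0" if "b \<in> S" for b using z(2) that by (simp add: g_def int_map_diff)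
  define d where "d = D g s"
  \<comment> \<open>The Gram-Schmidt coefficient; d is the squared length of g. If d = 0 then k is 0
    by the convention for division, and no correction is made: by \<open>d0\<close> the equation at
    s holds already.\<close>
  define k where "k = (D v s - D (T w) s) / d"
  have gg: "std_inner A g g = d"
  proof -
    have "std_inner A g g = (\<Sum>b\<in>B. D g b * (e b - z b))"
      using adjoint[of g "\<lambda>b. e b - z b"] by (simp add: g_def std_inner_def)
    also have "\<dots> = (\<Sum>b\<in>{s}. D g b * (e b - z b))"
    proof (intro sum.mono_neutral_right fin_B)
      show "\<forall>b\<in>B - {s}. D g b * (e b - z b) = 0"
        using gS z(1) by (auto simp: e_def supported_def)
    qed (use insert in auto)
    also have "\<dots> = d" using z(1) insert.hyps by (simp add: e_def d_def supported_def)
    finally show ?thesis .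
  qed
  \<comment> \<open>With g = 0 the pairing of v - T w with g is zero. By adjointness it is a sum
    over B in which S drops out by the choice of w, and the indices outside
    \<open>insert s S\<close> drop out by the supports. What remains is the term at s.\<close>
  have d0: "D v s = D (T w) s" if "d = 0"
  proof -
    have "g a = 0" if "a \<in> A" for a using std_inner_self_eq_0[OF fin_A _ that, of g] gg \<open>d = 0\<close> by simp
    then have "std_inner A (\<lambda>\<sigma>. v \<sigma> - T w \<sigma>) g = 0" by (simp add: std_inner_def)
    then have "0 = (\<Sum>b\<in>B. (D v b - D (T w) b) * (e b - z b))"
      unfolding g_def adjoint by (simp add: std_inner_def int_map_diff)
    also have "\<dots> = (\<Sum>b\<in>{s}. (D v b - D (T w) b) * (e b - z b))"
    proof (intro sum.mono_neutral_right fin_B)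
      show "\<forall>b\<in>B - {s}. (D v b - D (T w) b) * (e b - z b) = 0"
      proof
        fix b assume "b \<in> B - {s}"
        then show "(D v b - D (T w) b) * (e b - z b) = 0"
          using w(2) z(1) by (cases "b \<in> S") (auto simp: e_def supported_def)
      qed
    qed (use insert in auto)
    also have "\<dots> = D v s - D (T w) s" using z(1) insert.hyps by (simp add: e_def supported_def)
    finally show ?thesis by simp
  qed
  let ?w = "\<lambda>b. w b + k * (e b - z b)"
  have DT: "D (T ?w) = (\<lambda>b. D (T w) b + k * D g b)"
    by (simp add: g_def int_map_add int_map_scale)
  have "D (T ?w) b = D v b" if "b \<in> insert s S" for b
  proof -
    have "k * d = D v s - D (T w) s" using d0 by (cases "d = 0") (simp_all add: k_def)
    then have "D (T w) b + k * D g b = D v b" using that w(2) gS by (auto simp: d_def)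
    then show ?thesis by (simp only: DT)
  qed
  moreover have "?w \<in> supported (insert s S)"
    using w(1) z(1) by (auto simp: supported_def e_def)
  ultimately show ?case by blast
qed

text \<open>The normal equations of least squares for v and the span of the cuts. They are solvable
  for every v, even when the composite of D and T is singular.\<close>

lemma normal_equation: "\<exists>w\<in>supported B. D (T w) = D v"
proof -
  obtain w where "w \<in> supported B" "\<forall>b\<in>B. D (T w) b = D v b"
    using partial_normal_equation[OF fin_B] by blast
  moreover from this have "D (T w) = D v" by (auto simp: int_map_def)
  ultimately show ?thesis by blast
qed

text \<open>By adjointness v - u is orthogonal to all cuts iff u and v have the same boundary. So
  the projection of v is the one vector of the span with boundary D v, which makes the left square
  commute.\<close>

lemma orth_proj_cuts:
  shows "orth_proj A (real_span cuts) v \<in> real_span cuts" "D (orth_proj A (real_span cuts) v) = D v"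
    and "\<And>u. u \<in> real_span cuts \<Longrightarrow> D u = D v \<Longrightarrow> orth_proj A (real_span cuts) v = u"
proof -
  let ?P = "\<lambda>u. u \<in> real_span cuts \<and> (\<forall>w\<in>real_span cuts. std_inner A (\<lambda>\<sigma>. v \<sigma> - u \<sigma>) w = 0)"
  have P: "?P u \<longleftrightarrow> u \<in> real_span cuts \<and> D u = D v" for u
  proof -
    have "(\<forall>w\<in>supported B. std_inner B (D (\<lambda>\<sigma>. v \<sigma> - u \<sigma>)) w = 0) \<longleftrightarrow> D u = D v"
    proof
      assume 0: "\<forall>w\<in>supported B. std_inner B (D (\<lambda>\<sigma>. v \<sigma> - u \<sigma>)) w = 0"
      have "D (\<lambda>\<sigma>. v \<sigma> - u \<sigma>) b = 0" if "b \<in> B" for b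
        using 0 unit_ints[OF that] ints_supported[of B] std_inner_unit[OF that, of "D (\<lambda>\<sigma>. v \<sigma> - u \<sigma>)"]
        by (auto simp: subset_iff)
      then show "D u = D v" by (auto simp: int_map_diff fun_eq_iff) (auto simp: int_map_def)
    qed (simp add: int_map_diff std_inner_def)
    then show ?thesis unfolding real_span_cuts by (simp add: adjoint)
  qed
  have uniq: "u = u'" if "?P u" "?P u'" for u u'
    using that unfolding P unfolding real_span_cuts using D_T_inject by auto
  obtain w where "w \<in> supported B" "D (T w) = D v" using normal_equation by blast
  then have "?P (T w)" unfolding P unfolding real_span_cuts by auto
  then have ex: "\<exists>!u. ?P u" using uniq by blast
  have "?P (orth_proj A (real_span cuts) v)" unfolding orth_proj_def by (rule theI'[OF ex])
  then show "orth_proj A (real_span cuts) v \<in> real_span cuts" "D (orth_proj A (real_span cuts) v) = D v"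
    unfolding P by blast+
  show "orth_proj A (real_span cuts) v = u" if "u \<in> real_span cuts" "D u = D v" for u
    unfolding orth_proj_def using that P by (intro the1_equality[OF ex]) blast
qed

text \<open>Pairing u with the cut of a unit vector reads off a coefficient of D u.\<close>

lemma dual_cuts: "dual_lattice A cuts = {u \<in> real_span cuts. D u \<in> ints B}"
proof -
  have "(\<forall>w\<in>ints B. std_inner B (D u) w \<in> \<int>) \<longleftrightarrow> D u \<in> ints B" for u
  proof
    assume 0: "\<forall>w\<in>ints B. std_inner B (D u) w \<in> \<int>"
    then have "D u b \<in> \<int>" if "b \<in> B" for b
      using unit_ints[OF that] std_inner_unit[OF that, of "D u"] by auto
    then show "D u \<in> ints B" by (auto simp: ints_def int_map_def)
  next
    assume "D u \<in> ints B"
    then show "\<forall>w\<in>ints B. std_inner B (D u) w \<in> \<int>"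
      by (auto simp: ints_def std_inner_def intro!: Ints_sum Ints_mult)
  qed
  then show ?thesis by (auto simp: dual_lattice_def adjoint)
qed

text \<open>A rational-linear retraction of the reals onto the rationals, applied to a real solution of an
  integral linear system, yields a rational solution; then denominators are cleared.\<close>

lemma torsion_of_integral:
  assumes "u \<in> real_span cuts" "D u \<in> ints B"
  shows "\<exists>n::nat. n > 0 \<and> (\<lambda>\<sigma>. real n * u \<sigma>) \<in> cuts"
proof -
  obtain w where w: "w \<in> supported B" "u = T w" using assms unfolding real_span_cuts by blast
  obtain g :: "real \<Rightarrow> rat" where g: "\<And>a b. g (a + b) = g a + g b" "g 1 = 1" using rational_retraction by blast
  interpret g: Modules.additive g by unfold_locales (rule g)
  have g_nat: "g (of_nat n * a) = of_nat n * g a" for n a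
    by (induction n) (auto simp: g.zero g.add algebra_simps)
  have g_int: "g (of_int k * a) = of_int k * g a" for k a
  proof (cases "k \<ge> 0")
    case True
    then show ?thesis using g_nat[of "nat k" a] by simp
  next
    case False
    then have "g (- (of_int k * a)) = - of_int k * g a" using g_nat[of "nat (- k)" a] by simp
    then show ?thesis by (simp add: g.minus)
  qed
  define v where "v b = real_of_rat (g (w b))" for b
  have v: "v \<in> supported B" using w by (auto simp: supported_def v_def g.zero)
  have Tg: "T v a = real_of_rat (g (T w a))" for a
    by (auto simp: int_map_def v_def g.sum g_int g.zero of_rat_sum of_rat_mult)
  have "D (T v) b = real_of_rat (g (D (T w) b))" for b
    by (auto simp: int_map_def[of A B] Tg g.sum g_int g.zero of_rat_sum of_rat_mult)
  moreover have "real_of_rat (g (D (T w) b)) = D (T w) b" for b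
  proof -
    have "D (T w) b \<in> \<int>" using assms w by (auto simp: ints_def)
    then obtain k where "D (T w) b = of_int k" by (rule Ints_cases)
    then show ?thesis using g_int[of k 1] g(2) by simp
  qed
  ultimately have "D (T v) = D (T w)" by auto
  \<comment> \<open>This is more than some rational solution: D is injective on real cuts, so u
    itself is the cut of the rational cochain v.\<close>
  then have uv: "u = T v" using D_T_inject w by auto
  obtain n :: nat where n: "n > 0" "\<And>b. b \<in> B \<Longrightarrow> real n * v b \<in> \<int>"
    using common_denominator[OF fin_B, of "\<lambda>b. g (w b)"] unfolding v_def by blast
  have "(\<lambda>b. real n * v b) \<in> ints B"
    unfolding ints_def
  proof (intro CollectI conjI allI impI)
    show "real n * v b \<in> \<int>" for b using n v by (cases "b \<in> B") (auto simp: supported_def)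
  qed (use v in \<open>auto simp: supported_def\<close>)
  then have "(\<lambda>\<sigma>. real n * u \<sigma>) \<in> cuts" unfolding uv int_map_scale[symmetric] by (rule imageI)
  with n show ?thesis by blast
qed

end

text \<open>The groups are listed from right to left: the sequence runs from C through B to
  A.\<close>

lemma short_exact_sequenceI:
  assumes "group A" "group B" "group C" "f \<in> hom B A" "g \<in> hom C B"
    and "kernel B A f = g ` carrier C" "f ` carrier B = carrier A" "inj_on g (carrier C)"
  shows "short_exact_sequence A B C f g"
  using assms
  by (simp add: short_exact_sequence_iff epi_def mon_def group_hom_def group_hom_axioms_def)

text \<open>\<psi> is prescribed, so only \<phi> is constructed, and the right square forces it to
  be q after \<beta>, followed by the inverse of \<gamma>. Exactness is read off from the lower row
  through the three bijections.\<close>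

lemma transport_exact_row:
  assumes row: "short_exact_sequence A' B' C' q j"
    and \<alpha>: "\<alpha> \<in> iso C C'" and \<beta>: "\<beta> \<in> iso B B'" and \<gamma>: "\<gamma> \<in> iso A A'"
    and grp: "group A" "group B" "group C"
    and \<psi>: "\<psi> \<in> hom C B" and comm: "\<And>x. x \<in> carrier C \<Longrightarrow> \<beta> (\<psi> x) = j (\<alpha> x)"
  shows "\<exists>\<phi>. short_exact_sequence A B C \<phi> \<psi> \<and> (\<forall>y\<in>carrier B. \<gamma> (\<phi> y) = q (\<beta> y))"
proof -
  have row': "group A'" "group B'" "group C'" "q \<in> hom B' A'" "j \<in> hom C' B'"
    "kernel B' A' q = j ` carrier C'" "q ` carrier B' = carrier A'" "inj_on j (carrier C')"
    using row by (simp_all add: short_exact_sequence_iff epi_def mon_def group_hom_def group_hom_axioms_def)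
  define \<delta> where "\<delta> = inv_into (carrier A) \<gamma>"
  have \<delta>: "\<delta> \<in> iso A' A" unfolding \<delta>_def using grp(1) \<gamma> by (rule group.iso_set_sym)
  have \<gamma>s: "\<gamma> ` carrier A = carrier A'" and \<gamma>i: "inj_on \<gamma> (carrier A)" and \<gamma>h: "\<gamma> \<in> hom A A'"
    using \<gamma> by (auto simp: iso_def bij_betw_def)
  have \<beta>s: "\<beta> ` carrier B = carrier B'" and \<beta>i: "inj_on \<beta> (carrier B)" and \<beta>h: "\<beta> \<in> hom B B'"
    using \<beta> by (auto simp: iso_def bij_betw_def)
  have \<alpha>s: "\<alpha> ` carrier C = carrier C'" and \<alpha>i: "inj_on \<alpha> (carrier C)"
    using \<alpha> by (auto simp: iso_def bij_betw_def)
  have \<delta>s: "\<delta> ` carrier A' = carrier A" and \<delta>h: "\<delta> \<in> hom A' A"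
    using \<delta> by (auto simp: iso_def bij_betw_def)
  have \<gamma>\<delta>: "\<gamma> (\<delta> z) = z" if "z \<in> carrier A'" for z
    unfolding \<delta>_def using that \<gamma>s by (intro f_inv_into_f) auto
  have q\<beta>: "q (\<beta> y) \<in> carrier A'" if "y \<in> carrier B" for y
    using that \<beta>h row'(4) by (auto simp: hom_def)
  define \<phi> where "\<phi> = (\<lambda>y. \<delta> (q (\<beta> y)))"
  have \<gamma>\<phi>: "\<gamma> (\<phi> y) = q (\<beta> y)" if "y \<in> carrier B" for y
    unfolding \<phi>_def by (rule \<gamma>\<delta>[OF q\<beta>[OF that]])
  have \<phi>h: "\<phi> \<in> hom B A"
    using hom_compose[OF hom_compose[OF \<beta>h row'(4)] \<delta>h] by (simp add: \<phi>_def o_def)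
  have \<psi>c: "\<psi> x \<in> carrier B" if "x \<in> carrier C" for x using that \<psi> by (auto simp: hom_def)
  have one: "\<phi> y = \<one>\<^bsub>A\<^esub> \<longleftrightarrow> q (\<beta> y) = \<one>\<^bsub>A'\<^esub>" if y: "y \<in> carrier B" for y
  proof -
    have \<phi>y: "\<phi> y \<in> carrier A" using y \<phi>h by (auto simp: hom_def)
    have 1: "\<one>\<^bsub>A\<^esub> \<in> carrier A" using grp(1) by (simp add: group.is_monoid monoid.one_closed)
    have "\<gamma> \<one>\<^bsub>A\<^esub> = \<one>\<^bsub>A'\<^esub>" using \<gamma>h grp(1) row'(1) by (rule hom_one)
    with inj_on_eq_iff[OF \<gamma>i \<phi>y 1] \<gamma>\<phi>[OF y] show ?thesis by simp
  qed
  have "short_exact_sequence A B C \<phi> \<psi>"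
  proof (rule short_exact_sequenceI[OF grp \<phi>h \<psi>])
    show "kernel B A \<phi> = \<psi> ` carrier C"
    proof (intro equalityI subsetI)
      fix y assume "y \<in> kernel B A \<phi>"
      then have y: "y \<in> carrier B" "q (\<beta> y) = \<one>\<^bsub>A'\<^esub>" using one by (auto simp: kernel_def)
      then have "\<beta> y \<in> kernel B' A' q" using \<beta>s by (auto simp: kernel_def)
      then obtain x where x: "x \<in> carrier C" "\<beta> y = j (\<alpha> x)" unfolding row'(6) \<alpha>s[symmetric] by blast
      then have "\<beta> y = \<beta> (\<psi> x)" using comm by simp
      then have "y = \<psi> x" using inj_onD[OF \<beta>i _ y(1) \<psi>c[OF x(1)]] by simp
      then show "y \<in> \<psi> ` carrier C" using x(1) by blast
    next
      fix y assume "y \<in> \<psi> ` carrier C"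
      then obtain x where x: "x \<in> carrier C" "y = \<psi> x" by blast
      then have "\<beta> y \<in> kernel B' A' q" unfolding row'(6) using comm \<alpha>s by auto
      then have "q (\<beta> y) = \<one>\<^bsub>A'\<^esub>" by (simp add: kernel_def)
      then show "y \<in> kernel B A \<phi>" using x \<psi>c one by (auto simp: kernel_def)
    qed
    have "\<phi> ` carrier B = \<delta> ` q ` \<beta> ` carrier B" by (auto simp: \<phi>_def)
    then show "\<phi> ` carrier B = carrier A" by (simp add: \<beta>s row'(7) \<delta>s)
    show "inj_on \<psi> (carrier C)"
    proof (rule inj_onI)
      fix x x' assume x: "x \<in> carrier C" "x' \<in> carrier C" "\<psi> x = \<psi> x'"
      then have "j (\<alpha> x) = j (\<alpha> x')" using comm by metis
      moreover have "\<alpha> x \<in> carrier C'" "\<alpha> x' \<in> carrier C'" using \<alpha>s x by auto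
      ultimately have "\<alpha> x = \<alpha> x'" using inj_onD[OF row'(8)] by blast
      then show "x = x'" using inj_onD[OF \<alpha>i] x by blast
    qed
  qed
  with \<gamma>\<phi> show ?thesis by blast
qed

text \<open>K stands for the cycles of dimension d - 1. What matters is that they contain the image
  of D, which is where boundary squared zero enters, and that an integral chain with a positive
  multiple in K is in K, as for every kernel into a torsion-free group.\<close>

locale cut_flow = integer_matrix A B M for A B :: "'c set" and M +
  fixes K :: "('c \<Rightarrow> real) set"
  assumes K: "real_subgroup K" "K \<subseteq> ints B" and image_K: "D ` ints A \<subseteq> K"
    and saturated: "\<And>u n. u \<in> ints B \<Longrightarrow> n > 0 \<Longrightarrow> (\<lambda>\<sigma>. real n * u \<sigma>) \<in> K \<Longrightarrow> u \<in> K"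
begin

definition "bounds = D ` ints A"
text \<open>Named after the combinatorial Laplacian, the coboundary followed by the
  boundary.\<close>

definition "Lap = (D \<circ> T) ` ints B"
definition "CF = cuts <#>\<^bsub>vec_group (ints A)\<^esub> flows"
abbreviation "Cdual \<equiv> dual_lattice A cuts"
abbreviation "proj \<equiv> orth_proj A (real_span cuts)"

lemma in_bounds_iff: "u \<in> bounds \<longleftrightarrow> (\<exists>v\<in>ints A. u = D v)"
  by (auto simp: bounds_def)

lemma in_Lap_iff: "u \<in> Lap \<longleftrightarrow> (\<exists>w\<in>ints B. u = D (T w))"
  by (auto simp: Lap_def)

lemma D_bounds: "v \<in> ints A \<Longrightarrow> D v \<in> bounds"
  and D_T_Lap: "w \<in> ints B \<Longrightarrow> D (T w) \<in> Lap"
  by (auto simp: in_bounds_iff in_Lap_iff)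

lemma cuts_ints: "cuts \<subseteq> ints A"
  by (auto simp: int_map_ints)

lemma cuts_flows: "cuts \<inter> flows = {\<lambda>_. 0}"
proof -
  have "(\<lambda>_. 0) \<in> cuts"
    using real_subgroup_0[OF real_subgroup_image_int_map[OF real_subgroup_ints]] .
  moreover have "(\<lambda>_. 0) \<in> flows" using real_subgroup_0[OF real_subgroup_ints] by simp
  moreover have "u = (\<lambda>_. 0)" if "u \<in> cuts" "u \<in> flows" for u
  proof -
    obtain w where "u = T w" using \<open>u \<in> cuts\<close> by blast
    with \<open>u \<in> flows\<close> T_eq_0_iff[of w] show ?thesis by simp
  qed
  ultimately show ?thesis by blast
qed

lemma subgroup_cuts: "real_subgroup cuts" and subgroup_bounds: "real_subgroup bounds" and subgroup_Lap: "real_subgroup Lap"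
  unfolding bounds_def Lap_def image_comp[symmetric] by (intro real_subgroup_image_int_map real_subgroup_ints)+

lemma Lap_bounds: "Lap \<subseteq> bounds"
  using int_map_ints by (fastforce simp: in_Lap_iff in_bounds_iff)

lemma bounds_K: "bounds \<subseteq> K" using image_K by (simp add: bounds_def)

lemma Lap_K: "Lap \<subseteq> K" using Lap_bounds bounds_K by blast

text \<open>If u has the boundary of an integral cut, then it differs from that cut by a flow. Thus
  the sum of cuts and flows is the preimage of \<open>Lap\<close> under D, and \<alpha> is an
  instance of the isomorphism theorem.\<close>

lemma CF_iff: "u \<in> CF \<longleftrightarrow> u \<in> ints A \<and> D u \<in> Lap"
proof
  assume "u \<in> CF"
  then obtain c f where cf: "c \<in> cuts" "f \<in> flows" "u = (\<lambda>\<sigma>. c \<sigma> + f \<sigma>)" by (auto simp: CF_def set_mult_def)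
  then have "D u = D c" by (simp add: int_map_add)
  with cf show "u \<in> ints A \<and> D u \<in> Lap"
    using cuts_ints real_subgroup_add[OF real_subgroup_ints, of c A f] by (auto simp: in_Lap_iff)
next
  assume u: "u \<in> ints A \<and> D u \<in> Lap"
  then obtain w where w: "w \<in> ints B" "D u = D (T w)" by (auto simp: in_Lap_iff)
  then have "(\<lambda>\<sigma>. u \<sigma> - T w \<sigma>) \<in> flows"
    using u cuts_ints by (auto simp: int_map_diff intro!: real_subgroup_diff[OF real_subgroup_ints])
  moreover have "u = T w \<otimes>\<^bsub>vec_group (ints A)\<^esub> (\<lambda>\<sigma>. u \<sigma> - T w \<sigma>)" by simp
  ultimately show "u \<in> CF" unfolding CF_def set_mult_def using w(1) by blast
qed

lemma subgroup_CF: "real_subgroup CF"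
  using real_subgroup_ints[of A] subgroup_Lap
  unfolding real_subgroup_def by (auto simp: CF_iff int_map_diff)

lemma CF_ints: "CF \<subseteq> ints A" using CF_iff by blast

lemma Cdual_iff: "u \<in> Cdual \<longleftrightarrow> u \<in> real_span cuts \<and> D u \<in> ints B"
  by (simp add: dual_cuts)

lemma real_span_inject: "u \<in> real_span cuts \<Longrightarrow> v \<in> real_span cuts \<Longrightarrow> D u = D v \<Longrightarrow> u = v"
  unfolding real_span_cuts using D_T_inject by auto

lemma cuts_Cdual: "cuts \<subseteq> Cdual"
  using real_span_base[of _ cuts] cuts_ints int_map_ints[of _ A B M] by (auto simp: Cdual_iff)

lemma subgroup_Cdual: "real_subgroup Cdual"
proof -
  have "(\<lambda>\<sigma>. u \<sigma> - v \<sigma>) \<in> real_span cuts" if "u \<in> real_span cuts" "v \<in> real_span cuts" for u v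
    using real_span_add[OF that(1) real_span_scale[OF that(2), of "-1"]] by simp
  then show ?thesis
    using real_subgroup_ints[of B] real_span_0[of cuts]
    unfolding real_subgroup_def by (auto simp: Cdual_iff int_map_diff)
qed

lemma Lap_iff: assumes "u \<in> real_span cuts" shows "D u \<in> Lap \<longleftrightarrow> u \<in> cuts"
proof
  assume "D u \<in> Lap"
  then obtain w where w: "w \<in> ints B" "D u = D (T w)" by (auto simp: in_Lap_iff)
  then have "u = T w" using real_span_inject[OF assms real_span_base[of "T w"]] by blast
  with w show "u \<in> cuts" by blast
qed (auto simp: in_Lap_iff)

text \<open>Integrality of D u does not by itself put it into K. But a multiple of u is a cut, so a
  multiple of D u lies in \<open>Lap\<close> and hence in K, and K is saturated.\<close>

lemma D_Cdual: assumes "u \<in> Cdual" shows "D u \<in> saturation K Lap"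
proof -
  have u: "u \<in> real_span cuts" "D u \<in> ints B" using assms by (simp_all add: Cdual_iff)
  then obtain n :: nat where n: "n > 0" "(\<lambda>\<sigma>. real n * u \<sigma>) \<in> cuts" using torsion_of_integral by blast
  have "D (\<lambda>\<sigma>. real n * u \<sigma>) \<in> Lap" using n(2) by (auto simp: in_Lap_iff)
  then have L: "(\<lambda>\<sigma>. real n * D u \<sigma>) \<in> Lap" by (simp only: int_map_scale)
  with Lap_K saturated[OF u(2) n(1)] have "D u \<in> K" by blast
  with n(1) L show ?thesis unfolding saturation_def by blast
qed

lemma proj_Cdual: "v \<in> ints A \<Longrightarrow> proj v \<in> Cdual"
  by (simp add: Cdual_iff orth_proj_cuts int_map_ints)

text \<open>A boundary D v is also the boundary of the projection of v, which lies in the dual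
  lattice. So every boundary is torsion modulo \<open>Lap\<close>.\<close>

lemma bounds_saturation: "bounds \<subseteq> saturation K Lap"
proof
  fix u assume "u \<in> bounds"
  then obtain v where v: "v \<in> ints A" "u = D v" by (auto simp: in_bounds_iff)
  with D_Cdual[OF proj_Cdual] show "u \<in> saturation K Lap" by (simp add: orth_proj_cuts)
qed

text \<open>The torsion of homology is the torsion of the full cokernel of D, and the latter is what
  a diagonal form computes.\<close>

lemma saturation_K: "saturation K bounds = saturation (ints B) bounds"
  using K bounds_K saturated unfolding saturation_def by blast

section \<open>The maps of the diagram on representatives\<close>

sublocale \<alpha>: lattice_map "ints A" CF bounds Lap D
  by unfold_locales (auto simp: real_subgroup_ints subgroup_CF subgroup_bounds subgroup_Lap CF_iff int_map_add
    D_bounds Lap_bounds[THEN subsetD])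

sublocale \<beta>: lattice_map Cdual cuts "saturation K Lap" Lap D
  using subset_saturation[OF Lap_K]
  by unfold_locales (auto simp: subgroup_Cdual subgroup_cuts subgroup_Lap K real_subgroup_saturation D_Cdual
    int_map_add D_T_Lap cuts_Cdual[THEN subsetD])

sublocale \<psi>: lattice_map "ints A" CF Cdual cuts proj
proof
  fix u v
  show "proj (\<lambda>\<sigma>. u \<sigma> + v \<sigma>) = (\<lambda>\<sigma>. proj u \<sigma> + proj v \<sigma>)"
    by (intro orth_proj_cuts(3) real_span_add orth_proj_cuts(1)) (simp add: int_map_add orth_proj_cuts)
next
  fix u assume "u \<in> CF"
  then have "D (proj u) \<in> Lap" by (simp add: CF_iff orth_proj_cuts)
  then show "proj u \<in> cuts" using Lap_iff orth_proj_cuts(1) by blast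
qed (simp_all add: real_subgroup_ints subgroup_CF CF_ints subgroup_Cdual subgroup_cuts cuts_Cdual proj_Cdual)

sublocale j: lattice_map bounds Lap "saturation K Lap" Lap "\<lambda>u. u"
  using subset_saturation[OF Lap_K] bounds_saturation Lap_bounds
  by unfold_locales (auto simp: subgroup_bounds subgroup_Lap K real_subgroup_saturation)

lemma saturation_Lap_bounds: "saturation K Lap \<subseteq> saturation K bounds"
  using Lap_bounds unfolding saturation_def by blast

sublocale q: lattice_map "saturation K Lap" Lap "saturation K bounds" bounds "\<lambda>u. u"
  using subset_saturation[OF Lap_K] subset_saturation[OF bounds_K] Lap_bounds saturation_Lap_bounds
  by unfold_locales (auto simp: subgroup_bounds subgroup_Lap K real_subgroup_saturation)

text \<open>Multipliers compose: a multiple that is a boundary has a further multiple in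
  \<open>Lap\<close>. This makes q surjective onto the torsion of homology.\<close>

lemma saturation_eq: "saturation K bounds = saturation K Lap"
proof (intro equalityI saturation_Lap_bounds subsetI)
  fix u assume "u \<in> saturation K bounds"
  then obtain m :: nat where m: "u \<in> K" "m > 0" "(\<lambda>\<sigma>. real m * u \<sigma>) \<in> bounds" by (auto simp: saturation_def)
  with bounds_saturation have "(\<lambda>\<sigma>. real m * u \<sigma>) \<in> saturation K Lap" by blast
  then obtain n :: nat where "n > 0" "(\<lambda>\<sigma>. real n * (real m * u \<sigma>)) \<in> Lap" unfolding saturation_def by blast
  with m have "n * m > 0" "(\<lambda>\<sigma>. real (n * m) * u \<sigma>) \<in> Lap" by (simp_all add: mult.assoc)
  with m(1) show "u \<in> saturation K Lap" unfolding saturation_def by blast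
qed

lemma \<alpha>_iso: "induced Lap D \<in> iso (vec_group (ints A) Mod CF) (vec_group bounds Mod Lap)"
  by (rule \<alpha>.iso_induced) (auto simp: CF_iff in_bounds_iff)

lemma \<beta>_iso: "induced Lap D \<in> iso (vec_group Cdual Mod cuts) (vec_group (saturation K Lap) Mod Lap)"
proof (rule \<beta>.iso_induced)
  show "u \<in> cuts" if "u \<in> Cdual" "D u \<in> Lap" for u using that Lap_iff by (simp add: Cdual_iff)
next
  fix u assume "u \<in> saturation K Lap"
  then obtain n :: nat where n: "u \<in> K" "n > 0" "(\<lambda>\<sigma>. real n * u \<sigma>) \<in> Lap" by (auto simp: saturation_def)
  then obtain w where w: "w \<in> ints B" "(\<lambda>\<sigma>. real n * u \<sigma>) = D (T w)" by (auto simp: in_Lap_iff)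
  \<comment> \<open>Division by n may leave the lattice of cuts but not its real span, and the
    result has boundary u.\<close>
  let ?v = "\<lambda>\<sigma>. (1 / real n) * T w \<sigma>"
  have "D ?v = (\<lambda>\<sigma>. (1 / real n) * (real n * u \<sigma>))" unfolding int_map_scale w(2)[symmetric] ..
  then have v: "D ?v = u" using n(2) by simp
  moreover have "?v \<in> real_span cuts" using w(1) by (intro real_span_scale real_span_base imageI)
  ultimately show "\<exists>v\<in>Cdual. D v = u" using n(1) K(2) by (intro bexI[of _ ?v]) (auto simp: Cdual_iff)
qed

text \<open>The sequence of the third isomorphism theorem for \<open>Lap\<close>,
  \<open>bounds\<close> and their common saturation; both maps are the identity on
  representatives.\<close>

lemma exact_row:
  "short_exact_sequence (vec_group (saturation K bounds) Mod bounds) (vec_group (saturation K Lap) Mod Lap)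
     (vec_group bounds Mod Lap) (induced bounds (\<lambda>u. u)) (induced Lap (\<lambda>u. u))"
proof (rule short_exact_sequenceI)
  show "group (vec_group (saturation K bounds) Mod bounds)" "group (vec_group (saturation K Lap) Mod Lap)" "group (vec_group bounds Mod Lap)"
    by (intro group_quotient q.X q.Y q.N q.L j.X)+ (use Lap_bounds in auto)
  show "kernel (vec_group (saturation K Lap) Mod Lap) (vec_group (saturation K bounds) Mod bounds) (induced bounds (\<lambda>u. u))
      = induced Lap (\<lambda>u. u) ` carrier (vec_group bounds Mod Lap)"
  proof -
    have "kernel (vec_group (saturation K Lap) Mod Lap) (vec_group (saturation K bounds) Mod bounds) (induced bounds (\<lambda>u. u))
        = coset Lap ` {u \<in> saturation K Lap. u \<in> bounds}"
    proof -
      have "induced bounds (\<lambda>u. u) (coset Lap u) = bounds \<longleftrightarrow> u \<in> bounds" if "u \<in> saturation K Lap" for u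
        using that by (simp add: q.induced_coset coset_eq_self_iff subgroup_bounds)
      then show ?thesis by (auto simp: kernel_def carrier_quotient)
    qed
    also have "\<dots> = coset Lap ` bounds" using bounds_saturation by auto
    also have "\<dots> = induced Lap (\<lambda>u. u) ` carrier (vec_group bounds Mod Lap)"
      unfolding carrier_quotient image_image by (intro image_cong refl) (simp add: j.induced_coset)
    finally show ?thesis .
  qed
  show "induced bounds (\<lambda>u. u) ` carrier (vec_group (saturation K Lap) Mod Lap) = carrier (vec_group (saturation K bounds) Mod bounds)"
    by (rule q.surj_induced) (simp add: saturation_eq)
qed (rule q.induced_hom j.induced_hom j.inj_induced; assumption?)+

theorem cut_flow_diagram:
  "\<exists>\<phi> \<gamma>.
    short_exact_sequence (vec_group (saturation (ints A) cuts) Mod cuts) (vec_group Cdual Mod cuts)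
      (vec_group (ints A) Mod CF) \<phi> (induced cuts proj) \<and>
    \<gamma> \<in> iso (vec_group (saturation (ints A) cuts) Mod cuts) (vec_group (saturation K bounds) Mod bounds) \<and>
    (\<forall>x\<in>carrier (vec_group (ints A) Mod CF).
      induced Lap D (induced cuts proj x) = induced Lap (\<lambda>u. u) (induced Lap D x)) \<and>
    (\<forall>y\<in>carrier (vec_group Cdual Mod cuts). \<gamma> (\<phi> y) = induced bounds (\<lambda>u. u) (induced Lap D y))"
proof -
  have grp: "group (vec_group (saturation (ints A) cuts) Mod cuts)" "group (vec_group Cdual Mod cuts)"
    "group (vec_group (ints A) Mod CF)" "group (vec_group (saturation K bounds) Mod bounds)"
    by (intro group_quotient subgroup_cuts subgroup_Cdual subgroup_CF real_subgroup_ints real_subgroup_saturation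
      subset_saturation cuts_ints cuts_Cdual CF_ints K subgroup_bounds bounds_K)+
  \<comment> \<open>The isomorphism supplied by the diagonal form has the direction opposite to
    \<gamma>.\<close>
  have "vec_group (saturation K bounds) Mod bounds \<cong> vec_group (saturation (ints A) cuts) Mod cuts"
    unfolding saturation_K unfolding bounds_def by (rule torsion_coker_transpose[OF fin_A fin_B])
  then obtain \<gamma> where \<gamma>: "\<gamma> \<in> iso (vec_group (saturation (ints A) cuts) Mod cuts) (vec_group (saturation K bounds) Mod bounds)"
    using group.iso_sym[OF grp(4)] unfolding is_iso_def by blast
  \<comment> \<open>Both ways around give the class of D v, because the projection preserves
    boundaries.\<close>
  have comm: "induced Lap D (induced cuts proj x) = induced Lap (\<lambda>u. u) (induced Lap D x)"
    if x: "x \<in> carrier (vec_group (ints A) Mod CF)" for x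
  proof -
    obtain v where v: "v \<in> ints A" "x = coset CF v" using x unfolding carrier_quotient by blast
    then show ?thesis
      by (simp add: \<psi>.induced_coset \<alpha>.induced_coset \<beta>.induced_coset j.induced_coset D_bounds proj_Cdual orth_proj_cuts)
  qed
  obtain \<phi> where "short_exact_sequence (vec_group (saturation (ints A) cuts) Mod cuts) (vec_group Cdual Mod cuts)
       (vec_group (ints A) Mod CF) \<phi> (induced cuts proj)"
    "\<forall>y\<in>carrier (vec_group Cdual Mod cuts). \<gamma> (\<phi> y) = induced bounds (\<lambda>u. u) (induced Lap D y)"
    using transport_exact_row[OF exact_row \<alpha>_iso \<beta>_iso \<gamma> grp(1-3) \<psi>.induced_hom comm] by blast
  with \<gamma> comm show ?thesis by blast
qed

end

section \<open>Attaching a cell\<close>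

text \<open>This places the disk in the type of all functions with its standard topology, so that
  continuity can be argued with \<open>continuous_on\<close>.\<close>

lemma disk_eq: "disk k = top_of_set {x. (\<forall>i\<ge>k. x i = 0) \<and> (\<Sum>i<k. (x i)\<^sup>2) \<le> 1}"
  unfolding disk_def Euclidean_space_def euclidean_product_topology subtopology_subtopology
  by (rule arg_cong[where f = "subtopology _"]) auto

lemma topspace_disk: "topspace (disk k) = {x. (\<forall>i\<ge>k. x i = 0) \<and> (\<Sum>i<k. (x i)\<^sup>2) \<le> 1}"
  by (simp add: disk_eq)

definition radius :: "nat \<Rightarrow> (nat \<Rightarrow> real) \<Rightarrow> real" where
  "radius k x = sqrt (\<Sum>i<k. (x i)\<^sup>2)"

lemma radius_nonneg [simp]: "0 \<le> radius k x"
  by (simp add: radius_def sum_nonneg)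

lemma in_disk_iff: "x \<in> topspace (disk k) \<longleftrightarrow> (\<forall>i\<ge>k. x i = 0) \<and> radius k x \<le> 1"
  by (simp add: topspace_disk radius_def)

lemma in_open_disk_iff: "x \<in> open_disk k \<longleftrightarrow> (\<forall>i\<ge>k. x i = 0) \<and> radius k x < 1"
  by (auto simp: open_disk_def in_disk_iff radius_def)

lemma in_disk_boundary_iff: "x \<in> disk_boundary k \<longleftrightarrow> (\<forall>i\<ge>k. x i = 0) \<and> radius k x = 1"
  by (auto simp: disk_boundary_def in_disk_iff radius_def)

lemma radius_scale: "0 \<le> s \<Longrightarrow> radius k (\<lambda>i. s * x i) = s * radius k x"
  by (simp add: radius_def power_mult_distrib real_sqrt_mult flip: sum_distrib_left)

lemma continuous_on_radius [continuous_intros]: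
  "continuous_on S f \<Longrightarrow> continuous_on S (\<lambda>z. radius k (f z))"
  unfolding radius_def
  by (intro continuous_on_real_sqrt continuous_on_sum continuous_on_power)
    (rule continuous_on_product_then_coordinatewise)

lemma continuous_map_radius: "continuous_map (disk k) euclideanreal (radius k)"
  by (simp add: disk_eq continuous_on_radius)

text \<open>A closed subset of the cube of all sequences with entries in [-1,1], which is compact by
  Tychonoff.\<close>

lemma compact_space_disk: "compact_space (disk k)"
proof -
  have c: "compactin (powertop_real UNIV) (\<Pi>\<^sub>E i\<in>UNIV. {-1..1})"
    by (simp add: compactin_PiE)
  have cl: "closed {x::nat \<Rightarrow> real. (\<forall>i\<ge>k. x i = 0) \<and> (\<Sum>i<k. (x i)\<^sup>2) \<le> 1}"
  proof -
    have 1: "closed {x::nat \<Rightarrow> real. k \<le> i \<longrightarrow> x i = 0}" for i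
      by (cases "k \<le> i") (simp_all add: closed_Collect_eq continuous_on_product_coordinates)
    have 2: "closed {x::nat \<Rightarrow> real. (\<Sum>i<k. (x i)\<^sup>2) \<le> 1}"
      by (rule closed_Collect_le)
        (auto intro!: continuous_on_sum continuous_on_power continuous_on_product_coordinates)
    show ?thesis by (rule closed_Collect_conj[OF closed_Collect_all[OF 1] 2])
  qed
  have sub: "{x. (\<forall>i\<ge>k. x i = 0) \<and> (\<Sum>i<k. (x i)\<^sup>2) \<le> 1} \<subseteq> (\<Pi>\<^sub>E i\<in>UNIV. {-1..1::real})"
  proof (intro subsetI PiE_I)
    fix x :: "nat \<Rightarrow> real" and i assume "x \<in> {x. (\<forall>i\<ge>k. x i = 0) \<and> (\<Sum>i<k. (x i)\<^sup>2) \<le> 1}"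
    then have x: "\<forall>i\<ge>k. x i = 0" "(\<Sum>i<k. (x i)\<^sup>2) \<le> 1" by auto
    show "x i \<in> {-1..1}"
    proof (cases "i < k")
      case True
      then have "(x i)\<^sup>2 \<le> (\<Sum>i<k. (x i)\<^sup>2)" by (intro member_le_sum) auto
      with x have "(x i)\<^sup>2 \<le> 1" by linarith
      then show ?thesis by (simp add: abs_square_le_1 abs_le_iff)
    qed (use x in auto)
  qed auto
  have "compactin euclidean {x::nat \<Rightarrow> real. (\<forall>i\<ge>k. x i = 0) \<and> (\<Sum>i<k. (x i)\<^sup>2) \<le> 1}"
    using closed_compactin[OF c sub] cl by (simp only: euclidean_product_topology closed_closedin)
  then show ?thesis
    unfolding disk_eq by (rule compact_space_subtopology)
qed

text \<open>The radial homotopy which at time 1 pushes everything of radius at least 1/2 to the boundary.\<close>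

definition inflate :: "nat \<Rightarrow> real \<Rightarrow> (nat \<Rightarrow> real) \<Rightarrow> nat \<Rightarrow> real" where
  "inflate k t x = (\<lambda>i. min (1 + t) (1 / max (radius k x) (1/2)) * x i)"

lemma radius_inflate:
  assumes "0 \<le> t" shows "radius k (inflate k t x) = min (1 + t) (1 / max (radius k x) (1/2)) * radius k x"
  unfolding inflate_def using assms by (intro radius_scale) (auto simp: min_def max_def)

lemma radius_inflate_ge:
  assumes "0 \<le> t" "radius k x \<le> 1" shows "radius k x \<le> radius k (inflate k t x)"
proof -
  have "1 \<le> min (1 + t) (1 / max (radius k x) (1/2))" using assms by (auto simp: max_def)
  from mult_right_mono[OF this radius_nonneg[of k x]] show ?thesis by (simp add: radius_inflate assms)
qed

text \<open>The factor is at most the inverse radius where the radius is at least 1/2, and at most 2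
  further in, so no point leaves the disk. The maximum with 1/2 also avoids a division by zero at
  the centre.\<close>

lemma inflate_in_disk:
  assumes "0 \<le> t" "t \<le> 1" "x \<in> topspace (disk k)"
  shows "inflate k t x \<in> topspace (disk k)"
proof -
  have "min (1 + t) (1 / max (radius k x) (1/2)) * radius k x \<le> 1 / max (radius k x) (1/2) * radius k x"
    by (intro mult_right_mono) auto
  also have "\<dots> \<le> 1" by (auto simp: max_def)
  finally have "radius k (inflate k t x) \<le> 1" by (simp add: radius_inflate assms)
  then show ?thesis using assms by (simp add: in_disk_iff inflate_def)
qed

lemma inflate_0: "x \<in> topspace (disk k) \<Longrightarrow> inflate k 0 x = x"
  by (auto simp: inflate_def in_disk_iff fun_eq_iff min_def max_def)

lemma inflate_boundary: "0 \<le> t \<Longrightarrow> x \<in> disk_boundary k \<Longrightarrow> inflate k t x = x"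
  by (auto simp: inflate_def in_disk_boundary_iff fun_eq_iff)

lemma inflate_1_boundary:
  assumes "x \<in> topspace (disk k)" "1/2 \<le> radius k x" shows "inflate k 1 x \<in> disk_boundary k"
proof -
  have "1 / radius k x \<le> 2" using assms by (simp add: divide_le_eq)
  with assms have "radius k (inflate k 1 x) = 1" by (simp add: radius_inflate)
  with assms show ?thesis by (simp add: in_disk_boundary_iff in_disk_iff inflate_def)
qed

lemma continuous_map_inflate:
  "continuous_map (prod_topology (top_of_set {0..1}) (disk k)) (disk k) (\<lambda>(t, x). inflate k t x)"
proof -
  have "continuous_on ({0..1} \<times> topspace (disk k)) (\<lambda>z i. min (1 + fst z) (1 / max (radius k (snd z)) (1/2)) * snd z i)"
  proof (rule continuous_on_coordinatewise_then_product)
    fix i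
    have "continuous_on ({0..1} \<times> topspace (disk k)) (\<lambda>z. snd z i)"
      by (rule continuous_on_product_then_coordinatewise) (rule continuous_on_snd[OF continuous_on_id])
    moreover have "continuous_on ({0..1} \<times> topspace (disk k)) (\<lambda>z. min (1 + fst z) (1 / max (radius k (snd z)) (1/2)))"
      by (intro continuous_intros) (auto simp: max_def)
    ultimately show "continuous_on ({0..1} \<times> topspace (disk k)) (\<lambda>z. min (1 + fst z) (1 / max (radius k (snd z)) (1/2)) * snd z i)"
      by (rule continuous_on_mult[rotated])
  qed
  moreover have "prod_topology (top_of_set {0..1}) (disk k) = top_of_set ({0..1::real} \<times> topspace (disk k))"
    unfolding topspace_disk by (simp only: disk_eq subtopology_Times flip: prod_topology_euclidean)
  ultimately have "continuous_map (prod_topology (top_of_set {0..1}) (disk k)) euclidean (\<lambda>(t, x). inflate k t x)"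
    unfolding inflate_def case_prod_unfold by simp
  then show ?thesis
    unfolding disk_eq[of k] continuous_map_in_subtopology
    using inflate_in_disk[of _ _ k] unfolding topspace_disk by auto
qed

lemma disk_boundary_subset: "disk_boundary k \<subseteq> topspace (disk k)"
  by (auto simp: disk_boundary_def)

lemma open_disk_eq: "open_disk k = topspace (disk k) - disk_boundary k"
  by (auto simp: in_open_disk_iff in_disk_iff in_disk_boundary_iff)

lemma Hausdorff_space_disk: "Hausdorff_space (disk k)"
  unfolding disk_eq by (intro Hausdorff_space_subtopology) simp

lemma closedin_disk_boundary: "closedin (disk k) (disk_boundary k)"
proof -
  have "closedin (disk k) {x \<in> topspace (disk k). radius k x \<in> {1}}"
    by (rule closedin_continuous_map_preimage[OF continuous_map_radius]) simp
  also have "{x \<in> topspace (disk k). radius k x \<in> {1}} = disk_boundary k"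
    by (auto simp: in_disk_boundary_iff in_disk_iff)
  finally show ?thesis .
qed

definition collar :: "nat \<Rightarrow> (nat \<Rightarrow> real) set" where
  "collar k = {x \<in> topspace (disk k). 1/2 \<le> radius k x}"

lemma inflate_collar: "0 \<le> t \<Longrightarrow> t \<le> 1 \<Longrightarrow> x \<in> collar k \<Longrightarrow> inflate k t x \<in> collar k"
  using radius_inflate_ge[of t k x] inflate_in_disk[of t x k] by (auto simp: collar_def in_disk_iff)

text \<open>One k-cell attached to the closed set B, described inside a given Hausdorff space and
  not as a quotient: the characteristic map is a homeomorphism from the open disk onto the
  complement of B.\<close>

locale attached_cell =
  fixes Y :: "'a topology" and B :: "'a set" and k :: nat and \<kappa> :: "(nat \<Rightarrow> real) \<Rightarrow> 'a"
  assumes Hausdorff: "Hausdorff_space Y"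
    and closed_B: "closedin Y B"
    and continuous: "continuous_map (disk k) Y \<kappa>"
    and boundary: "\<kappa> ` disk_boundary k \<subseteq> B"
    and homeomorphic: "homeomorphic_map (subtopology (disk k) (open_disk k)) (subtopology Y (topspace Y - B)) \<kappa>"
begin

lemma B_subset: "B \<subseteq> topspace Y"
  using closed_B closedin_subset by blast

lemma open_cell: "\<kappa> ` open_disk k = topspace Y - B"
proof -
  have "\<kappa> ` topspace (subtopology (disk k) (open_disk k)) = topspace (subtopology Y (topspace Y - B))"
    using homeomorphic homeomorphic_imp_surjective_map by blast
  then show ?thesis by (auto simp: open_disk_eq Int_absorb1)
qed

lemma inj: "inj_on \<kappa> (open_disk k)"
proof -
  have "inj_on \<kappa> (topspace (subtopology (disk k) (open_disk k)))"
    using homeomorphic homeomorphic_imp_injective_map by blast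
  then show ?thesis by (simp add: open_disk_eq Int_absorb1)
qed

lemma image_disk: "topspace Y = B \<union> \<kappa> ` topspace (disk k)"
proof -
  have "\<kappa> ` topspace (disk k) \<subseteq> topspace Y"
    using continuous continuous_map_image_subset_topspace by blast
  with open_cell B_subset show ?thesis
    by (auto simp: open_disk_eq)
qed

text \<open>The radial homotopy carried over to Y. It fits together with the identity on B because
  \<open>inflate\<close> fixes the boundary sphere, so that \<open>push_char\<close> holds on the
  whole closed disk.\<close>

definition push :: "real \<Rightarrow> 'a \<Rightarrow> 'a" where
  "push t y = (if y \<in> B then y else \<kappa> (inflate k t (inv_into (open_disk k) \<kappa> y)))"

lemma push_char:
  assumes "0 \<le> t" "x \<in> topspace (disk k)" shows "push t (\<kappa> x) = \<kappa> (inflate k t x)"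
proof (cases "x \<in> disk_boundary k")
  case True
  then have "\<kappa> x \<in> B" using boundary by blast
  then show ?thesis using True assms by (simp add: push_def inflate_boundary)
next
  case False
  then have x: "x \<in> open_disk k" using assms by (simp add: open_disk_eq)
  then have "\<kappa> x \<notin> B" using open_cell by blast
  then show ?thesis using x inj by (simp add: push_def)
qed

lemma push_B: "y \<in> B \<Longrightarrow> push t y = y"
  by (simp add: push_def)

lemma push_0: "y \<in> topspace Y \<Longrightarrow> push 0 y = y"
  unfolding image_disk by (auto simp: push_B push_char inflate_0)

abbreviation "I \<equiv> top_of_set {0..1::real}"

text \<open>The closed disk is compact and Y is Hausdorff, so the characteristic map times the
  interval is a closed map. The preimage of a closed set under the homotopy is therefore the union
  of a closed part over B and the closed image of a preimage over the disk.\<close>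

lemma continuous_map_push: "continuous_map (prod_topology I Y) Y (\<lambda>(t, y). push t y)"
  unfolding continuous_map_closedin
proof (intro conjI allI impI funcsetI ballI)
  fix z assume "z \<in> topspace (prod_topology I Y)"
  then obtain t y where z: "z = (t, y)" "t \<in> {0..1}" "y \<in> topspace Y" by auto
  then show "(case z of (t, y) \<Rightarrow> push t y) \<in> topspace Y"
    using inflate_in_disk[of t _ k] unfolding image_disk by (auto simp: push_B push_char)
next
  fix K assume K: "closedin Y K"
  let ?P = "{z \<in> topspace (prod_topology I Y). (case z of (t, y) \<Rightarrow> push t y) \<in> K}"
  let ?Q = "{z \<in> topspace (prod_topology I (disk k)). (\<kappa> \<circ> (\<lambda>(t, x). inflate k t x)) z \<in> K}"
  have 1: "closedin (prod_topology I Y) ({0..1} \<times> (B \<inter> K))"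
    using closed_B K by (auto simp: closedin_prod_Times_iff)
  have "closedin (prod_topology I (disk k)) ?Q"
    by (rule closedin_continuous_map_preimage[OF continuous_map_compose[OF continuous_map_inflate continuous] K])
  moreover have "closed_map (prod_topology I (disk k)) (prod_topology I Y) (\<lambda>(t, x). (t, \<kappa> x))"
  proof (rule continuous_imp_closed_map)
    show "compact_space (prod_topology I (disk k))"
      using compact_space_disk by (auto simp: compact_space_prod_topology compact_space_subtopology)
    show "Hausdorff_space (prod_topology I Y)"
      using Hausdorff by (auto simp: Hausdorff_space_prod_topology Hausdorff_space_subtopology)
    show "continuous_map (prod_topology I (disk k)) (prod_topology I Y) (\<lambda>(t, x). (t, \<kappa> x))"
      using continuous continuous_map_compose[OF continuous_map_snd continuous, of I]
      by (auto simp: continuous_map_pairwise o_def case_prod_unfold continuous_map_fst)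
  qed
  ultimately have 2: "closedin (prod_topology I Y) ((\<lambda>(t, x). (t, \<kappa> x)) ` ?Q)"
    by (simp add: closed_map_def)
  have eq: "?P = {0..1} \<times> (B \<inter> K) \<union> (\<lambda>(t, x). (t, \<kappa> x)) ` ?Q" (is "_ = ?R")
  proof (rule Set.set_eqI)
    fix z :: "real \<times> 'a"
    obtain t y where z: "z = (t, y)" by fastforce
    have "(\<exists>x\<in>topspace (disk k). y = \<kappa> x \<and> \<kappa> (inflate k t x) \<in> K) \<longleftrightarrow> y \<in> \<kappa> ` topspace (disk k) \<and> push t y \<in> K" if "0 \<le> t"
      using push_char[OF that] by (auto simp: image_iff)
    moreover have "y \<in> topspace Y \<and> push t y \<in> K \<longleftrightarrow> y \<in> B \<inter> K \<or> y \<in> \<kappa> ` topspace (disk k) \<and> push t y \<in> K"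
      unfolding image_disk using push_B[of y t] by auto
    moreover have "z \<in> ?P \<longleftrightarrow> t \<in> {0..1} \<and> y \<in> topspace Y \<and> push t y \<in> K"
      by (simp add: z)
    moreover have "z \<in> ?R \<longleftrightarrow> t \<in> {0..1} \<and> (y \<in> B \<inter> K \<or> (\<exists>x\<in>topspace (disk k). y = \<kappa> x \<and> \<kappa> (inflate k t x) \<in> K))"
      unfolding z by (fastforce simp: image_iff)
    ultimately show "z \<in> ?P \<longleftrightarrow> z \<in> ?R"
      by (cases "t \<in> {0..1}") (simp_all only: atLeastAtMost_iff simp_thms)
  qed
  show "closedin (prod_topology I Y) ?P" unfolding eq by (rule closedin_Un[OF 1 2])
qed

definition "T = B \<union> \<kappa> ` collar k"

lemma T_subset: "T \<subseteq> topspace Y"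
  unfolding T_def image_disk collar_def by auto

lemma push_T: "0 \<le> t \<Longrightarrow> t \<le> 1 \<Longrightarrow> y \<in> T \<Longrightarrow> push t y \<in> T"
  unfolding T_def using inflate_collar by (auto simp: push_B push_char collar_def)

lemma push_1_T: "y \<in> T \<Longrightarrow> push 1 y \<in> B"
  unfolding T_def using boundary inflate_1_boundary by (auto simp: push_B push_char collar_def)

lemma homotopic_push:
  assumes "S \<subseteq> topspace Y" "\<And>t. 0 \<le> t \<Longrightarrow> t \<le> 1 \<Longrightarrow> push t \<in> S \<rightarrow> S"
  shows "homotopic_with (\<lambda>h. h \<in> S \<rightarrow> S) Y Y (push 1) id"
proof (rule homotopic_with_symD)
  show "homotopic_with (\<lambda>h. h \<in> S \<rightarrow> S) Y Y id (push 1)"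
  proof (subst homotopic_with)
    show "h \<in> S \<rightarrow> S \<longleftrightarrow> g \<in> S \<rightarrow> S" if "\<And>x. x \<in> topspace Y \<Longrightarrow> h x = g x" for h g :: "'a \<Rightarrow> 'a"
      using that assms(1) by (auto simp: Pi_iff subset_iff)
    show "\<exists>h. continuous_map (prod_topology I Y) Y h \<and> (\<forall>x\<in>topspace Y. h (0, x) = id x) \<and>
       (\<forall>x\<in>topspace Y. h (1, x) = push 1 x) \<and> (\<forall>t\<in>{0..1}. (\<lambda>x. h (t, x)) \<in> S \<rightarrow> S)"
      using continuous_map_push push_0 assms(2) by (intro exI[of _ "\<lambda>(t, y). push t y"]) auto
  qed
qed

lemma continuous_push_1: "continuous_map Y Y (push 1)"
proof -
  have "continuous_map Y (prod_topology I Y) (\<lambda>y. (1, y))"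
    by (simp add: continuous_map_pairwise o_def)
  from continuous_map_compose[OF this continuous_map_push] show ?thesis by (simp add: o_def)
qed

text \<open>\<open>push 1\<close> is a homotopy inverse of the inclusion of pairs: it maps T into B,
  and the homotopy to the identity preserves both B and T.\<close>

lemma iso_thicken:
  "hom_induced p Y B Y T id \<in> iso (relative_homology_group p Y B) (relative_homology_group p Y T)"
proof (rule homotopy_equivalence_relative_homology_group_isomorphism[where g = "push 1"])
  show "homotopic_with (\<lambda>h. h \<in> B \<rightarrow> B) Y Y (push 1 \<circ> id) id"
    using homotopic_push[OF B_subset] by (auto simp: push_B)
  show "homotopic_with (\<lambda>h. h \<in> T \<rightarrow> T) Y Y (id \<circ> push 1) id"
    using homotopic_push[OF T_subset] push_T by auto
qed (auto simp: continuous_push_1 push_1_T T_def)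

lemma iso_excise:
  "hom_induced p (subtopology Y (topspace Y - B)) (T - B) Y T id \<in>
     iso (relative_homology_group p (subtopology Y (topspace Y - B)) (T - B)) (relative_homology_group p Y T)"
proof -
  \<comment> \<open>The closed half disk. Its image is closed, and the complement of this image is
    an open set between B and T, which puts the closure of B into the interior of T as excision
    demands.\<close>
  let ?N = "{x \<in> topspace (disk k). radius k x \<in> {0..1/2}}"
  have "closedin (disk k) ?N"
    by (rule closedin_continuous_map_preimage[OF continuous_map_radius]) simp
  then have "closedin Y (\<kappa> ` ?N)"
    using continuous_imp_closed_map[OF continuous compact_space_disk Hausdorff] by (simp add: closed_map_def)
  then have op: "openin Y (topspace Y - \<kappa> ` ?N)" by blast
  have "B \<subseteq> topspace Y - \<kappa> ` ?N"
  proof -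
    have "?N \<subseteq> open_disk k" by (auto simp: in_open_disk_iff in_disk_iff)
    with open_cell B_subset show ?thesis by blast
  qed
  moreover have "topspace Y - \<kappa> ` ?N \<subseteq> T"
    unfolding T_def image_disk collar_def by (auto simp: image_iff) (metis linorder_not_le nle_le)
  ultimately have "B \<subseteq> Y interior_of T"
    using op by (meson interior_of_maximal order_trans)
  then have "Y closure_of B \<subseteq> Y interior_of T"
    using closed_B by (simp add: closure_of_closedin)
  from homology_excision_axiom[OF this T_subset, of p] show ?thesis by simp
qed

end

text \<open>The disk is its boundary with one cell attached by the identity, so thickening and
  excision apply to the source pair of \<open>iso_char\<close> as well.\<close>

lemma attached_cell_disk: "attached_cell (disk k) (disk_boundary k) k id"
  by unfold_locales (auto simp: Hausdorff_space_disk closedin_disk_boundary open_disk_eq)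

text \<open>This and the next lemma are the two-out-of-three property of isomorphisms, for chasing
  the squares of thickening and excision.\<close>

lemma iso_left_factor:
  assumes "f \<in> hom G H" "g \<in> iso H K" "(\<lambda>x. g (f x)) \<in> iso G K"
  shows "f \<in> iso G H"
proof -
  have "inj_on f (carrier G)"
    using assms(3) unfolding iso_def bij_betw_def by (auto simp: inj_on_def)
  moreover have "f ` carrier G = carrier H"
  proof
    show "f ` carrier G \<subseteq> carrier H" using assms(1) by (auto simp: hom_def)
    show "carrier H \<subseteq> f ` carrier G"
    proof
      fix y assume y: "y \<in> carrier H"
      then have "g y \<in> carrier K" using assms(2) by (auto simp: iso_def bij_betw_def)
      then have "g y \<in> (\<lambda>x. g (f x)) ` carrier G" using assms(3) by (simp add: iso_def bij_betw_def)
      then obtain x where x: "x \<in> carrier G" "g (f x) = g y" by auto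
      with assms y have "f x = y" by (auto simp: iso_def bij_betw_def inj_on_def hom_def Pi_iff)
      with x show "y \<in> f ` carrier G" by auto
    qed
  qed
  ultimately show ?thesis using assms(1) by (auto simp: iso_def bij_betw_def)
qed

lemma iso_right_factor:
  assumes "f \<in> iso G H" "(\<lambda>x. g (f x)) \<in> iso G K" "g \<in> hom H K"
  shows "g \<in> iso H K"
proof -
  have fs: "f ` carrier G = carrier H" using assms(1) by (auto simp: iso_def bij_betw_def)
  have "inj_on g (carrier H)"
    using assms(2) unfolding iso_def bij_betw_def fs[symmetric] by (auto simp: inj_on_def)
  moreover have "g ` carrier H = carrier K"
    using assms(2) unfolding iso_def bij_betw_def fs[symmetric] by (auto simp: image_image)
  ultimately show ?thesis using assms(3) by (auto simp: iso_def bij_betw_def)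
qed

context attached_cell
begin

text \<open>In both pairs the boundary is thickened to a collar, along which the homotopy pushes back, and
  is then excised. What remains is homeomorphic by the characteristic map.\<close>

theorem iso_char:
  "hom_induced p (disk k) (disk_boundary k) Y B \<kappa> \<in>
     iso (relative_homology_group p (disk k) (disk_boundary k)) (relative_homology_group p Y B)"
proof -
  interpret D: attached_cell "disk k" "disk_boundary k" k id by (rule attached_cell_disk)
  let ?D = "disk k" and ?S = "disk_boundary k"
  let ?D' = "subtopology ?D (topspace ?D - ?S)" and ?Y' = "subtopology Y (topspace Y - B)"
  have DT: "D.T = collar k"
    by (auto simp: D.T_def collar_def in_disk_boundary_iff in_disk_iff)
  have cT: "\<kappa> ` collar k \<subseteq> T" by (auto simp: T_def)
  have T': "\<kappa> ` (D.T - ?S) = T - B"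
  proof -
    have "collar k - ?S \<subseteq> open_disk k" by (auto simp: open_disk_eq collar_def)
    moreover have "\<kappa> ` (collar k \<inter> ?S) \<subseteq> B" using boundary by auto
    ultimately show ?thesis unfolding DT T_def using open_cell by blast
  qed
  have hom': "hom_induced p ?D' (D.T - ?S) ?Y' (T - B) \<kappa> \<in>
      iso (relative_homology_group p ?D' (D.T - ?S)) (relative_homology_group p ?Y' (T - B))"
  proof (rule homeomorphic_map_relative_homology_iso)
    show "homeomorphic_map ?D' ?Y' \<kappa>" using homeomorphic by (simp add: open_disk_eq)
    show "D.T - ?S \<subseteq> topspace ?D'" using D.T_subset by auto
  qed (rule T')
  have c': "continuous_map ?D' ?Y' \<kappa>"
    using homeomorphic by (simp add: open_disk_eq homeomorphic_imp_continuous_map)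
  have mid: "hom_induced p ?D D.T Y T \<kappa> \<in> iso (relative_homology_group p ?D D.T) (relative_homology_group p Y T)"
  proof (rule iso_right_factor[OF D.iso_excise])
    have "(\<lambda>x. hom_induced p ?D D.T Y T \<kappa> (hom_induced p ?D' (D.T - ?S) ?D D.T id x))
        = (\<lambda>x. hom_induced p ?Y' (T - B) Y T id (hom_induced p ?D' (D.T - ?S) ?Y' (T - B) \<kappa> x))"
      using continuous c' cT T'
      by (subst (1 2) hom_induced_compose') (auto simp: DT intro: continuous_map_from_subtopology)
    also have "\<dots> \<in> iso (relative_homology_group p ?D' (D.T - ?S)) (relative_homology_group p Y T)"
      using iso_set_trans[OF hom' iso_excise] by (simp add: o_def)
    finally show "(\<lambda>x. hom_induced p ?D D.T Y T \<kappa> (hom_induced p ?D' (D.T - ?S) ?D D.T id x))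
      \<in> iso (relative_homology_group p ?D' (D.T - ?S)) (relative_homology_group p Y T)" .
  qed (rule hom_induced_hom)
  show ?thesis
  proof (rule iso_left_factor[OF hom_induced_hom iso_thicken])
    have "(\<lambda>x. hom_induced p Y B Y T id (hom_induced p ?D ?S Y B \<kappa> x))
        = (\<lambda>x. hom_induced p ?D D.T Y T \<kappa> (hom_induced p ?D ?S ?D D.T id x))"
      using continuous boundary cT
      by (subst (1 2) hom_induced_compose') (auto simp: DT T_def collar_def in_disk_boundary_iff in_disk_iff)
    also have "\<dots> \<in> iso (relative_homology_group p ?D ?S) (relative_homology_group p Y T)"
      using iso_set_trans[OF D.iso_thicken mid] by (simp add: o_def)
    finally show "(\<lambda>x. hom_induced p Y B Y T id (hom_induced p ?D ?S Y B \<kappa> x))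
      \<in> iso (relative_homology_group p ?D ?S) (relative_homology_group p Y T)" .
  qed
qed

end

section \<open>Homology of consecutive skeleta\<close>

lemma contractible_space_disk: "contractible_space (disk k)"
  unfolding contractible_space_def
proof (intro exI[of _ "\<lambda>_. 0"])
  let ?h = "\<lambda>z::real \<times> (nat \<Rightarrow> real). \<lambda>i. (1 - fst z) * snd z i"
  have in_disk: "?h (t, x) \<in> topspace (disk k)" if "t \<in> {0..1}" "x \<in> topspace (disk k)" for t x
  proof -
    have "radius k (?h (t, x)) = (1 - t) * radius k x" using that by (simp add: radius_scale)
    also have "\<dots> \<le> 1" using that by (intro mult_le_one) (auto simp: in_disk_iff)
    finally show ?thesis using that by (auto simp: in_disk_iff)
  qed
  have "continuous_on ({0..1} \<times> topspace (disk k)) ?h"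
  proof (rule continuous_on_coordinatewise_then_product)
    fix i
    have "continuous_on ({0..1::real} \<times> topspace (disk k)) (\<lambda>z. snd z i)"
      by (rule continuous_on_product_then_coordinatewise) (rule continuous_on_snd[OF continuous_on_id])
    moreover have "continuous_on ({0..1::real} \<times> topspace (disk k)) (\<lambda>z. 1 - fst z)"
      by (intro continuous_intros)
    ultimately show "continuous_on ({0..1} \<times> topspace (disk k)) (\<lambda>z. ?h z i)"
      by (rule continuous_on_mult[rotated])
  qed
  moreover have "prod_topology (top_of_set {0..1}) (disk k) = top_of_set ({0..1::real} \<times> topspace (disk k))"
    unfolding topspace_disk by (simp only: disk_eq subtopology_Times flip: prod_topology_euclidean)
  ultimately have "continuous_map (prod_topology (top_of_set {0..1}) (disk k)) euclidean ?h"
    by simp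
  then have "continuous_map (prod_topology (top_of_set {0..1}) (disk k)) (disk k) ?h"
    unfolding disk_eq[of k] continuous_map_in_subtopology
    using in_disk unfolding topspace_disk by auto
  then show "homotopic_with (\<lambda>x. True) (disk k) (disk k) id (\<lambda>x. \<lambda>_. 0)"
    by (subst homotopic_with) (auto intro!: exI[of _ ?h])
qed

text \<open>For positive k the disk is contractible, so the group is the reduced homology of the
  sphere one dimension lower. For k = 0 the sphere is empty, and the group is the homology of a
  point.\<close>

lemma disk_homology_integer:
  "relative_homology_group (int k) (disk k) (disk_boundary k) \<cong> integer_group"
proof (cases k)
  case 0
  have "topspace (disk 0) = {\<lambda>_. 0}" by (auto simp: topspace_disk)
  moreover have "disk_boundary 0 = {}" by (auto simp: in_disk_boundary_iff radius_def)
  ultimately show ?thesis unfolding 0 by (simp add: homology_coefficients)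
next
  case (Suc n)
  have eq: "{x. (\<Sum>i<k. (x i)\<^sup>2) \<le> 1} \<inter> disk_boundary k = topspace (Euclidean_space k) \<inter> {x. (\<Sum>i<k. (x i)\<^sup>2) = 1}"
    by (auto simp: in_disk_boundary_iff topspace_Euclidean_space radius_def)
  have sub: "subtopology (disk k) (disk_boundary k) = nsphere n"
    unfolding disk_def subtopology_subtopology eq subtopology_restrict
    by (simp add: Suc nsphere_def lessThan_Suc_atMost)
  then have "topspace (disk k) \<inter> disk_boundary k \<noteq> {}"
    using nonempty_nsphere[of n] by (metis null_topspace_iff_trivial topspace_subtopology)
  with contractible_space_disk have "relative_homology_group (int k) (disk k) (disk_boundary k) \<cong>
      reduced_homology_group (int k - 1) (subtopology (disk k) (disk_boundary k))"
    by (rule isomorphic_group_relative_homology_of_contractible)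
  also have "int k - 1 = int n" using Suc by simp
  also note sub
  also note reduced_homology_group_nsphere(1)
  finally show ?thesis .
qed

text \<open>The isomorphism with the integers enters through the infinite carrier: a generator of an
  infinite cyclic group has order 0 in the convention of \<open>ord\<close>, so none of its nonzero
  powers is trivial.\<close>

lemma disk_homology_generator_power:
  assumes g: "g \<in> carrier (relative_homology_group (int k) (disk k) (disk_boundary k))"
    and gen: "generate (relative_homology_group (int k) (disk k) (disk_boundary k)) {g}
       = carrier (relative_homology_group (int k) (disk k) (disk_boundary k))"
  shows "\<And>c. c \<in> carrier (relative_homology_group (int k) (disk k) (disk_boundary k)) \<Longrightarrow>
        \<exists>n::int. c = g [^]\<^bsub>relative_homology_group (int k) (disk k) (disk_boundary k)\<^esub> n"
    and "\<And>n::int. g [^]\<^bsub>relative_homology_group (int k) (disk k) (disk_boundary k)\<^esub> n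
          = \<one>\<^bsub>relative_homology_group (int k) (disk k) (disk_boundary k)\<^esub> \<Longrightarrow> n = 0"
proof -
  let ?G = "relative_homology_group (int k) (disk k) (disk_boundary k)"
  interpret group ?G by simp
  show "\<exists>n::int. c = g [^]\<^bsub>?G\<^esub> n" if "c \<in> carrier ?G" for c
    using that generate_pow[OF g] gen by auto
  have "infinite (carrier ?G)"
    using iso_finite[OF disk_homology_integer[of k]] by (simp add: infinite_UNIV_int)
  then have "infinite (carrier (subgroup_generated ?G {g}))"
    using gen g by (simp add: carrier_subgroup_generated)
  then have "ord g = 0" using infinite_cyclic_subgroup_order g by blast
  then show "n = 0" if "g [^]\<^bsub>?G\<^esub> n = \<one>\<^bsub>?G\<^esub>" for n :: int
    using int_pow_eq_id[OF g] that by simp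
qed

lemma hom_finprod_pow:
  assumes "comm_group G" "comm_group H" "h \<in> hom G H" "f \<in> I \<rightarrow> carrier G"
  shows "h (finprod G (\<lambda>i. f i [^]\<^bsub>G\<^esub> (a i :: int)) I) = finprod H (\<lambda>i. h (f i) [^]\<^bsub>H\<^esub> a i) I"
proof -
  interpret G: comm_group G by fact
  interpret H: comm_group H by fact
  have hc: "h x \<in> carrier H" if "x \<in> carrier G" for x using assms(3) that by (auto simp: hom_def)
  show ?thesis
    using assms(4)
  proof (induction I rule: infinite_finite_induct)
    case (insert i I)
    then have f: "f i \<in> carrier G" "\<And>j. j \<in> I \<Longrightarrow> f j \<in> carrier G" by auto
    have cl: "finprod G (\<lambda>i. f i [^]\<^bsub>G\<^esub> a i) I \<in> carrier G"
      using f by (intro G.finprod_closed) auto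
    have "h (finprod G (\<lambda>i. f i [^]\<^bsub>G\<^esub> a i) (insert i I))
        = h (f i [^]\<^bsub>G\<^esub> a i \<otimes>\<^bsub>G\<^esub> finprod G (\<lambda>i. f i [^]\<^bsub>G\<^esub> a i) I)"
      using insert.hyps f by (subst G.finprod_insert) auto
    also have "\<dots> = h (f i) [^]\<^bsub>H\<^esub> a i \<otimes>\<^bsub>H\<^esub> finprod H (\<lambda>i. h (f i) [^]\<^bsub>H\<^esub> a i) I"
      using assms(3) f cl insert
      by (simp add: hom_mult hom_int_pow[OF assms(3)] G.is_group H.is_group)
    also have "\<dots> = finprod H (\<lambda>i. h (f i) [^]\<^bsub>H\<^esub> a i) (insert i I)"
      using insert.hyps f hc by (subst H.finprod_insert) auto
    finally show ?case .
  qed (use hom_one[OF assms(3)] in \<open>auto simp: G.is_group H.is_group\<close>)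
qed

section \<open>Skeleta of a finite CW complex\<close>

locale CW_complex =
  fixes \<Sigma> :: "('a, 'c) oriented_CW"
  assumes CW: "finite_CW \<Sigma>"
begin

abbreviation "X \<equiv> total_space \<Sigma>"

lemma finite_cells: "finite (cells \<Sigma> i)"
proof -
  have "finite (SIGMA i:UNIV. cells \<Sigma> i)" using CW by (simp add: finite_CW_def)
  moreover have "cells \<Sigma> i = snd ` ((SIGMA i:UNIV. cells \<Sigma> i) \<inter> {i} \<times> UNIV)" by force
  ultimately show ?thesis by (metis finite_Int finite_imageI)
qed

lemma Hausdorff: "Hausdorff_space X"
  using CW by (simp add: finite_CW_def)

lemma char_continuous: "0 \<le> i \<Longrightarrow> \<sigma> \<in> cells \<Sigma> i \<Longrightarrow> continuous_map (disk (nat i)) X (char_map \<Sigma> i \<sigma>)"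
  using CW by (simp add: finite_CW_def)

lemma char_embedding: "0 \<le> i \<Longrightarrow> \<sigma> \<in> cells \<Sigma> i \<Longrightarrow>
    embedding_map (subtopology (disk (nat i)) (open_disk (nat i))) X (char_map \<Sigma> i \<sigma>)"
  using CW by (simp add: finite_CW_def)

lemma char_boundary: "0 \<le> i \<Longrightarrow> \<sigma> \<in> cells \<Sigma> i \<Longrightarrow>
    char_map \<Sigma> i \<sigma> ` disk_boundary (nat i) \<subseteq> skeleton \<Sigma> (i - 1)"
  using CW by (simp add: finite_CW_def)

lemma orientation_in: "0 \<le> i \<Longrightarrow> \<sigma> \<in> cells \<Sigma> i \<Longrightarrow> orientation \<Sigma> i \<sigma> \<in> carrier (disk_homology i)"
  and orientation_generates: "0 \<le> i \<Longrightarrow> \<sigma> \<in> cells \<Sigma> i \<Longrightarrow>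
    generate (disk_homology i) {orientation \<Sigma> i \<sigma>} = carrier (disk_homology i)"
  using CW by (simp_all add: finite_CW_def)

lemma orientation_spans:
  assumes "0 \<le> i" "\<sigma> \<in> cells \<Sigma> i" "c \<in> carrier (disk_homology i)"
  shows "\<exists>n::int. c = orientation \<Sigma> i \<sigma> [^]\<^bsub>disk_homology i\<^esub> n"
  using disk_homology_generator_power(1)[of "orientation \<Sigma> i \<sigma>" "nat i" c]
    orientation_in[of i \<sigma>] orientation_generates[of i \<sigma>] assms by simp

lemma orientation_free:
  assumes "0 \<le> i" "\<sigma> \<in> cells \<Sigma> i"
    "orientation \<Sigma> i \<sigma> [^]\<^bsub>disk_homology i\<^esub> (n::int) = \<one>\<^bsub>disk_homology i\<^esub>"
  shows "n = 0"
  using disk_homology_generator_power(2)[of "orientation \<Sigma> i \<sigma>" "nat i" n]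
    orientation_in[of i \<sigma>] orientation_generates[of i \<sigma>] assms by simp

lemma disjoint_open_cells:
  assumes "0 \<le> i" "0 \<le> j" "\<sigma> \<in> cells \<Sigma> i" "\<tau> \<in> cells \<Sigma> j" "(i, \<sigma>) \<noteq> (j, \<tau>)"
  shows "open_cell \<Sigma> i \<sigma> \<inter> open_cell \<Sigma> j \<tau> = {}"
proof -
  have "disjoint_family_on (\<lambda>(i, \<sigma>). open_cell \<Sigma> i \<sigma>) (SIGMA i:{0..}. cells \<Sigma> i)"
    using CW by (simp add: finite_CW_def)
  from disjoint_family_onD[OF this, of "(i, \<sigma>)" "(j, \<tau>)"] assms show ?thesis by auto
qed

text \<open>Interpolates between consecutive skeleta, so that the cells of dimension i can be
  attached one at a time.\<close>

definition partial_skeleton :: "int \<Rightarrow> 'c set \<Rightarrow> 'a set" where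
  "partial_skeleton i W = skeleton \<Sigma> (i - 1) \<union> (\<Union>\<sigma>\<in>W. open_cell \<Sigma> i \<sigma>)"

lemma partial_skeleton_empty [simp]: "partial_skeleton i {} = skeleton \<Sigma> (i - 1)"
  by (simp add: partial_skeleton_def)

lemma partial_skeleton_cells: "0 \<le> i \<Longrightarrow> partial_skeleton i (cells \<Sigma> i) = skeleton \<Sigma> i"
proof -
  assume "0 \<le> i"
  then have "{0..i} = insert i {0..i - 1}" by auto
  then show ?thesis by (auto simp: partial_skeleton_def skeleton_def)
qed

lemma partial_skeleton_mono: "V \<subseteq> W \<Longrightarrow> partial_skeleton i V \<subseteq> partial_skeleton i W"
  by (auto simp: partial_skeleton_def)

lemma skeleton_subset_partial: "skeleton \<Sigma> (i - 1) \<subseteq> partial_skeleton i W"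
  by (auto simp: partial_skeleton_def)

text \<open>The boundary of a cell lies in the lower skeleton, so adding open or closed cells makes
  no difference; closed cells are compact, which yields closedness.\<close>

lemma partial_skeleton_closed_cells:
  assumes "0 \<le> i" "W \<subseteq> cells \<Sigma> i"
  shows "partial_skeleton i W = skeleton \<Sigma> (i - 1) \<union> (\<Union>\<sigma>\<in>W. char_map \<Sigma> i \<sigma> ` topspace (disk (nat i)))"
proof -
  have "char_map \<Sigma> i \<sigma> ` topspace (disk (nat i)) = open_cell \<Sigma> i \<sigma> \<union> char_map \<Sigma> i \<sigma> ` disk_boundary (nat i)"
    for \<sigma>
    using disk_boundary_subset unfolding open_cell_def open_disk_eq by blast
  moreover have "char_map \<Sigma> i \<sigma> ` disk_boundary (nat i) \<subseteq> skeleton \<Sigma> (i - 1)" if "\<sigma> \<in> W" for \<sigma>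
    using char_boundary assms that by blast
  ultimately show ?thesis unfolding partial_skeleton_def by (simp add: UN_Un_distrib) fast
qed

lemma closedin_partial_skeleton:
  assumes "0 \<le> i" "W \<subseteq> cells \<Sigma> i" "closedin X (skeleton \<Sigma> (i - 1))"
  shows "closedin X (partial_skeleton i W)"
proof -
  have "closedin X (char_map \<Sigma> i \<sigma> ` topspace (disk (nat i)))" if "\<sigma> \<in> W" for \<sigma>
    using continuous_imp_closed_map[OF char_continuous compact_space_disk Hausdorff, of i \<sigma>] that assms
    by (auto simp: closed_map_def)
  moreover have "finite W" using assms finite_cells finite_subset by blast
  ultimately show ?thesis
    unfolding partial_skeleton_closed_cells[OF assms(1,2)]
    by (intro closedin_Un assms closedin_Union) auto
qed

lemma closedin_skeleton: "closedin X (skeleton \<Sigma> i)"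
proof (cases "i \<ge> -1")
  case True
  then show ?thesis
  proof (induction i rule: int_ge_induct)
    case (step i)
    then show ?case
      using closedin_partial_skeleton[of "i + 1" "cells \<Sigma> (i + 1)"] partial_skeleton_cells[of "i + 1"] by simp
  qed (simp add: skeleton_def)
qed (simp add: skeleton_def)

abbreviation partial_space :: "int \<Rightarrow> 'c set \<Rightarrow> 'a topology" where
  "partial_space i W \<equiv> subtopology X (partial_skeleton i W)"

lemma topspace_partial_space:
  "0 \<le> i \<Longrightarrow> W \<subseteq> cells \<Sigma> i \<Longrightarrow> topspace (partial_space i W) = partial_skeleton i W"
  using closedin_subset[OF closedin_partial_skeleton[OF _ _ closedin_skeleton]] by auto

lemma open_cell_disjoint_partial:
  assumes "0 \<le> i" "W \<subseteq> cells \<Sigma> i" "\<sigma> \<in> cells \<Sigma> i" "\<sigma> \<notin> W"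
  shows "open_cell \<Sigma> i \<sigma> \<inter> partial_skeleton i W = {}"
proof -
  have "open_cell \<Sigma> i \<sigma> \<inter> open_cell \<Sigma> j \<tau> = {}" if "j \<in> {0..i - 1}" "\<tau> \<in> cells \<Sigma> j" for j \<tau>
    using that assms by (intro disjoint_open_cells) auto
  moreover have "open_cell \<Sigma> i \<sigma> \<inter> open_cell \<Sigma> i \<tau> = {}" if "\<tau> \<in> W" for \<tau>
    using that assms by (intro disjoint_open_cells) auto
  ultimately show ?thesis unfolding partial_skeleton_def skeleton_def by blast
qed

lemma char_continuous_partial:
  assumes "0 \<le> i" "W \<subseteq> cells \<Sigma> i" "\<sigma> \<in> W"
  shows "continuous_map (disk (nat i)) (partial_space i W) (char_map \<Sigma> i \<sigma>)"
  using char_continuous[of i \<sigma>] assms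
  by (auto simp: continuous_map_in_subtopology partial_skeleton_closed_cells)

text \<open>Disjointness of open cells makes the complement of the smaller stage exactly the new
  open cell, on which the characteristic map is an embedding.\<close>

lemma attached_cell_partial:
  assumes i: "0 \<le> i" and W: "insert \<sigma> W \<subseteq> cells \<Sigma> i" "\<sigma> \<notin> W"
  shows "attached_cell (partial_space i (insert \<sigma> W)) (partial_skeleton i W) (nat i) (char_map \<Sigma> i \<sigma>)"
proof
  show "Hausdorff_space (partial_space i (insert \<sigma> W))"
    by (intro Hausdorff_space_subtopology Hausdorff)
  show "closedin (partial_space i (insert \<sigma> W)) (partial_skeleton i W)"
    using assms by (intro closedin_subset_topspace closedin_partial_skeleton closedin_skeleton partial_skeleton_mono) auto
  show "continuous_map (disk (nat i)) (partial_space i (insert \<sigma> W)) (char_map \<Sigma> i \<sigma>)"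
    using assms by (intro char_continuous_partial) auto
  show "char_map \<Sigma> i \<sigma> ` disk_boundary (nat i) \<subseteq> partial_skeleton i W"
    using char_boundary[OF i, of \<sigma>] W skeleton_subset_partial by blast
  have "homeomorphic_map (subtopology (disk (nat i)) (open_disk (nat i)))
      (subtopology X (char_map \<Sigma> i \<sigma> ` topspace (subtopology (disk (nat i)) (open_disk (nat i))))) (char_map \<Sigma> i \<sigma>)"
    using char_embedding[OF i, of \<sigma>] W by (simp add: embedding_map_def)
  moreover have "char_map \<Sigma> i \<sigma> ` topspace (subtopology (disk (nat i)) (open_disk (nat i))) = open_cell \<Sigma> i \<sigma>"
    by (simp add: open_cell_def open_disk_eq Int_absorb1)
  moreover have "topspace (partial_space i (insert \<sigma> W)) - partial_skeleton i W = open_cell \<Sigma> i \<sigma>"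
    using open_cell_disjoint_partial[OF i _ _ W(2)] W
    by (subst topspace_partial_space[OF i]) (auto simp: partial_skeleton_def)
  moreover have "subtopology (partial_space i (insert \<sigma> W)) (open_cell \<Sigma> i \<sigma>) = subtopology X (open_cell \<Sigma> i \<sigma>)"
    unfolding subtopology_subtopology
    by (rule arg_cong[where f = "subtopology X"]) (auto simp: partial_skeleton_def)
  ultimately show "homeomorphic_map (subtopology (disk (nat i)) (open_disk (nat i)))
      (subtopology (partial_space i (insert \<sigma> W)) (topspace (partial_space i (insert \<sigma> W)) - partial_skeleton i W))
      (char_map \<Sigma> i \<sigma>)" by simp
qed

section \<open>Cell classes as a basis of relative homology\<close>

abbreviation partial_homology :: "int \<Rightarrow> 'c set \<Rightarrow> 'a chain set monoid" where
  "partial_homology i W \<equiv> relative_homology_group i (partial_space i W) (skeleton \<Sigma> (i - 1))"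

definition partial_class :: "int \<Rightarrow> 'c set \<Rightarrow> 'c \<Rightarrow> 'a chain set" where
  "partial_class i W \<sigma> =
     hom_induced i (disk (nat i)) (disk_boundary (nat i)) (partial_space i W) (skeleton \<Sigma> (i - 1))
       (char_map \<Sigma> i \<sigma>) (orientation \<Sigma> i \<sigma>)"

lemma partial_class_in: "partial_class i W \<sigma> \<in> carrier (partial_homology i W)"
  by (simp add: partial_class_def hom_induced_carrier)

text \<open>Two choices of S occur: the lower skeleton, when classes move to a larger stage, and the
  complement of one open cell, when they are projected to the part of that cell.\<close>

lemma partial_class_include:
  assumes "0 \<le> i" "W \<subseteq> cells \<Sigma> i" "\<sigma> \<in> V" "V \<subseteq> W" "skeleton \<Sigma> (i - 1) \<subseteq> S"
  shows "hom_induced i (partial_space i V) (skeleton \<Sigma> (i - 1)) (partial_space i W) S id (partial_class i V \<sigma>)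
     = hom_induced i (disk (nat i)) (disk_boundary (nat i)) (partial_space i W) S
         (char_map \<Sigma> i \<sigma>) (orientation \<Sigma> i \<sigma>)"
  unfolding partial_class_def
proof (subst hom_induced_compose')
  show "continuous_map (disk (nat i)) (partial_space i V) (char_map \<Sigma> i \<sigma>)"
    using assms by (intro char_continuous_partial) auto
  show "char_map \<Sigma> i \<sigma> \<in> disk_boundary (nat i) \<rightarrow> skeleton \<Sigma> (i - 1)"
    using char_boundary[of i \<sigma>] assms by auto
  show "continuous_map (partial_space i V) (partial_space i W) id"
    using partial_skeleton_mono[OF \<open>V \<subseteq> W\<close>, of i]
    by (auto simp: continuous_map_in_subtopology intro: continuous_map_from_subtopology)
qed (use assms in auto)

text \<open>Relative to the previous stage, c becomes a power of the class of the new cell by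
  \<open>iso_char\<close>. Dividing that power out leaves an element that dies there, and by
  exactness for the triple it comes from the previous stage.\<close>

lemma partial_classes_span:
  assumes i: "0 \<le> i" and W: "W \<subseteq> cells \<Sigma> i" and c: "c \<in> carrier (partial_homology i W)"
  shows "\<exists>a :: 'c \<Rightarrow> int. c = finprod (partial_homology i W) (\<lambda>\<sigma>. partial_class i W \<sigma> [^]\<^bsub>partial_homology i W\<^esub> a \<sigma>) W"
proof -
  have "finite W" using W finite_cells finite_subset by blast
  then show ?thesis
    using W c
  proof (induction W arbitrary: c)
    case empty
    interpret comm_group "partial_homology i {}" by simp
    have "trivial_group (partial_homology i {})"
      using trivial_relative_homology_group_topspace[of i "partial_space i {}"]
        topspace_partial_space[OF i, of "{}"] by simp
    with empty have "c = \<one>\<^bsub>partial_homology i {}\<^esub>" by (auto simp: trivial_group_def)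
    then show ?case using finprod_empty by blast
  next
    case (insert \<sigma> W)
    let ?Y = "partial_space i (insert \<sigma> W)" and ?B = "partial_skeleton i W" and ?A = "skeleton \<Sigma> (i - 1)"
    let ?G = "partial_homology i (insert \<sigma> W)" and ?H = "relative_homology_group i ?Y ?B"
      and ?G' = "partial_homology i W"
    let ?p = "hom_induced i ?Y ?A ?Y ?B id" and ?q = "hom_induced i (partial_space i W) ?A ?Y ?A id"
    let ?g = "partial_class i (insert \<sigma> W) \<sigma>"
    interpret attached_cell ?Y ?B "nat i" "char_map \<Sigma> i \<sigma>"
      using insert by (intro attached_cell_partial[OF i])
    interpret G: comm_group ?G by simp
    interpret H: comm_group ?H by simp
    interpret G': comm_group ?G' by simp
    have sub: "subtopology ?Y ?B = partial_space i W"
      unfolding subtopology_subtopology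
      by (rule arg_cong[where f = "subtopology X"]) (auto simp: partial_skeleton_def)
    have ex: "exact_seq ([?H, ?G, ?G'], [?p, ?q])"
      using homology_exactness_triple_3[OF skeleton_subset_partial[of i W], of i ?Y] unfolding sub .
    have p: "?p \<in> hom ?G ?H" and q: "?q \<in> hom ?G' ?G" by (rule hom_induced_hom)+
    have surj: "carrier ?H = hom_induced i (disk (nat i)) (disk_boundary (nat i)) ?Y ?B (char_map \<Sigma> i \<sigma>) ` carrier (disk_homology i)"
      using iso_char[of i] i by (simp add: iso_def bij_betw_def)
    have "?p c \<in> carrier ?H" by (rule hom_induced_carrier)
    then obtain e where e: "?p c = hom_induced i (disk (nat i)) (disk_boundary (nat i)) ?Y ?B (char_map \<Sigma> i \<sigma>) e"
      "e \<in> carrier (disk_homology i)"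
      unfolding surj by (rule imageE)
    obtain n :: int where n: "e = orientation \<Sigma> i \<sigma> [^]\<^bsub>disk_homology i\<^esub> n"
      using orientation_spans[OF i _ e(2)] insert.prems by blast
    have pg: "?p ?g = hom_induced i (disk (nat i)) (disk_boundary (nat i)) ?Y ?B (char_map \<Sigma> i \<sigma>) (orientation \<Sigma> i \<sigma>)"
      using insert.prems by (intro partial_class_include i skeleton_subset_partial) auto
    have "?p c = ?p ?g [^]\<^bsub>?H\<^esub> n"
      unfolding e(1) n pg using insert.prems
      by (subst hom_int_pow[OF hom_induced_hom]) (auto simp: orientation_in i)
    then have "?p c = ?p (?g [^]\<^bsub>?G\<^esub> n)"
      using hom_int_pow[OF p partial_class_in] by simp
    moreover have gn: "?g [^]\<^bsub>?G\<^esub> n \<in> carrier ?G" using partial_class_in by simp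
    moreover have "?p (c \<otimes>\<^bsub>?G\<^esub> inv\<^bsub>?G\<^esub> (?g [^]\<^bsub>?G\<^esub> n)) = ?p c \<otimes>\<^bsub>?H\<^esub> inv\<^bsub>?H\<^esub> ?p (?g [^]\<^bsub>?G\<^esub> n)"
    proof -
      interpret p: group_hom ?G ?H ?p by unfold_locales (rule p)
      show ?thesis using insert.prems gn by (simp only: p.hom_mult p.hom_inv G.inv_closed)
    qed
    ultimately have "?p (c \<otimes>\<^bsub>?G\<^esub> inv\<^bsub>?G\<^esub> (?g [^]\<^bsub>?G\<^esub> n)) = \<one>\<^bsub>?H\<^esub>"
      by (simp only: H.r_inv[OF hom_induced_carrier])
    then have "c \<otimes>\<^bsub>?G\<^esub> inv\<^bsub>?G\<^esub> (?g [^]\<^bsub>?G\<^esub> n) \<in> kernel ?G ?H ?p"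
      using insert.prems gn by (simp add: kernel_def)
    then obtain c' where c': "c' \<in> carrier ?G'" "c \<otimes>\<^bsub>?G\<^esub> inv\<^bsub>?G\<^esub> (?g [^]\<^bsub>?G\<^esub> n) = ?q c'"
      using ex by auto
    obtain a :: "'c \<Rightarrow> int" where a: "c' = finprod ?G' (\<lambda>\<sigma>. partial_class i W \<sigma> [^]\<^bsub>?G'\<^esub> a \<sigma>) W"
      using insert.IH[OF _ c'(1)] insert.prems by auto
    have qc: "?q c' = finprod ?G (\<lambda>\<tau>. partial_class i (insert \<sigma> W) \<tau> [^]\<^bsub>?G\<^esub> a \<tau>) W"
    proof -
      have "?q c' = finprod ?G (\<lambda>\<tau>. ?q (partial_class i W \<tau>) [^]\<^bsub>?G\<^esub> a \<tau>) W"
        unfolding a by (intro hom_finprod_pow q) (auto simp: partial_class_in)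
      also have "\<dots> = finprod ?G (\<lambda>\<tau>. partial_class i (insert \<sigma> W) \<tau> [^]\<^bsub>?G\<^esub> a \<tau>) W"
      proof (intro G.finprod_cong' refl)
        fix \<tau> assume "\<tau> \<in> W"
        then have "?q (partial_class i W \<tau>) = partial_class i (insert \<sigma> W) \<tau>"
          using insert.prems partial_class_include[OF i, of "insert \<sigma> W" \<tau> W ?A] by (auto simp: partial_class_def)
        then show "?q (partial_class i W \<tau>) [^]\<^bsub>?G\<^esub> a \<tau> = partial_class i (insert \<sigma> W) \<tau> [^]\<^bsub>?G\<^esub> a \<tau>" by simp
      qed (use partial_class_in in auto)
      finally show ?thesis .
    qed
    have "c = ?g [^]\<^bsub>?G\<^esub> n \<otimes>\<^bsub>?G\<^esub> ?q c'"
      using insert.prems gn unfolding c'(2)[symmetric]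
      by (simp add: G.m_comm[of c] G.m_assoc[symmetric])
    also have "\<dots> = finprod ?G (\<lambda>\<tau>. partial_class i (insert \<sigma> W) \<tau> [^]\<^bsub>?G\<^esub> (a(\<sigma> := n)) \<tau>) (insert \<sigma> W)"
      unfolding qc
    proof (subst G.finprod_insert)
      show "?g [^]\<^bsub>?G\<^esub> n \<otimes>\<^bsub>?G\<^esub> finprod ?G (\<lambda>\<tau>. partial_class i (insert \<sigma> W) \<tau> [^]\<^bsub>?G\<^esub> a \<tau>) W
         = ?g [^]\<^bsub>?G\<^esub> (a(\<sigma> := n)) \<sigma> \<otimes>\<^bsub>?G\<^esub> finprod ?G (\<lambda>\<tau>. partial_class i (insert \<sigma> W) \<tau> [^]\<^bsub>?G\<^esub> (a(\<sigma> := n)) \<tau>) W"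
        using insert.hyps
        by (intro arg_cong2[where f = "mult ?G"] G.finprod_cong') (auto simp: partial_class_in)
    qed (use insert.hyps in \<open>auto simp: partial_class_in\<close>)
    finally show ?case by blast
  qed
qed

lemma partial_class_cells: "0 \<le> i \<Longrightarrow> partial_class i (cells \<Sigma> i) = cell_class \<Sigma> i"
  by (simp add: fun_eq_iff partial_class_def cell_class_def partial_skeleton_cells)

lemma cell_class_in: "cell_class \<Sigma> i \<sigma> \<in> carrier (skeletal_homology \<Sigma> i)"
  by (simp add: cell_class_def hom_induced_carrier)

lemma cell_classes_span:
  assumes "0 \<le> i" "c \<in> carrier (skeletal_homology \<Sigma> i)"
  shows "\<exists>a :: 'c \<Rightarrow> int. c = finprod (skeletal_homology \<Sigma> i)
      (\<lambda>\<sigma>. cell_class \<Sigma> i \<sigma> [^]\<^bsub>skeletal_homology \<Sigma> i\<^esub> a \<sigma>) (cells \<Sigma> i)"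
  using partial_classes_span[OF assms(1) subset_refl, of c] assms
  by (simp add: partial_skeleton_cells partial_class_cells)

text \<open>Relative to the complement of the open cell \<open>\<tau>\<close> all other cell classes vanish, while that of
  \<open>\<tau>\<close> generates an infinite cyclic group.\<close>

lemma cell_classes_independent:
  assumes i: "0 \<le> i" and \<tau>: "\<tau> \<in> cells \<Sigma> i"
    and 1: "finprod (skeletal_homology \<Sigma> i)
      (\<lambda>\<sigma>. cell_class \<Sigma> i \<sigma> [^]\<^bsub>skeletal_homology \<Sigma> i\<^esub> (a \<sigma> :: int)) (cells \<Sigma> i) = \<one>\<^bsub>skeletal_homology \<Sigma> i\<^esub>"
  shows "a \<tau> = 0"
proof -
  define W where "W = cells \<Sigma> i - {\<tau>}"
  have W: "insert \<tau> W = cells \<Sigma> i" "\<tau> \<notin> W" "finite W" using \<tau> finite_cells by (auto simp: W_def)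
  let ?Y = "skeleton_space \<Sigma> i" and ?B = "partial_skeleton i W" and ?A = "skeleton \<Sigma> (i - 1)"
  let ?G = "skeletal_homology \<Sigma> i" and ?H = "relative_homology_group i ?Y ?B"
  let ?p = "hom_induced i ?Y ?A ?Y ?B id"
  let ?\<kappa> = "\<lambda>\<sigma>. hom_induced i (disk (nat i)) (disk_boundary (nat i)) ?Y ?B (char_map \<Sigma> i \<sigma>)"
  have Y: "?Y = partial_space i (cells \<Sigma> i)" using i by (simp add: partial_skeleton_cells)
  interpret attached_cell ?Y ?B "nat i" "char_map \<Sigma> i \<tau>"
    unfolding Y using attached_cell_partial[OF i, of \<tau> W] W by simp
  interpret H: comm_group ?H by simp
  have pc: "?p (cell_class \<Sigma> i \<sigma>) = ?\<kappa> \<sigma> (orientation \<Sigma> i \<sigma>)" if "\<sigma> \<in> cells \<Sigma> i" for \<sigma>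
    using partial_class_include[OF i subset_refl that subset_refl skeleton_subset_partial[of i W]] i
    by (simp add: partial_skeleton_cells partial_class_cells)
  \<comment> \<open>The closed cell \<sigma> lies in the complement of the open cell \<tau>, so its
    class factors through the homology of that complement relative to itself, which is
    trivial.\<close>
  have triv: "?p (cell_class \<Sigma> i \<sigma>) = \<one>\<^bsub>?H\<^esub>" if \<sigma>: "\<sigma> \<in> W" for \<sigma>
  proof -
    have WC: "W \<subseteq> cells \<Sigma> i" and \<sigma>C: "\<sigma> \<in> cells \<Sigma> i" using W \<sigma> by auto
    let ?Z = "partial_space i W"
    have "trivial_group (relative_homology_group i ?Z ?B)"
      using trivial_relative_homology_group_topspace[of i ?Z] topspace_partial_space[OF i WC] by simp
    then have t: "hom_induced i (disk (nat i)) (disk_boundary (nat i)) ?Z ?B (char_map \<Sigma> i \<sigma>) (orientation \<Sigma> i \<sigma>)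
        = \<one>\<^bsub>relative_homology_group i ?Z ?B\<^esub>"
      using hom_induced_carrier[of i "disk (nat i)" "disk_boundary (nat i)" ?Z ?B "char_map \<Sigma> i \<sigma>"]
      by (simp add: trivial_group_def)
    have "?\<kappa> \<sigma> (orientation \<Sigma> i \<sigma>) = hom_induced i ?Z ?B ?Y ?B id
        (hom_induced i (disk (nat i)) (disk_boundary (nat i)) ?Z ?B (char_map \<Sigma> i \<sigma>) (orientation \<Sigma> i \<sigma>))"
    proof (subst hom_induced_compose')
      show "continuous_map (disk (nat i)) ?Z (char_map \<Sigma> i \<sigma>)"
        using char_continuous_partial[OF i WC \<sigma>] .
      show "char_map \<Sigma> i \<sigma> \<in> disk_boundary (nat i) \<rightarrow> ?B"
        using char_boundary[OF i \<sigma>C] skeleton_subset_partial[of i W] by (auto simp: image_subset_iff)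
      show "continuous_map ?Z ?Y id"
        unfolding Y using partial_skeleton_mono[OF WC, of i]
        by (auto simp: continuous_map_in_subtopology intro: continuous_map_from_subtopology)
    qed auto
    also have "\<dots> = \<one>\<^bsub>?H\<^esub>"
      unfolding t by (rule hom_one[OF hom_induced_hom]) simp_all
    finally show ?thesis using pc[OF \<sigma>C] by simp
  qed
  have "\<one>\<^bsub>?H\<^esub> = ?p (finprod ?G (\<lambda>\<sigma>. cell_class \<Sigma> i \<sigma> [^]\<^bsub>?G\<^esub> a \<sigma>) (cells \<Sigma> i))"
    unfolding 1 by (rule hom_one[OF hom_induced_hom, symmetric]) simp_all
  also have "\<dots> = finprod ?H (\<lambda>\<sigma>. ?p (cell_class \<Sigma> i \<sigma>) [^]\<^bsub>?H\<^esub> a \<sigma>) (cells \<Sigma> i)"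
    by (intro hom_finprod_pow hom_induced_hom) (auto simp: cell_class_in)
  also have "\<dots> = finprod ?H (\<lambda>\<sigma>. ?p (cell_class \<Sigma> i \<sigma>) [^]\<^bsub>?H\<^esub> a \<sigma>) (insert \<tau> W)" by (simp add: W)
  also have "\<dots> = ?p (cell_class \<Sigma> i \<tau>) [^]\<^bsub>?H\<^esub> a \<tau> \<otimes>\<^bsub>?H\<^esub> finprod ?H (\<lambda>\<sigma>. ?p (cell_class \<Sigma> i \<sigma>) [^]\<^bsub>?H\<^esub> a \<sigma>) W"
    using W by (subst H.finprod_insert) (auto simp: hom_induced_carrier)
  also have "finprod ?H (\<lambda>\<sigma>. ?p (cell_class \<Sigma> i \<sigma>) [^]\<^bsub>?H\<^esub> a \<sigma>) W = \<one>\<^bsub>?H\<^esub>"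
    by (rule H.finprod_one_eqI) (simp add: triv)
  also have "?p (cell_class \<Sigma> i \<tau>) [^]\<^bsub>?H\<^esub> a \<tau> \<otimes>\<^bsub>?H\<^esub> \<one>\<^bsub>?H\<^esub> = ?\<kappa> \<tau> (orientation \<Sigma> i \<tau> [^]\<^bsub>disk_homology i\<^esub> a \<tau>)"
    unfolding pc[OF \<tau>]
    by (subst hom_int_pow[OF hom_induced_hom]) (auto simp: orientation_in i \<tau> hom_induced_carrier)
  finally have \<kappa>0: "?\<kappa> \<tau> (orientation \<Sigma> i \<tau> [^]\<^bsub>disk_homology i\<^esub> a \<tau>) = ?\<kappa> \<tau> \<one>\<^bsub>disk_homology i\<^esub>"
    using hom_one[OF hom_induced_hom, of i "disk (nat i)" "disk_boundary (nat i)" ?Y ?B "char_map \<Sigma> i \<tau>"] by simp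
  have "inj_on (?\<kappa> \<tau>) (carrier (disk_homology i))"
    using iso_char[of i] i by (simp add: iso_def bij_betw_def)
  from inj_onD[OF this \<kappa>0] have "orientation \<Sigma> i \<tau> [^]\<^bsub>disk_homology i\<^esub> a \<tau> = \<one>\<^bsub>disk_homology i\<^esub>"
    by (simp add: group.int_pow_closed orientation_in i \<tau> group.is_monoid monoid.one_closed)
  then show ?thesis using orientation_free[OF i \<tau>] by blast
qed

end

section \<open>The cellular boundary\<close>

context comm_group
begin

definition combination :: "('i \<Rightarrow> 'a) \<Rightarrow> 'i set \<Rightarrow> ('i \<Rightarrow> int) \<Rightarrow> 'a" where
  "combination f I a = finprod G (\<lambda>i. f i [^] a i) I"

lemma combination_closed: "f \<in> I \<rightarrow> carrier G \<Longrightarrow> combination f I a \<in> carrier G"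
  unfolding combination_def by (intro finprod_closed) auto

lemma combination_cong: "f \<in> I \<rightarrow> carrier G \<Longrightarrow> (\<And>i. i \<in> I \<Longrightarrow> a i = b i) \<Longrightarrow> combination f I a = combination f I b"
  unfolding combination_def by (intro finprod_cong') auto

lemma combination_add:
  "f \<in> I \<rightarrow> carrier G \<Longrightarrow> combination f I (\<lambda>i. a i + b i) = combination f I a \<otimes> combination f I b"
proof -
  assume f: "f \<in> I \<rightarrow> carrier G"
  then have "combination f I (\<lambda>i. a i + b i) = finprod G (\<lambda>i. f i [^] a i \<otimes> f i [^] b i) I"
    unfolding combination_def by (intro finprod_cong') (auto simp: int_pow_mult Pi_iff)
  with f show ?thesis unfolding combination_def by (simp add: finprod_multf Pi_iff)
qed

lemma combination_power:
  assumes f: "f \<in> I \<rightarrow> carrier G"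
  shows "combination f I a [^] (k::int) = combination f I (\<lambda>i. k * a i)"
proof -
  have "(\<lambda>x. x [^] k) \<in> hom G G" by (auto simp: hom_def int_pow_mult_distrib m_comm)
  from hom_finprod_pow[OF comm_group_axioms comm_group_axioms this f, of a]
  have "combination f I a [^] k = finprod G (\<lambda>i. (f i [^] k) [^] a i) I"
    unfolding combination_def .
  also have "\<dots> = combination f I (\<lambda>i. k * a i)"
    unfolding combination_def using f by (intro finprod_cong') (auto simp: int_pow_pow Pi_iff)
  finally show ?thesis .
qed

text \<open>Substituting combinations into a combination multiplies coefficient matrices; this is
  how consecutive incidence matrices get multiplied. For infinite J the product and the sums take
  their default values, and both sides are the neutral element.\<close>

lemma combination_sum:
  assumes f: "f \<in> I \<rightarrow> carrier G"
  shows "finprod G (\<lambda>j. combination f I (m j) [^] (n j :: int)) J = combination f I (\<lambda>i. \<Sum>j\<in>J. n j * m j i)"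
proof (induction J rule: infinite_finite_induct)
  case (insert j J)
  then show ?case
    by (subst finprod_insert) (auto simp: combination_closed f combination_power combination_add)
next
  case empty
  have "combination f I (\<lambda>i. 0) = \<one>" unfolding combination_def by (rule finprod_one_eqI) simp
  then show ?case by simp
next
  case (infinite A)
  have "combination f I (\<lambda>i. 0) = \<one>" unfolding combination_def by (rule finprod_one_eqI) simp
  then show ?case using infinite by simp
qed

end

section \<open>Incidence numbers and the square of the boundary\<close>

context CW_complex
begin

lemma skeleton_mono: "i \<le> j \<Longrightarrow> skeleton \<Sigma> i \<subseteq> skeleton \<Sigma> j"
  unfolding skeleton_def by (intro UN_mono) auto

lemma subtopology_skeleton_space: "i \<le> j \<Longrightarrow> subtopology (skeleton_space \<Sigma> j) (skeleton \<Sigma> i) = skeleton_space \<Sigma> i"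
  using skeleton_mono[of i j] by (simp add: subtopology_subtopology Int_absorb1)

lemma cell_class_Pi: "cell_class \<Sigma> i \<in> I \<rightarrow> carrier (skeletal_homology \<Sigma> i)"
  by (simp add: cell_class_in)

abbreviation "relboundary i \<equiv> hom_relboundary i (skeleton_space \<Sigma> i) (skeleton \<Sigma> (i - 1)) (skeleton \<Sigma> (i - 2))"

lemma relboundary_hom:
  "relboundary i \<in> hom (skeletal_homology \<Sigma> i) (skeletal_homology \<Sigma> (i - 1))"
  using group_homomorphism_hom_relboundary[of i "skeleton_space \<Sigma> i" "skeleton \<Sigma> (i - 1)" "skeleton \<Sigma> (i - 2)"]
  by (simp add: subtopology_skeleton_space)

text \<open>Spanning gives existence and independence gives uniqueness, so the definite description
  behind \<open>incidence\<close> denotes.\<close>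

lemma incidence_spec:
  assumes "1 \<le> i"
  shows "relboundary i (cell_class \<Sigma> i \<sigma>) =
    comm_group.combination (skeletal_homology \<Sigma> (i - 1)) (cell_class \<Sigma> (i - 1)) (cells \<Sigma> (i - 1)) (incidence \<Sigma> i \<sigma>)"
proof -
  let ?G = "skeletal_homology \<Sigma> (i - 1)" and ?C = "cells \<Sigma> (i - 1)" and ?c = "cell_class \<Sigma> (i - 1)"
  interpret comm_group ?G by simp
  let ?b = "relboundary i (cell_class \<Sigma> i \<sigma>)"
  let ?P = "\<lambda>a. (\<forall>\<tau>. \<tau> \<notin> ?C \<longrightarrow> a \<tau> = 0) \<and> ?b = combination ?c ?C a"
  have "?b \<in> carrier ?G"
    using relboundary_hom[of i] cell_class_in[of i \<sigma>] by (simp add: hom_def Pi_iff)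
  then obtain a :: "'c \<Rightarrow> int" where a: "?b = combination ?c ?C a"
    using cell_classes_span[of "i - 1" ?b] assms unfolding combination_def by auto
  have "\<exists>!a. ?P a"
  proof (rule ex_ex1I)
    \<comment> \<open>Coefficients outside the cells are set to 0, as the definition of
      \<open>incidence\<close> asks; left arbitrary they would destroy uniqueness.\<close>
    have "combination ?c ?C a = combination ?c ?C (\<lambda>\<tau>. if \<tau> \<in> ?C then a \<tau> else 0)"
      by (rule combination_cong[OF cell_class_Pi]) simp
    then have "?P (\<lambda>\<tau>. if \<tau> \<in> ?C then a \<tau> else 0)" using a by simp
    then show "\<exists>a. ?P a" by (rule exI[where P = ?P])
  next
    fix a b assume a: "?P a" and b: "?P b"
    have "combination ?c ?C (\<lambda>\<tau>. (a \<tau> - b \<tau>) + b \<tau>) = combination ?c ?C (\<lambda>\<tau>. a \<tau> - b \<tau>) \<otimes>\<^bsub>?G\<^esub> combination ?c ?C b"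
      by (rule combination_add[OF cell_class_Pi])
    then have "combination ?c ?C b = combination ?c ?C (\<lambda>\<tau>. a \<tau> - b \<tau>) \<otimes>\<^bsub>?G\<^esub> combination ?c ?C b"
      using a b by simp
    then have "combination ?c ?C (\<lambda>\<tau>. a \<tau> - b \<tau>) = \<one>\<^bsub>?G\<^esub>"
      using r_cancel_one'[OF combination_closed[OF cell_class_Pi] combination_closed[OF cell_class_Pi]] by simp
    then have "a \<tau> - b \<tau> = 0" if "\<tau> \<in> ?C" for \<tau>
      using cell_classes_independent[of "i - 1" \<tau> "\<lambda>\<tau>. a \<tau> - b \<tau>"] that assms
      unfolding combination_def by simp
    with a b show "a = b" by (metis eq_iff_diff_eq_0 ext)
  qed
  then have "?P (THE a. ?P a)" by (rule theI')
  moreover have "incidence \<Sigma> i \<sigma> = (THE a. ?P a)"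
    using assms unfolding incidence_def combination_def by simp
  ultimately show ?thesis by simp
qed

text \<open>The connecting map is the boundary into the homology of the lower skeleton followed by
  passage to relative homology. In its square this passage meets the next boundary, and these two
  are consecutive in the exact sequence of a pair.\<close>

lemma relboundary_relboundary:
  assumes "c \<in> carrier (skeletal_homology \<Sigma> i)"
  shows "relboundary (i - 1) (relboundary i c) = \<one>\<^bsub>skeletal_homology \<Sigma> (i - 2)\<^esub>"
proof -
  let ?Y = "skeleton_space \<Sigma> (i - 1)" and ?S = "skeleton \<Sigma> (i - 2)"
  let ?z = "hom_boundary i (skeleton_space \<Sigma> i) (skeleton \<Sigma> (i - 1)) c"
  have sub: "subtopology (skeleton_space \<Sigma> i) (skeleton \<Sigma> (i - 1)) = ?Y" "subtopology ?Y ?S = skeleton_space \<Sigma> (i - 2)"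
    by (simp_all add: subtopology_skeleton_space)
  have z: "?z \<in> carrier (homology_group (i - 1) ?Y)"
    using hom_boundary_carrier[of i "skeleton_space \<Sigma> i" "skeleton \<Sigma> (i - 1)" c] by (simp add: sub)
  have "hom_induced (i - 1) ?Y {} ?Y ?S id ` carrier (homology_group (i - 1) ?Y)
      = kernel (relative_homology_group (i - 1) ?Y ?S) (homology_group (i - 1 - 1) (subtopology ?Y ?S)) (hom_boundary (i - 1) ?Y ?S)"
    using homology_exactness_axiom_1[of "i - 1" ?Y ?S] by simp
  with z have "hom_induced (i - 1) ?Y {} ?Y ?S id ?z
      \<in> kernel (relative_homology_group (i - 1) ?Y ?S) (homology_group (i - 1 - 1) (subtopology ?Y ?S)) (hom_boundary (i - 1) ?Y ?S)"
    by blast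
  then have "hom_boundary (i - 1) ?Y ?S (hom_induced (i - 1) ?Y {} ?Y ?S id ?z) = \<one>\<^bsub>homology_group (i - 2) (skeleton_space \<Sigma> (i - 2))\<^esub>"
    unfolding kernel_def sub by simp
  then show ?thesis
    using hom_one[OF hom_induced_hom, of "i - 2" "skeleton_space \<Sigma> (i - 2)" "{}" "skeleton_space \<Sigma> (i - 2)" "skeleton \<Sigma> (i - 3)" id]
    by (simp add: hom_relboundary_def sub)
qed

text \<open>Boundary squared is expanded in the cell classes of dimension i - 2, whose independence
  lets the coefficients be compared.\<close>

lemma incidence_incidence_ge_2:
  assumes i: "2 \<le> i" and \<rho>: "\<rho> \<in> cells \<Sigma> (i - 2)"
  shows "(\<Sum>\<tau>\<in>cells \<Sigma> (i - 1). incidence \<Sigma> i \<sigma> \<tau> * incidence \<Sigma> (i - 1) \<tau> \<rho>) = 0"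
proof -
  let ?G = "skeletal_homology \<Sigma> (i - 1)" and ?H = "skeletal_homology \<Sigma> (i - 2)"
  interpret G: comm_group ?G by simp
  interpret H: comm_group ?H by simp
  have hom: "relboundary (i - 1) \<in> hom ?G ?H" using relboundary_hom[of "i - 1"] by simp
  have spec: "relboundary i (cell_class \<Sigma> i \<sigma>)
      = finprod ?G (\<lambda>\<tau>. cell_class \<Sigma> (i - 1) \<tau> [^]\<^bsub>?G\<^esub> incidence \<Sigma> i \<sigma> \<tau>) (cells \<Sigma> (i - 1))"
    using incidence_spec[of i \<sigma>] i unfolding G.combination_def by simp
  have "\<one>\<^bsub>?H\<^esub> = relboundary (i - 1) (relboundary i (cell_class \<Sigma> i \<sigma>))"
    by (simp only: relboundary_relboundary cell_class_in)
  also have "\<dots> = finprod ?H (\<lambda>\<tau>. relboundary (i - 1) (cell_class \<Sigma> (i - 1) \<tau>) [^]\<^bsub>?H\<^esub> incidence \<Sigma> i \<sigma> \<tau>) (cells \<Sigma> (i - 1))"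
    unfolding spec by (rule hom_finprod_pow[OF G.comm_group_axioms H.comm_group_axioms hom cell_class_Pi])
  also have "\<dots> = finprod ?H (\<lambda>\<tau>. H.combination (cell_class \<Sigma> (i - 2)) (cells \<Sigma> (i - 2)) (incidence \<Sigma> (i - 1) \<tau>)
      [^]\<^bsub>?H\<^esub> incidence \<Sigma> i \<sigma> \<tau>) (cells \<Sigma> (i - 1))"
    using i incidence_spec[of "i - 1"] by simp
  also have "\<dots> = H.combination (cell_class \<Sigma> (i - 2)) (cells \<Sigma> (i - 2))
      (\<lambda>\<rho>. \<Sum>\<tau>\<in>cells \<Sigma> (i - 1). incidence \<Sigma> i \<sigma> \<tau> * incidence \<Sigma> (i - 1) \<tau> \<rho>)"
    by (rule H.combination_sum[OF cell_class_Pi])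
  finally have "H.combination (cell_class \<Sigma> (i - 2)) (cells \<Sigma> (i - 2))
      (\<lambda>\<rho>. \<Sum>\<tau>\<in>cells \<Sigma> (i - 1). incidence \<Sigma> i \<sigma> \<tau> * incidence \<Sigma> (i - 1) \<tau> \<rho>) = \<one>\<^bsub>?H\<^esub>" ..
  from cell_classes_independent[OF _ \<rho> this[unfolded H.combination_def]] i show ?thesis by simp
qed

text \<open>The augmentation is not a connecting map, so this case is separate. Under a map to a
  point all vertex classes go to the same generator, by the common orientation of the vertices,
  whereas the boundary of an edge is already trivial in the homology of the 1-skeleton.\<close>

lemma incidence_incidence_1:
  assumes \<sigma>: "\<sigma> \<in> cells \<Sigma> 1"
  shows "(\<Sum>\<tau>\<in>cells \<Sigma> 0. incidence \<Sigma> 1 \<sigma> \<tau>) = 0"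
proof (cases "cells \<Sigma> 0 = {}")
  case False
  then obtain \<tau>\<^sub>0 where \<tau>\<^sub>0: "\<tau>\<^sub>0 \<in> cells \<Sigma> 0" by blast
  define or where "or = orientation \<Sigma> 0 \<tau>\<^sub>0"
  have or: "orientation \<Sigma> 0 \<tau> = or" if "\<tau> \<in> cells \<Sigma> 0" for \<tau>
    using CW that \<tau>\<^sub>0 unfolding or_def finite_CW_def by blast
  let ?Y = "skeleton_space \<Sigma> 0" and ?Z = "skeleton_space \<Sigma> 1" and ?D = "disk 0"
  let ?G = "homology_group 0 ?Y" and ?H = "homology_group 0 ?D"
  \<comment> \<open>The target is \<open>disk 0\<close>, the one-point space in whose homology the
    orientations of vertices live.\<close>
  define pt :: "'a \<Rightarrow> nat \<Rightarrow> real" where "pt = (\<lambda>_ _. 0)"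
  have empty: "skeleton \<Sigma> (-1) = {}" by (simp add: skeleton_def)
  have D: "topspace ?D = {\<lambda>_. 0}" by (auto simp: topspace_disk)
  have bd: "disk_boundary 0 = {}" by (auto simp: in_disk_boundary_iff radius_def)
  have pt: "continuous_map W ?D pt" for W unfolding pt_def by (simp add: D)
  have sub: "subtopology ?Z (skeleton \<Sigma> 0) = ?Y" by (simp add: subtopology_skeleton_space)
  interpret G: comm_group ?G by simp
  interpret H: comm_group ?H by simp
  let ?e = "hom_induced 0 ?Y {} ?D {} pt"
  have e: "?e (cell_class \<Sigma> 0 \<tau>) = or" if \<tau>: "\<tau> \<in> cells \<Sigma> 0" for \<tau>
  proof -
    have "?e (cell_class \<Sigma> 0 \<tau>) = hom_induced 0 ?D {} ?D {} (pt \<circ> char_map \<Sigma> 0 \<tau>) (orientation \<Sigma> 0 \<tau>)"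
      unfolding cell_class_def using char_continuous_partial[of 0 "cells \<Sigma> 0" \<tau>] \<tau> pt
      by (simp add: bd empty hom_induced_compose' partial_skeleton_cells)
    also have "\<dots> = orientation \<Sigma> 0 \<tau>"
    proof (rule hom_induced_id_gen)
      show "continuous_map ?D ?D (pt \<circ> char_map \<Sigma> 0 \<tau>)" by (simp add: D pt_def o_def)
      show "orientation \<Sigma> 0 \<tau> \<in> carrier ?H" using orientation_in[of 0 \<tau>] \<tau> by (simp add: bd)
    qed (auto simp: D pt_def)
    finally show ?thesis using or[OF \<tau>] by simp
  qed
  have orc: "or \<in> carrier ?H" using orientation_in[of 0 \<tau>\<^sub>0] \<tau>\<^sub>0 by (simp add: bd or_def)
  let ?z = "hom_boundary 1 ?Z (skeleton \<Sigma> 0) (cell_class \<Sigma> 1 \<sigma>)"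
  have z: "?z = G.combination (cell_class \<Sigma> 0) (cells \<Sigma> 0) (incidence \<Sigma> 1 \<sigma>)"
    using incidence_spec[of 1 \<sigma>] by (simp add: empty hom_relboundary_empty)
  have "hom_boundary 1 ?Z (skeleton \<Sigma> 0) ` carrier (relative_homology_group 1 ?Z (skeleton \<Sigma> 0))
      = kernel ?G (homology_group 0 ?Z) (hom_induced 0 ?Y {} ?Z {} id)"
    using homology_exactness_axiom_2[of 1 ?Z "skeleton \<Sigma> 0"] by (simp add: sub)
  then have "?z \<in> kernel ?G (homology_group 0 ?Z) (hom_induced 0 ?Y {} ?Z {} id)"
    using cell_class_in[of 1 \<sigma>] by auto
  then have "hom_induced 0 ?Y {} ?Z {} id ?z = \<one>\<^bsub>homology_group 0 ?Z\<^esub>" by (simp add: kernel_def)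
  moreover have "?e ?z = hom_induced 0 ?Z {} ?D {} pt (hom_induced 0 ?Y {} ?Z {} id ?z)"
  proof (subst hom_induced_compose')
    show "continuous_map ?Y ?Z id"
      using skeleton_mono[of 0 1] by (auto simp: continuous_map_in_subtopology intro: continuous_map_from_subtopology)
  qed (auto simp: pt)
  ultimately have "?e ?z = \<one>\<^bsub>?H\<^esub>"
    using hom_one[OF hom_induced_hom, of 0 ?Z "{}" ?D "{}" pt] by simp
  moreover have "?e ?z = finprod ?H (\<lambda>\<tau>. ?e (cell_class \<Sigma> 0 \<tau>) [^]\<^bsub>?H\<^esub> incidence \<Sigma> 1 \<sigma> \<tau>) (cells \<Sigma> 0)"
    unfolding z G.combination_def using cell_class_Pi[of 0]
    by (intro hom_finprod_pow hom_induced_hom) (simp_all add: empty)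
  moreover have "finprod ?H (\<lambda>\<tau>. ?e (cell_class \<Sigma> 0 \<tau>) [^]\<^bsub>?H\<^esub> incidence \<Sigma> 1 \<sigma> \<tau>) (cells \<Sigma> 0)
      = finprod ?H (\<lambda>\<tau>. or [^]\<^bsub>?H\<^esub> incidence \<Sigma> 1 \<sigma> \<tau>) (cells \<Sigma> 0)"
    using orc by (intro H.finprod_cong') (auto simp: e)
  moreover have "finprod ?H (\<lambda>\<tau>. or [^]\<^bsub>?H\<^esub> incidence \<Sigma> 1 \<sigma> \<tau>) T = or [^]\<^bsub>?H\<^esub> (\<Sum>\<tau>\<in>T. incidence \<Sigma> 1 \<sigma> \<tau>)"
    for T
  proof (induction T rule: infinite_finite_induct)
    case (insert \<tau> T)
    then show ?case using orc by (subst H.finprod_insert) (auto simp: H.int_pow_mult)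
  qed simp_all
  ultimately have "or [^]\<^bsub>?H\<^esub> (\<Sum>\<tau>\<in>cells \<Sigma> 0. incidence \<Sigma> 1 \<sigma> \<tau>) = \<one>\<^bsub>?H\<^esub>" by simp
  then show ?thesis using orientation_free[of 0 \<tau>\<^sub>0] \<tau>\<^sub>0 by (simp add: bd or_def)
qed simp

theorem incidence_incidence:
  assumes \<sigma>: "\<sigma> \<in> cells \<Sigma> i" and \<rho>: "\<rho> \<in> cells \<Sigma> (i - 2)"
  shows "(\<Sum>\<tau>\<in>cells \<Sigma> (i - 1). incidence \<Sigma> i \<sigma> \<tau> * incidence \<Sigma> (i - 1) \<tau> \<rho>) = 0"
proof -
  have "\<forall>i < -1. cells \<Sigma> i = {}" using CW by (simp add: finite_CW_def)
  with \<rho> have "\<not> i - 2 < -1" by blast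
  then consider "2 \<le> i" | "i = 1" by linarith
  then show ?thesis
  proof cases
    case 2
    then show ?thesis using incidence_incidence_1[of \<sigma>] \<sigma> by (simp add: incidence_def[of \<Sigma> 0])
  qed (use incidence_incidence_ge_2 \<rho> in blast)
qed

end

section \<open>The diagram of a CW complex\<close>

text \<open>Turns membership of a coset in the critical group into a condition on its
  representative, for the description of q on cosets.\<close>

lemma coset_in_image_iff:
  assumes "real_subgroup S" "real_subgroup N" "N \<subseteq> S"
  shows "coset N u \<in> coset N ` S \<longleftrightarrow> u \<in> S"
proof
  assume "coset N u \<in> coset N ` S"
  then obtain v where v: "v \<in> S" "(\<lambda>\<sigma>. u \<sigma> - v \<sigma>) \<in> N" using coset_eq_iff[OF assms(2)] by blast
  with real_subgroup_add[OF assms(1) _ v(1), of "\<lambda>\<sigma>. u \<sigma> - v \<sigma>"] assms(3) show "u \<in> S" by auto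
qed simp

context CW_complex
begin

lemma bd_eq: "bd \<Sigma> i = int_map (cells \<Sigma> i) (cells \<Sigma> (i - 1)) (incidence \<Sigma> i)"
  by (simp add: bd_def int_map_def fun_eq_iff)

lemma cobd_eq: "cobd \<Sigma> i = int_map (cells \<Sigma> (i - 1)) (cells \<Sigma> i) (\<lambda>\<tau> \<sigma>. incidence \<Sigma> i \<sigma> \<tau>)"
  by (simp add: cobd_def int_map_def fun_eq_iff)

lemma int_chains_eq: "int_chains \<Sigma> i = ints (cells \<Sigma> i)"
  by (simp add: int_chains_def ints_def)

lemma bd_bd: "bd \<Sigma> (i - 1) (bd \<Sigma> i c) = (\<lambda>_. 0)"
proof
  fix \<rho>
  show "bd \<Sigma> (i - 1) (bd \<Sigma> i c) \<rho> = 0"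
  proof (cases "\<rho> \<in> cells \<Sigma> (i - 1 - 1)")
    case True
    have "bd \<Sigma> (i - 1) (bd \<Sigma> i c) \<rho>
        = (\<Sum>\<tau>\<in>cells \<Sigma> (i - 1). \<Sum>\<sigma>\<in>cells \<Sigma> i. of_int (incidence \<Sigma> i \<sigma> \<tau> * incidence \<Sigma> (i - 1) \<tau> \<rho>) * c \<sigma>)"
      using True by (simp add: bd_def sum_distrib_left ac_simps)
    also have "\<dots> = (\<Sum>\<sigma>\<in>cells \<Sigma> i. of_int (\<Sum>\<tau>\<in>cells \<Sigma> (i - 1). incidence \<Sigma> i \<sigma> \<tau> * incidence \<Sigma> (i - 1) \<tau> \<rho>) * c \<sigma>)"
      by (subst sum.swap) (simp add: sum_distrib_right)
    also have "\<dots> = 0"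
      using True incidence_incidence[of _ i \<rho>] by (intro sum.neutral) (simp add: ac_simps)
    finally show ?thesis .
  qed (simp add: bd_def)
qed

text \<open>The cycles contain the boundaries by \<open>bd_bd\<close>, and they are saturated since
  a positive factor can be cancelled in the cycle equation.\<close>

lemma cut_flow: "cut_flow (cells \<Sigma> d) (cells \<Sigma> (d - 1)) (incidence \<Sigma> d) (ker_bd \<Sigma> (d - 1))"
proof
  show "real_subgroup (ker_bd \<Sigma> (d - 1))"
    using real_subgroup_ints[of "cells \<Sigma> (d - 1)"]
    unfolding real_subgroup_def ker_bd_def int_chains_eq bd_eq by (auto simp: int_map_diff)
  show "int_map (cells \<Sigma> d) (cells \<Sigma> (d - 1)) (incidence \<Sigma> d) ` ints (cells \<Sigma> d) \<subseteq> ker_bd \<Sigma> (d - 1)"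
    unfolding ker_bd_def int_chains_eq using bd_bd[of d] int_map_ints by (fastforce simp: bd_eq[of d])
  fix u and n :: nat
  assume u: "u \<in> ints (cells \<Sigma> (d - 1))" "n > 0" "(\<lambda>\<sigma>. real n * u \<sigma>) \<in> ker_bd \<Sigma> (d - 1)"
  then have "(\<lambda>\<sigma>. real n * bd \<Sigma> (d - 1) u \<sigma>) = (\<lambda>_. 0)"
    by (simp add: ker_bd_def bd_eq int_map_scale)
  with u show "u \<in> ker_bd \<Sigma> (d - 1)" by (simp add: ker_bd_def int_chains_eq fun_eq_iff)
qed (auto simp: finite_cells ker_bd_def int_chains_eq)

end

theorem theorem7p6:
  fixes \<Sigma> :: "('a, 'c) oriented_CW" and d :: int
    and Zn C F Cdual :: "('c \<Rightarrow> real) set" and CF :: "('c \<Rightarrow> real) set"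
  assumes "finite_CW \<Sigma>"
    and "CW_dimension \<Sigma> d"
  defines "Zn \<equiv> int_chains \<Sigma> d"
    and "C \<equiv> cut_lattice \<Sigma> d"
    and "F \<equiv> flow_lattice \<Sigma> d"
    and "CF \<equiv> C <#>\<^bsub>vec_group Zn\<^esub> F"
    and "Cdual \<equiv> dual_lattice (cells \<Sigma> d) C"
  shows "C \<inter> F = {\<lambda>_. 0} \<and>
    (\<exists>\<psi> \<phi> j q \<alpha> \<beta> \<gamma>.
       short_exact_sequence
         (torsion_subgroup (cell_cohomology \<Sigma> d)) (vec_group Cdual Mod C) (vec_group Zn Mod CF) \<phi> \<psi> \<and>
       short_exact_sequence
         (torsion_subgroup (cell_homology \<Sigma> (d - 1))) (critical_group \<Sigma> d)
         (vec_group (im_bd \<Sigma> d) Mod im_bd_cobd \<Sigma> d) q j \<and>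
       \<alpha> \<in> iso (vec_group Zn Mod CF) (vec_group (im_bd \<Sigma> d) Mod im_bd_cobd \<Sigma> d) \<and>
       \<beta> \<in> iso (vec_group Cdual Mod C) (critical_group \<Sigma> d) \<and>
       \<gamma> \<in> iso (torsion_subgroup (cell_cohomology \<Sigma> d)) (torsion_subgroup (cell_homology \<Sigma> (d - 1))) \<and>
       (\<forall>x \<in> carrier (vec_group Zn Mod CF). \<beta> (\<psi> x) = j (\<alpha> x)) \<and>
       (\<forall>y \<in> carrier (vec_group Cdual Mod C). \<gamma> (\<phi> y) = q (\<beta> y)) \<and>
       (\<forall>v \<in> Zn. \<psi> (CF #>\<^bsub>vec_group Zn\<^esub> v) =
          C #>\<^bsub>vec_group Cdual\<^esub> orth_proj (cells \<Sigma> d) (real_span C) v) \<and>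
       (\<forall>u \<in> im_bd \<Sigma> d. j (im_bd_cobd \<Sigma> d #>\<^bsub>vec_group (im_bd \<Sigma> d)\<^esub> u) =
          im_bd_cobd \<Sigma> d #>\<^bsub>vec_group (ker_bd \<Sigma> (d - 1))\<^esub> u) \<and>
       (\<forall>u \<in> ker_bd \<Sigma> (d - 1).
          im_bd_cobd \<Sigma> d #>\<^bsub>vec_group (ker_bd \<Sigma> (d - 1))\<^esub> u \<in> carrier (critical_group \<Sigma> d) \<longrightarrow>
          q (im_bd_cobd \<Sigma> d #>\<^bsub>vec_group (ker_bd \<Sigma> (d - 1))\<^esub> u) =
            im_bd \<Sigma> d #>\<^bsub>vec_group (ker_bd \<Sigma> (d - 1))\<^esub> u)) \<and>
    critical_group \<Sigma> d \<cong> vec_group Cdual Mod C"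
proof -
  interpret CW_complex \<Sigma> by unfold_locales fact
  interpret L: cut_flow "cells \<Sigma> d" "cells \<Sigma> (d - 1)" "incidence \<Sigma> d" "ker_bd \<Sigma> (d - 1)" by (rule cut_flow)
  let ?K = "ker_bd \<Sigma> (d - 1)"
  have Zn: "Zn = ints (cells \<Sigma> d)" by (simp add: Zn_def int_chains_eq)
  have C: "C = L.cuts" by (simp add: C_def cut_lattice_def im_cobd_def cobd_eq int_chains_eq)
  have F: "F = L.flows" by (simp add: F_def flow_lattice_def ker_bd_def bd_eq int_chains_eq)
  have CF: "CF = L.CF" unfolding CF_def L.CF_def C F Zn ..
  have Cdual: "Cdual = L.Cdual" unfolding Cdual_def C ..
  have im: "im_bd \<Sigma> d = L.bounds" by (simp add: im_bd_def L.bounds_def bd_eq int_chains_eq)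
  have lap: "im_bd_cobd \<Sigma> d = L.Lap" by (simp add: im_bd_cobd_def L.Lap_def bd_eq cobd_eq int_chains_eq)
  have crit: "critical_group \<Sigma> d = vec_group (saturation ?K L.Lap) Mod L.Lap"
    unfolding critical_group_def lap by (rule torsion_quotient[OF L.subgroup_Lap])
  have hom: "torsion_subgroup (cell_homology \<Sigma> (d - 1)) = vec_group (saturation ?K L.bounds) Mod L.bounds"
    using torsion_quotient[OF L.subgroup_bounds] by (simp add: cell_homology_def im)
  \<comment> \<open>In the top dimension every cochain is a cocycle, so the cohomology is the whole
    cokernel of the coboundary map.\<close>
  have "cells \<Sigma> (d + 1) = {}" using assms(2) by (simp add: CW_dimension_def)
  then have "ker_cobd \<Sigma> (d + 1) = ints (cells \<Sigma> d)" by (auto simp: ker_cobd_def cobd_def int_chains_eq)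
  then have cohom: "torsion_subgroup (cell_cohomology \<Sigma> d) = vec_group (saturation (ints (cells \<Sigma> d)) C) Mod C"
    using torsion_quotient[OF L.subgroup_cuts] unfolding C by (simp add: cell_cohomology_def C[symmetric] C_def cut_lattice_def)
  have "\<exists>\<phi> \<gamma>.
    short_exact_sequence (torsion_subgroup (cell_cohomology \<Sigma> d)) (vec_group Cdual Mod C) (vec_group Zn Mod CF)
      \<phi> (induced C L.proj) \<and>
    \<gamma> \<in> iso (torsion_subgroup (cell_cohomology \<Sigma> d)) (torsion_subgroup (cell_homology \<Sigma> (d - 1))) \<and>
    (\<forall>x\<in>carrier (vec_group Zn Mod CF).
      induced L.Lap L.D (induced C L.proj x) = induced L.Lap (\<lambda>u. u) (induced L.Lap L.D x)) \<and>
    (\<forall>y\<in>carrier (vec_group Cdual Mod C). \<gamma> (\<phi> y) = induced L.bounds (\<lambda>u. u) (induced L.Lap L.D y))"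
    unfolding hom cohom Zn CF Cdual C by (rule L.cut_flow_diagram)
  then obtain \<phi> \<gamma> where diagram:
    "short_exact_sequence (torsion_subgroup (cell_cohomology \<Sigma> d)) (vec_group Cdual Mod C) (vec_group Zn Mod CF)
       \<phi> (induced C L.proj)"
    "\<gamma> \<in> iso (torsion_subgroup (cell_cohomology \<Sigma> d)) (torsion_subgroup (cell_homology \<Sigma> (d - 1)))"
    "\<forall>x\<in>carrier (vec_group Zn Mod CF).
       induced L.Lap L.D (induced C L.proj x) = induced L.Lap (\<lambda>u. u) (induced L.Lap L.D x)"
    "\<forall>y\<in>carrier (vec_group Cdual Mod C). \<gamma> (\<phi> y) = induced L.bounds (\<lambda>u. u) (induced L.Lap L.D y)"
    by blast
  have \<alpha>: "induced L.Lap L.D \<in> iso (vec_group Zn Mod CF) (vec_group (im_bd \<Sigma> d) Mod im_bd_cobd \<Sigma> d)"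
    unfolding Zn CF im lap by (rule L.\<alpha>_iso)
  have \<beta>: "induced L.Lap L.D \<in> iso (vec_group Cdual Mod C) (critical_group \<Sigma> d)"
    unfolding crit Cdual C by (rule L.\<beta>_iso)
  have row: "short_exact_sequence (torsion_subgroup (cell_homology \<Sigma> (d - 1))) (critical_group \<Sigma> d)
      (vec_group (im_bd \<Sigma> d) Mod im_bd_cobd \<Sigma> d) (induced L.bounds (\<lambda>u. u)) (induced L.Lap (\<lambda>u. u))"
    unfolding hom crit im lap by (rule L.exact_row)
  have \<psi>: "\<forall>v\<in>Zn. induced C L.proj (CF #>\<^bsub>vec_group Zn\<^esub> v)
      = C #>\<^bsub>vec_group Cdual\<^esub> orth_proj (cells \<Sigma> d) (real_span C) v"
    unfolding r_coset_vec_group Zn CF C by (simp add: L.\<psi>.induced_coset)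
  have j: "\<forall>u\<in>im_bd \<Sigma> d. induced L.Lap (\<lambda>u. u) (im_bd_cobd \<Sigma> d #>\<^bsub>vec_group (im_bd \<Sigma> d)\<^esub> u)
      = im_bd_cobd \<Sigma> d #>\<^bsub>vec_group ?K\<^esub> u"
    unfolding r_coset_vec_group im lap by (simp add: L.j.induced_coset)
  have q: "\<forall>u\<in>?K. im_bd_cobd \<Sigma> d #>\<^bsub>vec_group ?K\<^esub> u \<in> carrier (critical_group \<Sigma> d) \<longrightarrow>
      induced L.bounds (\<lambda>u. u) (im_bd_cobd \<Sigma> d #>\<^bsub>vec_group ?K\<^esub> u) = im_bd \<Sigma> d #>\<^bsub>vec_group ?K\<^esub> u"
    unfolding r_coset_vec_group crit im lap carrier_quotient
    by (simp add: coset_in_image_iff L.q.X L.q.N L.q.induced_coset)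
  have "group (vec_group Cdual Mod C)"
    unfolding Cdual C by (intro group_quotient L.subgroup_Cdual L.subgroup_cuts L.cuts_Cdual)
  then have "critical_group \<Sigma> d \<cong> vec_group Cdual Mod C"
    using group.iso_sym \<beta> is_isoI by blast
  moreover have "C \<inter> F = {\<lambda>_. 0}" unfolding C F by (rule L.cuts_flows)
  ultimately show ?thesis
    using diagram row \<alpha> \<beta> \<psi> j q by (intro conjI exI)
qed

end
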